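(* Let $\mathcal{G}=(V,\mathcal{E})$ be a connected graph with countable vertex set and bounded degree, endowed with a weight function $a$ whose weights are bounded from above and from below (there are constants $0<m\le M<\infty$ with $m\le a_{x,y}\le M$ for every edge $\{x,y\}\in\mathcal{E}$), satisfying the isoperimetric inequality $IS_6$: there exists $\kappa>0$ such that $$\mu(A)^{1-1/6}\le\kappa\cdot a(A)\quad\text{for every finite }A\subset V.$$ Endow $\mathbb{Z}$ (with edges between integers at distance $1$) with the canonical weights $1_{\{|i-j|=1\}}$. Then the critical value $u_*$ for percolation of the vacant set of random interlacements on the product weighted graph $\mathcal{G}\times\mathbb{Z}$ is positive.
   Context: Weighted graphs. A weighted graph is a connected graph $(V,\mathcal{E})$ with $V$ countable and $\mathcal{E}\subset\{\{x,y\}\subset V;\ x\neq y\}$, together with a weight function, i.e. a symmetric map $a:V\times V\to\mathbb{R}_+$ with $a_{x,y}>0$ iff $\{x,y\}\in\mathcal{E}$; $x\leftrightarrow y$ means $\{x,y\}\in\mathcal{E}$. Put $\mu_x=\sum_{y:\{x,y\}\in\mathcal{E}}a_{x,y}$; for finite $A\subset V$, $\mu(A)=\sum_{x\in A}\mu_x$ and $a(A)=\sum_{x\in A,\,y\in A^c}a_{x,y}$. The degree of a vertex is the number of edges incident to it. The weighted graph is transient if the random walk with transition probabilities $a_{x,y}/\mu_x$ is transient (random interlacements are defined on transient weighted graphs; $\mathcal{G}\times\mathbb{Z}$ is transient under the hypotheses of the claim). Products. For weighted graphs $\mathcal{G}$, $\mathcal{G}'$ with weights $a,a'$, the product $\mathcal{G}\times\mathcal{G}'$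 has as vertices the pairs $(x,x')$; $(x,x')$ and $(y,y')$ are neighbors if ($x\leftrightarrow y$ and $x'=y'$) or ($x=y$ and $x'\leftrightarrow y'$), with weight $a(x,y)1_{\{x'=y'\}}+1_{\{x=y\}}a'(x',y')$. Random interlacements on a transient weighted graph with vertex set $V$. For finite $K\subset V$, $\mathrm{cap}(K)=\inf\{\frac12\sum_{x,y\in V}|f(x)-f(y)|^2a_{x,y};\ f:V\to\mathbb{R}\text{ finitely supported},\ f\equiv1\text{ on }K\}$. With $P_x$ the law of the walk from $x$, $\widetilde H_K=\inf\{n\ge1;X_n\in K\}$ and $e_K(x)=1_{\{x\in K\}}P_x[\widetilde H_K=\infty]\mu_x$, one has $\mathrm{cap}(K)=\sum_{x\in K}e_K(x)$. $W_+$ (resp. $W$) is the set of nearest-neighbor trajectories indexed by $\mathbb{N}=\{0,1,\dots\}$ (resp. $\mathbb{Z}$) that visit each vertex only finitely many times, with the $\sigma$-algebra generated by the canonical coordinates $X_n$. $W^*$ is the quotient of $W$ by time shift, with projection $\pi^*$ and the $\sigma$-algebra $\{A;(\pi^* )^{-1}(A)\text{ measurable}\}$; $W_K$ is the set of $w\in W$ entering $K$, and $W_K^*=\pi^*(W_K)$. There is a unique $\sigma$-finite measure $\nu$ on $W^*$ such that for each finite $K\subset V$, $1_{W_K^*}\cdot\nu$ is the image under $\pi^*$ of the measure $Q_K$ on $W_K$ given by $Q_K[(X_{-n})_{n\ge0}\in A,X_0=x,(X_n)_{n\ge0}\in B]=P_x[A\mid\widetilde H_K=\infty]\,e_K(x)\,P_x[B]$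 for measurable $A,B\subset W_+$ and $x\in V$. Let $\mathbb{P}$ be the law of a Poisson point process $\omega=\sum_i\delta_{(w_i^*,u_i)}$ on $W^*\times\mathbb{R}_+$ with intensity $\nu(dw^* )\otimes du$. The vacant set at level $u\ge0$ is $\mathcal{V}^u=V\setminus\bigcup_{i:u_i\le u}\mathrm{Range}(w_i^* )$. The law $Q^u$ of $(1_{\{x\in\mathcal{V}^u\}})_{x\in V}$ on $\{0,1\}^V$ (with the $\sigma$-algebra generated by the coordinates $Y_x$) is the unique probability measure such that $Q^u[Y_x=1\text{ for all }x\in K]=\exp(-u\cdot\mathrm{cap}(K))$ for all finite $K\subset V$. Critical value. $\eta(u,x)=\mathbb{P}[\text{the connected component of }x\text{ in }\mathcal{V}^u\text{ is infinite}]$ and $u_*=\inf\{u\ge0;\eta(u,x)=0\}\in[0,\infty]$, which does not depend on the vertex $x$. *)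

theory Defs
  imports "HOL-Probability.Probability"
begin

text \<open>
  The vertex set of a graph is a whole countable type.
\<close>

locale weighted_graph =
  fixes E :: "'v::countable set set" and a :: "'v \<Rightarrow> 'v \<Rightarrow> real"
  assumes edgeE: "e \<in> E \<Longrightarrow> \<exists>x y. x \<noteq> y \<and> e = {x, y}"
    and connected_edges: "(x, y) \<in> {(x, y). {x, y} \<in> E}\<^sup>*"
    and weight_nonneg: "0 \<le> a x y"
    and weight_sym: "a x y = a y x"
    and weight_pos_iff: "0 < a x y \<longleftrightarrow> {x, y} \<in> E"

definition bounded_degree :: "'v set set \<Rightarrow> bool" where
  "bounded_degree E \<longleftrightarrow> (\<exists>D::nat. \<forall>x. finite {e \<in> E. x \<in> e} \<and> card {e \<in> E. x \<in> e} \<le> D)"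

definition bounded_weights :: "'v set set \<Rightarrow> ('v \<Rightarrow> 'v \<Rightarrow> real) \<Rightarrow> bool" where
  "bounded_weights E a \<longleftrightarrow>
     (\<exists>m M. 0 < m \<and> m \<le> M \<and> (\<forall>x y. {x, y} \<in> E \<longrightarrow> m \<le> a x y \<and> a x y \<le> M))"

definition vertex_weight :: "'v set set \<Rightarrow> ('v \<Rightarrow> 'v \<Rightarrow> real) \<Rightarrow> 'v \<Rightarrow> real" where
  "vertex_weight E a x = infsum (a x) {y. {x, y} \<in> E}"

definition boundary_weight :: "('v \<Rightarrow> 'v \<Rightarrow> real) \<Rightarrow> 'v set \<Rightarrow> real" where
  "boundary_weight a A = infsum (\<lambda>(x, y). a x y) (A \<times> - A)"

definition isoperimetric_ineq :: "real \<Rightarrow> 'v set set \<Rightarrow> ('v \<Rightarrow> 'v \<Rightarrow> real) \<Rightarrow> bool" where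
  "isoperimetric_ineq d E a \<longleftrightarrow>
     (\<exists>\<kappa>>0. \<forall>A. finite A \<longrightarrow>
        (\<Sum>x\<in>A. vertex_weight E a x) powr (1 - 1 / d) \<le> \<kappa> * boundary_weight a A)"

definition product_edges :: "'v set set \<Rightarrow> 'u set set \<Rightarrow> ('v \<times> 'u) set set" where
  "product_edges E E' =
     {{(x, x'), (y, y')} | x x' y y'. {x, y} \<in> E \<and> x' = y' \<or> x = y \<and> {x', y'} \<in> E'}"

definition product_weight ::
    "('v \<Rightarrow> 'v \<Rightarrow> real) \<Rightarrow> ('u \<Rightarrow> 'u \<Rightarrow> real) \<Rightarrow> 'v \<times> 'u \<Rightarrow> 'v \<times> 'u \<Rightarrow> real" where
  "product_weight a a' =
     (\<lambda>(x, x') (y, y'). a x y * of_bool (x' = y') + of_bool (x = y) * a' x' y')"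

definition int_edges :: "int set set" where
  "int_edges = {{i, j} | i j. \<bar>i - j\<bar> = 1}"

definition int_weight :: "int \<Rightarrow> int \<Rightarrow> real" where
  "int_weight i j = of_bool (\<bar>i - j\<bar> = 1)"


section \<open>The random walk\<close>

definition walk_step :: "'v::countable set set \<Rightarrow> ('v \<Rightarrow> 'v \<Rightarrow> real) \<Rightarrow> 'v \<Rightarrow> 'v pmf" where
  "walk_step E a x = embed_pmf (\<lambda>y. a x y / vertex_weight E a x)"

lemma (in weighted_graph) pmf_walk_step:
  assumes fin: "finite {y. {x, y} \<in> E}" and pos: "vertex_weight E a x > 0"
  shows "pmf (walk_step E a x) y = a x y / vertex_weight E a x"
  unfolding walk_step_def
proof (rule pmf_embed_pmf)
  let ?N = "{y. {x, y} \<in> E}" and ?mu = "vertex_weight E a x"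
  show "0 \<le> a x z / ?mu" for z
    using weight_nonneg[of x z] pos by simp
  have out: "a x z = 0" if "z \<notin> ?N" for z
    using that weight_pos_iff[of x z] weight_nonneg[of x z] by auto
  have "(\<integral>\<^sup>+ z. ennreal (a x z / ?mu) \<partial>count_space UNIV) = (\<Sum>z\<in>?N. ennreal (a x z / ?mu))"
    by (rule nn_integral_count_space'[OF fin]) (use out in auto)
  also have "\<dots> = ennreal ((\<Sum>z\<in>?N. a x z) / ?mu)"
    using weight_nonneg pos by (simp add: sum_ennreal sum_divide_distrib)
  also have "(\<Sum>z\<in>?N. a x z) = ?mu"
    using fin by (simp add: vertex_weight_def)
  finally show "(\<integral>\<^sup>+ z. ennreal (a x z / ?mu) \<partial>count_space UNIV) = 1"
    using pos by simp
qed

text \<open>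
  The law of the walk started at \<open>x\<close>, on the product space of all sequences of vertices, is the
  Ionescu-Tulcea extension of the following kernels; its values on cylinders are computed in
  \<open>emeasure_walk_law_cylinder\<close> below.
\<close>

definition walk_kernel ::
    "'v::countable set set \<Rightarrow> ('v \<Rightarrow> 'v \<Rightarrow> real) \<Rightarrow> 'v \<Rightarrow> nat \<Rightarrow> (nat \<Rightarrow> 'v) \<Rightarrow> 'v measure" where
  "walk_kernel E a x n w =
     measure_pmf (case n of 0 \<Rightarrow> return_pmf x | Suc k \<Rightarrow> walk_step E a (w k))"

definition walk_law ::
    "'v::countable set set \<Rightarrow> ('v \<Rightarrow> 'v \<Rightarrow> real) \<Rightarrow> 'v \<Rightarrow> (nat \<Rightarrow> 'v) measure" where
  "walk_law E a x =
     projective_family.lim UNIV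
       (Ionescu_Tulcea.CI (walk_kernel E a x) (\<lambda>_. count_space UNIV)) (\<lambda>_. count_space UNIV)"

lemma Ionescu_Tulcea_walk_kernel:
  "Ionescu_Tulcea (walk_kernel E a x) (\<lambda>_. count_space UNIV)"
proof (rule Ionescu_Tulcea.intro)
  fix i
  show "walk_kernel E a x i \<in> measurable (PiM {0..<i} (\<lambda>_. count_space UNIV))
          (subprob_algebra (count_space UNIV))"
  proof (cases i)
    case 0
    then show ?thesis
      by (auto simp: walk_kernel_def[abs_def] intro!: measurable_const measure_pmf_in_subprob_algebra)
  next
    case (Suc k)
    have "(\<lambda>w. measure_pmf (walk_step E a (w k)))
       \<in> measurable (PiM {0..<Suc k} (\<lambda>_. count_space UNIV)) (subprob_algebra (count_space UNIV))"
    proof (rule measurable_compose[OF measurable_component_singleton])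
      show "(\<lambda>y. measure_pmf (walk_step E a y)) \<in> measurable (count_space UNIV) (subprob_algebra (count_space UNIV))"
        by (auto simp: measure_pmf_in_subprob_algebra)
    qed simp
    then show ?thesis
      using Suc by (simp add: walk_kernel_def[abs_def])
  qed
qed (simp add: walk_kernel_def prob_space_measure_pmf)

lemma emeasure_walk_law_cylinder:
  "emeasure (walk_law E a x) {w. \<forall>i\<le>n. w i = q i} =
     of_bool (q 0 = x) * (\<Prod>i<n. ennreal (pmf (walk_step E a (q i)) (q (Suc i))))"
proof -
  let ?M = "\<lambda>_::nat. count_space (UNIV :: 'a set)"
  let ?r = "\<lambda>m. restrict q {0..<m}"
  interpret IT: Ionescu_Tulcea "walk_kernel E a x" ?M
    by (rule Ionescu_Tulcea_walk_kernel)
  have PiM_sing: "{?r m} \<in> sets (PiM {0..<m} ?M)" for m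
  proof -
    have "{?r m} = (\<Pi>\<^sub>E i\<in>{0..<m}. {q i})"
      by (auto simp: PiE_def extensional_def fun_eq_iff restrict_def Pi_def)
    then show ?thesis by (auto intro!: sets_PiM_I_finite)
  qed
  have eP: "emeasure (IT.eP m w) {?r (Suc m)} =
      indicator {?r m} w * ennreal (pmf (case m of 0 \<Rightarrow> return_pmf x | Suc k \<Rightarrow> walk_step E a (q k)) (q m))"
    if w: "w \<in> space (PiM {0..<m} ?M)" for m w
  proof -
    have ext: "w i = undefined" if "i \<notin> {0..<m}" for i
      using w that by (auto simp: space_PiM PiE_def extensional_def)
    have "fun_upd w m -` {?r (Suc m)} \<inter> space (?M m) = (if w = ?r m then {q m} else {})"
    proof -
      have "w(m := y) = ?r (Suc m) \<longleftrightarrow> w = ?r m \<and> y = q m" for y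
        using ext by (auto simp: fun_eq_iff less_Suc_eq split: if_splits)
      then show ?thesis by auto
    qed
    moreover have "walk_kernel E a x m (?r m) = walk_kernel E a x m q"
      by (cases m) (auto simp: walk_kernel_def)
    ultimately show ?thesis
      by (subst IT.emeasure_eP[OF w PiM_sing])
         (auto simp: walk_kernel_def emeasure_pmf_single split: nat.split split_indicator)
  qed
  have C: "emeasure (IT.C 0 m (\<lambda>_. undefined)) {?r m} =
      (\<Prod>i<m. ennreal (pmf (case i of 0 \<Rightarrow> return_pmf x | Suc k \<Rightarrow> walk_step E a (q k)) (q i)))" for m
  proof (induction m)
    case 0
    then show ?case
      by (simp add: restrict_def PiM_empty emeasure_return)
  next
    case (Suc m)
    have sp: "(\<lambda>_. undefined) \<in> space (PiM {0..<0::nat} ?M)"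
      by (simp add: space_PiM)
    have "emeasure (IT.C 0 (Suc m) (\<lambda>_. undefined)) {?r (Suc m)} =
       (\<integral>\<^sup>+w. emeasure (IT.eP m w) {?r (Suc m)} \<partial>IT.C 0 m (\<lambda>_. undefined))"
      unfolding IT.C.simps add_0
      by (rule emeasure_bind[where N="PiM {0..<Suc m} ?M"])
         (use sp IT.prob_space_C[OF sp, of m] IT.measurable_eP[of m] PiM_sing[of "Suc m"] in
           \<open>auto simp: prob_space.not_empty IT.sets_C[OF sp] cong: measurable_cong_sets\<close>)
    also have "\<dots> = (\<integral>\<^sup>+w. ennreal (pmf (case m of 0 \<Rightarrow> return_pmf x | Suc k \<Rightarrow> walk_step E a (q k)) (q m))
        * indicator {?r m} w \<partial>IT.C 0 m (\<lambda>_. undefined))"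
      by (rule nn_integral_cong) (use IT.space_C[OF sp] eP in \<open>auto simp: mult.commute\<close>)
    also have "\<dots> = ennreal (pmf (case m of 0 \<Rightarrow> return_pmf x | Suc k \<Rightarrow> walk_step E a (q k)) (q m))
        * emeasure (IT.C 0 m (\<lambda>_. undefined)) {?r m}"
      by (rule nn_integral_cmult_indicator) (use PiM_sing[of m] IT.sets_C[OF sp] in auto)
    finally show ?case
      unfolding Suc.IH prod.lessThan_Suc by (simp only: mult.commute)
  qed
  have emb: "{w. \<forall>i\<le>n. w i = q i} = IT.PF.emb UNIV {0..<Suc n} {?r (Suc n)}"
    by (auto simp: prod_emb_def space_PiM fun_eq_iff restrict_def less_Suc_eq_le)
       (metis)
  have "emeasure (walk_law E a x) {w. \<forall>i\<le>n. w i = q i} = emeasure (IT.CI {0..<Suc n}) {?r (Suc n)}"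
    unfolding walk_law_def emb using PiM_sing by (intro IT.lim) auto
  also have "\<dots> = emeasure (IT.C 0 (Suc n) (\<lambda>_. undefined)) (IT.PF.emb {0..<Suc n} {0..<Suc n} {?r (Suc n)})"
    using PiM_sing by (intro IT.emeasure_CI) auto
  also have "IT.PF.emb {0..<Suc n} {0..<Suc n} {?r (Suc n)} = {?r (Suc n)}"
    using PiM_sing by (intro prod_emb_id) (auto simp: PiE_def)
  finally show ?thesis
    unfolding C prod.lessThan_Suc_shift by (auto simp: o_def)
qed

definition return_time :: "'v set \<Rightarrow> (nat \<Rightarrow> 'v) \<Rightarrow> enat" where
  "return_time K w = Inf (enat ` {n. 1 \<le> n \<and> w n \<in> K})"

definition equilibrium_measure ::
    "'v::countable set set \<Rightarrow> ('v \<Rightarrow> 'v \<Rightarrow> real) \<Rightarrow> 'v set \<Rightarrow> 'v \<Rightarrow> real" where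
  "equilibrium_measure E a K x =
     of_bool (x \<in> K) * \<P>(w in walk_law E a x. return_time K w = \<infinity>) * vertex_weight E a x"


section \<open>Spaces of trajectories\<close>

definition half_trajectories :: "'v set set \<Rightarrow> (nat \<Rightarrow> 'v) set" where
  "half_trajectories E = {w. (\<forall>n. {w n, w (Suc n)} \<in> E) \<and> (\<forall>x. finite {n. w n = x})}"

definition trajectories :: "'v set set \<Rightarrow> (int \<Rightarrow> 'v) set" where
  "trajectories E = {w. (\<forall>n. {w n, w (n + 1)} \<in> E) \<and> (\<forall>x. finite {n. w n = x})}"

text \<open>
  In the following measures only the \<open>\<sigma>\<close>-algebra is used.
\<close>

definition half_trajectory_space :: "'v set set \<Rightarrow> (nat \<Rightarrow> 'v) measure" where
  "half_trajectory_space E = restrict_space (\<Pi>\<^sub>M n\<in>UNIV. count_space UNIV) (half_trajectories E)"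

definition trajectory_space :: "'v set set \<Rightarrow> (int \<Rightarrow> 'v) measure" where
  "trajectory_space E = restrict_space (\<Pi>\<^sub>M n\<in>UNIV. count_space UNIV) (trajectories E)"

definition shift_class :: "(int \<Rightarrow> 'v) \<Rightarrow> (int \<Rightarrow> 'v) set" where
  "shift_class w = {w'. \<exists>k. \<forall>n. w' n = w (n + k)}"

definition trajectories_mod_shift :: "'v set set \<Rightarrow> (int \<Rightarrow> 'v) set set" where
  "trajectories_mod_shift E = shift_class ` trajectories E"

definition trajectory_mod_shift_space :: "'v set set \<Rightarrow> (int \<Rightarrow> 'v) set measure" where
  "trajectory_mod_shift_space E =
     sigma (trajectories_mod_shift E)
       {A. A \<subseteq> trajectories_mod_shift E \<and>
           {w \<in> trajectories E. shift_class w \<in> A} \<in> sets (trajectory_space E)}"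

definition trajectories_hitting :: "'v set set \<Rightarrow> 'v set \<Rightarrow> (int \<Rightarrow> 'v) set" where
  "trajectories_hitting E K = {w \<in> trajectories E. \<exists>n. w n \<in> K}"


section \<open>The intensity measure\<close>

text \<open>
  \<open>Q\<close> is the measure $Q_K$. For \<open>x\<close> with \<open>equilibrium_measure E a K x = 0\<close>, the right-hand side
  vanishes whatever the value of the conditional probability.
\<close>

definition is_interlacement_Q ::
    "'v::countable set set \<Rightarrow> ('v \<Rightarrow> 'v \<Rightarrow> real) \<Rightarrow> 'v set \<Rightarrow> (int \<Rightarrow> 'v) measure \<Rightarrow> bool" where
  "is_interlacement_Q E a K Q \<longleftrightarrow>
     sets Q = sets (restrict_space (trajectory_space E) (trajectories_hitting E K)) \<and>
     (\<forall>A \<in> sets (half_trajectory_space E). \<forall>B \<in> sets (half_trajectory_space E). \<forall>x.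
        emeasure Q {w \<in> trajectories_hitting E K.
            (\<lambda>n::nat. w (- int n)) \<in> A \<and> w 0 = x \<and> (\<lambda>n::nat. w (int n)) \<in> B} =
        ennreal (\<P>(w in walk_law E a x. w \<in> A \<bar> return_time K w = \<infinity>) *
                 equilibrium_measure E a K x *
                 \<P>(w in walk_law E a x. w \<in> B)))"

text \<open>
  These conditions determine \<open>\<nu>\<close> uniquely.
\<close>

definition is_interlacement_intensity ::
    "'v::countable set set \<Rightarrow> ('v \<Rightarrow> 'v \<Rightarrow> real) \<Rightarrow> (int \<Rightarrow> 'v) set measure \<Rightarrow> bool" where
  "is_interlacement_intensity E a \<nu> \<longleftrightarrow>
     sets \<nu> = sets (trajectory_mod_shift_space E) \<and>
     sigma_finite_measure \<nu> \<and>
     (\<forall>K. finite K \<longrightarrow>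
        (\<exists>Q. is_interlacement_Q E a K Q \<and>
             density \<nu> (indicator (shift_class ` trajectories_hitting E K)) =
             distr Q (trajectory_mod_shift_space E) shift_class))"


section \<open>Poisson point processes\<close>

text \<open>
  A point measure $\sum_{i \in I} \delta_{p_i}$ is given by its countable index set \<open>I\<close> and its
  points \<open>p\<close>; points may be repeated.
\<close>

definition point_count :: "nat set \<Rightarrow> (nat \<Rightarrow> 'p) \<Rightarrow> 'p set \<Rightarrow> ennreal" where
  "point_count I p D = emeasure (count_space UNIV) {i \<in> I. p i \<in> D}"

text \<open>
  The random point measure with index set \<open>I \<xi>\<close> and points \<open>p \<xi>\<close>, for an outcome \<open>\<xi>\<close> of
  the probability space \<open>P\<close>, is a Poisson point process with intensity \<open>\<Lambda>\<close>. The enumeration of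
  the points need not be measurable, only their numbers in measurable sets.
\<close>

definition poisson_point_process ::
    "'w measure \<Rightarrow> 'p measure \<Rightarrow> ('w \<Rightarrow> nat set) \<Rightarrow> ('w \<Rightarrow> nat \<Rightarrow> 'p) \<Rightarrow> bool" where
  "poisson_point_process P \<Lambda> I p \<longleftrightarrow>
     prob_space P \<and>
     (\<forall>\<xi>\<in>space P. \<forall>i\<in>I \<xi>. p \<xi> i \<in> space \<Lambda>) \<and>
     (\<forall>D\<in>sets \<Lambda>. (\<lambda>\<xi>. point_count (I \<xi>) (p \<xi>) D) \<in> borel_measurable P) \<and>
     (\<forall>D\<in>sets \<Lambda>. emeasure \<Lambda> D < \<infinity> \<longrightarrow>
        (\<forall>k::nat. \<P>(\<xi> in P. point_count (I \<xi>) (p \<xi>) D = of_nat k) =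
                 exp (- measure \<Lambda> D) * measure \<Lambda> D ^ k / fact k)) \<and>
     (\<forall>D\<in>sets \<Lambda>. emeasure \<Lambda> D = \<infinity> \<longrightarrow> (AE \<xi> in P. point_count (I \<xi>) (p \<xi>) D = \<infinity>)) \<and>
     (\<forall>J D. finite (J :: nat set) \<longrightarrow> D ` J \<subseteq> sets \<Lambda> \<longrightarrow> disjoint_family_on D J \<longrightarrow>
        prob_space.indep_vars P (\<lambda>_. borel) (\<lambda>j \<xi>. point_count (I \<xi>) (p \<xi>) (D j)) J)"


section \<open>Random interlacements and percolation of the vacant set\<close>

text \<open>
  \<open>p \<xi> i = (w\<^sub>i, u\<^sub>i)\<close> consists of a trajectory modulo shift and its label in \<open>[0, \<infinity>)\<close>.
\<close>

definition is_random_interlacement ::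
    "'v::countable set set \<Rightarrow> ('v \<Rightarrow> 'v \<Rightarrow> real) \<Rightarrow> 'w measure \<Rightarrow>
     ('w \<Rightarrow> nat set) \<Rightarrow> ('w \<Rightarrow> nat \<Rightarrow> (int \<Rightarrow> 'v) set \<times> real) \<Rightarrow> bool" where
  "is_random_interlacement E a P I p \<longleftrightarrow>
     (\<exists>\<nu>. is_interlacement_intensity E a \<nu> \<and>
          poisson_point_process P (\<nu> \<Otimes>\<^sub>M restrict_space lborel {0..}) I p)"

definition class_range :: "(int \<Rightarrow> 'v) set \<Rightarrow> 'v set" where
  "class_range c = (\<Union>w\<in>c. range w)"

definition vacant_set ::
    "nat set \<Rightarrow> (nat \<Rightarrow> (int \<Rightarrow> 'v) set \<times> real) \<Rightarrow> real \<Rightarrow> 'v set" where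
  "vacant_set I p u = - (\<Union>i\<in>{i \<in> I. snd (p i) \<le> u}. class_range (fst (p i)))"

text \<open>The component of \<open>x\<close> in the subgraph induced by \<open>S\<close>, empty if \<open>x \<notin> S\<close>.\<close>

definition component_in :: "'v set set \<Rightarrow> 'v set \<Rightarrow> 'v \<Rightarrow> 'v set" where
  "component_in E S x =
     {y. x \<in> S \<and> (x, y) \<in> {(y, z). y \<in> S \<and> z \<in> S \<and> {y, z} \<in> E}\<^sup>*}"

definition percolation_prob ::
    "'v set set \<Rightarrow> 'w measure \<Rightarrow> ('w \<Rightarrow> nat set) \<Rightarrow>
     ('w \<Rightarrow> nat \<Rightarrow> (int \<Rightarrow> 'v) set \<times> real) \<Rightarrow> real \<Rightarrow> 'v \<Rightarrow> real" where
  "percolation_prob E P I p u x =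
     \<P>(\<xi> in P. infinite (component_in E (vacant_set (I \<xi>) (p \<xi>) u) x))"

text \<open>
  The infimum of the empty set is \<open>\<infinity>\<close>. The value does not depend on \<open>x\<close> when \<open>P\<close>, \<open>I\<close>, \<open>p\<close>
  are a random interlacement on a connected weighted graph.
\<close>

definition critical_value ::
    "'v set set \<Rightarrow> 'w measure \<Rightarrow> ('w \<Rightarrow> nat set) \<Rightarrow>
     ('w \<Rightarrow> nat \<Rightarrow> (int \<Rightarrow> 'v) set \<times> real) \<Rightarrow> 'v \<Rightarrow> ereal" where
  "critical_value E P I p x = Inf (ereal ` {u. 0 \<le> u \<and> percolation_prob E P I p u x = 0})"

end

theory Submission
  imports Defs
begin

text \<open>
  Let \<open>x = (v, j)\<close>. A geodesic ray from \<open>v\<close> in the graph, times the half-line above \<open>j\<close>, is a copy of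
  the quarter plane with corner \<open>x\<close>. For small \<open>u\<close> the vacant set percolates from \<open>x\<close> inside this
  quarter plane.

  By planar duality (\<open>finite_cluster_blocked\<close>) the vacant cluster of the corner is finite only if
  occupied sites, linked also diagonally, join the two axes. Such a chain starting at
  distance \<open>m\<close> from the corner has extent at least \<open>m\<close>, so it is a crossing at a scale
  comparable with \<open>m\<close>. Let \<open>q\<^sub>n\<close> be the largest probability of a crossing at scale \<open>16\<^sup>n\<close>. One crossing at scale
  \<open>16\<^sup>n\<^sup>+\<^sup>1\<close> contains two crossings at scale \<open>16\<^sup>n\<close> around centres at distance at least \<open>31 16\<^sup>n\<close>, chosen from a
  bounded number of candidates (\<open>crossing_cascade\<close>). Two
  increasing events on finite sets \<open>K\<^sub>1\<close> and \<open>K\<^sub>2\<close> are independent up to the error \<open>u\<close> times the intensity of the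
  trajectories that meet both sets, because those that meet only \<open>K\<^sub>1\<close> and those that meet only \<open>K\<^sub>2\<close> form
  independent Poisson processes (\<open>decoupling\<close>). A trajectory through two given
  vertices at distance \<open>r\<close> has intensity at most a constant times the probability that the walk hits one of
  them from the other, hence at most \<open>C r\<^sup>-\<^sup>9\<^sup>/\<^sup>2\<close>. Two planar boxes of side \<open>L\<close> contain of order \<open>L\<^sup>4\<close> pairs, so
  the error is of order \<open>u L\<^sup>-\<^sup>1\<^sup>/\<^sup>2\<close>, that is \<open>u 4\<^sup>-\<^sup>n\<close>, and the recursion
  \<open>q\<^sub>n\<^sub>+\<^sub>1 \<le> A (q\<^sub>n\<^sup>2 + u B 4\<^sup>-\<^sup>n)\<close> keeps \<open>q\<^sub>n \<le> \<epsilon> 4\<^sup>-\<^sup>n\<close> for all small \<open>u\<close> (\<open>cross_prob_small\<close>). Summed over all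
  scales the obstacles then have total probability less than one (\<open>planar_percolation\<close>).

  The argument needs the hitting probability to decay faster than \<open>r\<^sup>-\<^sup>4\<close>. This is where dimension six
  enters. The product with the line has isoperimetric
  dimension seven (\<open>isoperimetric_graph_product\<close>). Isoperimetry gives a
  Faber-Krahn inequality and from it a Nash inequality (\<open>nash\<close>), so that the heat kernel is of
  order \<open>n\<^sup>-\<^sup>7\<^sup>/\<^sup>2\<close> (\<open>heat_uniform_decay\<close>). Interpolated with the Gaussian
  bound of Carne and Varopoulos (\<open>carne_varopoulos\<close>) this bounds the Green function by
  \<open>C r\<^sup>-\<^sup>\<beta>\<close> for every \<open>\<beta> < 5\<close> (\<open>green_function\<close>).

  A single vertex without edges satisfies all hypotheses on the graph. The product is then the line,
  on which the walk is recurrent, so that almost surely no trajectory is present (\<open>line_recurrent\<close>).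
\<close>

section \<open>Planar duality in the quarter plane\<close>

definition grid_adjacent :: "nat \<times> nat \<Rightarrow> nat \<times> nat \<Rightarrow> bool" where
  "grid_adjacent p q \<longleftrightarrow>
     fst p = fst q \<and> (snd q = Suc (snd p) \<or> snd p = Suc (snd q)) \<or>
     snd p = snd q \<and> (fst q = Suc (fst p) \<or> fst p = Suc (fst q))"

definition star_adjacent :: "int \<times> int \<Rightarrow> int \<times> int \<Rightarrow> bool" where
  "star_adjacent p q \<longleftrightarrow> \<bar>fst p - fst q\<bar> \<le> 1 \<and> \<bar>snd p - snd q\<bar> \<le> 1"

definition star_connected :: "(int \<times> int) set \<Rightarrow> int \<times> int \<Rightarrow> int \<times> int \<Rightarrow> bool" where
  "star_connected S p q \<longleftrightarrow> (p, q) \<in> {(p, q). p \<in> S \<and> q \<in> S \<and> star_adjacent p q}\<^sup>*"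

text \<open>
  The hypothesis says that each unit square has an even number of marked sides (\<open>H\<close> marks horizontal
  edges, \<open>V\<close> vertical ones). In the sum over a row of squares the inner vertical sides cancel.
\<close>

lemma odd_row_shift:
  fixes H V :: "nat \<Rightarrow> nat \<Rightarrow> bool"
  assumes "\<And>i j. (H i j \<noteq> H i (Suc j)) = (V i j \<noteq> V (Suc i) j)"
  shows "(odd (\<Sum>i<N. of_bool (H i j) :: nat) \<noteq> odd (\<Sum>i<N. of_bool (H i (Suc j)) :: nat)) = (V 0 j \<noteq> V N j)"
proof (induction N)
  case 0 show ?case by simp
next
  case (Suc N)
  then show ?case using assms[of N j] by (auto simp: of_bool_def)
qed

lemma odd_changes:
  fixes c :: "nat \<Rightarrow> bool"
  shows "odd (\<Sum>i<N. of_bool (c i \<noteq> c (Suc i)) :: nat) = (c 0 \<noteq> c N)"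
  by (induction N) (auto simp: of_bool_def)

abbreviation int_pair :: "nat \<times> nat \<Rightarrow> int \<times> int" where
  "int_pair p \<equiv> (int (fst p), int (snd p))"

text \<open>
  A parity argument. Let \<open>C\<close> be the cluster of the corner and \<open>T\<close> the set of the blocked sites that are
  star-connected to the horizontal axis; suppose that \<open>T\<close> misses the vertical axis. Mark the edges between
  \<open>C\<close> and \<open>T\<close>. The corners of a unit square are pairwise star-adjacent, so \<open>T\<close> contains all of its blocked
  corners or none; in the first case the marked sides are those where membership in \<open>C\<close> changes, in the second
  there are none, and either way their number is even. Hence the parity of the number of marked edges is the
  same in all rows. Far away it is even, but on the horizontal axis it is odd, since that row starts in
  \<open>C\<close> and ends outside.
\<close>

lemma finite_cluster_blocked:
  fixes S :: "(int \<times> int) set"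
  defines "C \<equiv> {q. (0, q) \<in> {(p, q). int_pair p \<notin> S \<and> int_pair q \<notin> S \<and> grid_adjacent p q}\<^sup>*}"
  assumes fin: "finite C" and origin: "(0, 0) \<notin> S"
  shows "\<exists>m k. star_connected S (int m, 0) (0, int k) \<and> (int m, 0) \<in> S"
proof (rule ccontr)
  assume neg: "\<not> ?thesis"
  define T where "T = {q. int_pair q \<in> S \<and> (\<exists>m. (int m, 0) \<in> S \<and> star_connected S (int m, 0) (int_pair q))}"
  have C0: "(0, 0) \<in> C" by (simp add: C_def zero_prod_def)
  have CS: "int_pair q \<notin> S" if "q \<in> C" for q
    using that origin unfolding C_def by (auto elim: rtranclE simp: zero_prod_def)
  have step: "q \<in> C" if "p \<in> C" "grid_adjacent p q" "int_pair q \<notin> S" for p q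
    using that CS[OF that(1)] unfolding C_def by (auto intro: rtrancl_into_rtrancl)
  have T_step: "q \<in> T" if "p \<in> T" "star_adjacent (int_pair p) (int_pair q)" "int_pair q \<in> S" for p q
    using that unfolding T_def star_connected_def by (blast intro: rtrancl_into_rtrancl)
  have T_axis: "(i, 0) \<in> T" if "(int i, 0) \<in> S" for i
    using that unfolding T_def star_connected_def by auto
  have T_yaxis: "(0, j) \<notin> T" for j
    using neg unfolding T_def by auto
  have TS: "int_pair q \<in> S" if "q \<in> T" for q using that by (simp add: T_def)
  define e where "e p q \<longleftrightarrow> p \<in> C \<and> q \<in> T \<or> q \<in> C \<and> p \<in> T" for p q
  define H where "H i j = e (i, j) (Suc i, j)" for i j
  define V where "V i j = e (i, j) (i, Suc j)" for i j
  have edge_cut: "e p q = ((p \<in> C) \<noteq> (q \<in> C))"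
    if "grid_adjacent p q" "int_pair p \<in> S \<longrightarrow> p \<in> T" "int_pair q \<in> S \<longrightarrow> q \<in> T" for p q
  proof -
    have "grid_adjacent q p" using that(1) by (auto simp: grid_adjacent_def)
    then show ?thesis using that step[of p q] step[of q p] CS[of p] CS[of q] TS[of p] TS[of q]
      unfolding e_def by blast
  qed
  have square: "(H i j \<noteq> H i (Suc j)) = (V i j \<noteq> V (Suc i) j)" for i j
  proof -
    let ?Q = "{(i, j), (Suc i, j), (i, Suc j), (Suc i, Suc j)}"
    show ?thesis
    proof (cases "\<exists>p\<in>?Q. p \<in> T")
      case True
      then have all: "int_pair q \<in> S \<longrightarrow> q \<in> T" if "q \<in> ?Q" for q
        using that T_step[of _ q] by (auto simp: star_adjacent_def)
      have "e p q = ((p \<in> C) \<noteq> (q \<in> C))" if "p \<in> ?Q" "q \<in> ?Q" "grid_adjacent p q" for p q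
        using that all edge_cut by metis
      from this[of "(i, j)" "(Suc i, j)"] this[of "(i, Suc j)" "(Suc i, Suc j)"]
        this[of "(i, j)" "(i, Suc j)"] this[of "(Suc i, j)" "(Suc i, Suc j)"]
      show ?thesis
        unfolding H_def V_def by (simp add: grid_adjacent_def) argo
    next
      case False
      then show ?thesis by (auto simp: H_def V_def e_def)
    qed
  qed
  obtain N where N: "\<And>q. q \<in> C \<Longrightarrow> fst q < N \<and> snd q < N"
  proof -
    have "finite (fst ` C \<union> snd ` C)" using fin by simp
    then obtain N where "\<forall>n\<in>fst ` C \<union> snd ` C. n < N"
      using finite_nat_set_iff_bounded by blast
    then show ?thesis using that by blast
  qed
  have V0: "\<not> V 0 j" for j using T_yaxis by (auto simp: V_def e_def)
  have VN: "\<not> V N j" for j using N[of "(N, j)"] N[of "(N, Suc j)"] by (auto simp: V_def e_def)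
  define R where "R j = odd (\<Sum>i<N. of_bool (H i j) :: nat)" for j
  have "R j = R (Suc j)" for j
  proof -
    have "R j \<noteq> R (Suc j) \<longleftrightarrow> V 0 j \<noteq> V N j"
      unfolding R_def using odd_row_shift[where H = H and V = V, OF square] .
    then show ?thesis using V0[of j] VN[of j] by argo
  qed
  then have R0: "R j = R 0" for j by (induction j) auto
  have "\<not> H i N" for i using N[of "(i, N)"] N[of "(Suc i, N)"] by (auto simp: H_def e_def)
  then have "\<not> R N" by (simp add: R_def)
  have "H i 0 = (((i, 0) \<in> C) \<noteq> ((Suc i, 0) \<in> C))" for i
    unfolding H_def by (rule edge_cut) (use T_axis[of i] T_axis[of "Suc i"] in \<open>auto simp: grid_adjacent_def\<close>)
  then have "R 0 = (((0, 0) \<in> C) \<noteq> ((N, 0) \<in> C))"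
    unfolding R_def using odd_changes[of "\<lambda>i. (i, 0) \<in> C" N] by simp
  moreover have "(N, 0) \<notin> C" using N[of "(N, 0)"] by auto
  ultimately have "R 0" using C0 by simp
  with \<open>\<not> R N\<close> R0 show False by simp
qed

section \<open>Crossings\<close>

definition grid_box :: "int \<times> int \<Rightarrow> int \<Rightarrow> (int \<times> int) set" where
  "grid_box z r = {p. \<bar>fst p - fst z\<bar> \<le> r \<and> \<bar>snd p - snd z\<bar> \<le> r}"

text \<open>
  The truncation to the box of radius \<open>3 L + 1\<close> makes a crossing depend on finitely many sites. A
  star-connected path leaves the box of radius \<open>3 L\<close> at a site at distance exactly \<open>3 L + 1\<close>.
\<close>

definition crossing :: "(int \<times> int) set \<Rightarrow> int \<times> int \<Rightarrow> int \<Rightarrow> bool" where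
  "crossing S z L \<longleftrightarrow>
     (\<exists>p q. p \<in> grid_box z L \<and> q \<notin> grid_box z (3 * L) \<and> star_connected (S \<inter> grid_box z (3 * L + 1)) p q)"

lemma star_connected_mono: "S \<subseteq> S' \<Longrightarrow> star_connected S p q \<Longrightarrow> star_connected S' p q"
  unfolding star_connected_def
  by (rule subsetD[OF rtrancl_mono[of "{(p, q). p \<in> S \<and> q \<in> S \<and> star_adjacent p q}"]]) auto

lemma crossing_mono: "crossing S z L \<Longrightarrow> S \<inter> grid_box z (3 * L + 1) \<subseteq> S' \<Longrightarrow> crossing S' z L"
  unfolding crossing_def using star_connected_mono[of "S \<inter> grid_box z (3 * L + 1)" "S' \<inter> grid_box z (3 * L + 1)"] by blast

lemma star_connected_sym: "star_connected S p q \<Longrightarrow> star_connected S q p"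
proof -
  have "sym {(p, q). p \<in> S \<and> q \<in> S \<and> star_adjacent p q}"
    by (auto simp: sym_def star_adjacent_def abs_minus_commute)
  then show "star_connected S p q \<Longrightarrow> star_connected S q p"
    unfolding star_connected_def by (rule symD[OF sym_rtrancl])
qed

text \<open>
  The path can be stopped at its first exit from the box of radius \<open>3 L\<close>.
\<close>

lemma star_connected_crossing:
  assumes "star_connected S p q" "p \<in> grid_box z L" "q \<notin> grid_box z (3 * L)" "0 \<le> L"
  shows "crossing S z L"
proof -
  let ?S = "S \<inter> grid_box z (3 * L + 1)"
  have "crossing S z L \<or> star_connected ?S p q \<and> q \<in> grid_box z (3 * L)"
    using assms(1) unfolding star_connected_def[of S]
  proof (induction rule: rtrancl_induct)
    case base
    then show ?case using assms(2,4) by (auto simp: star_connected_def grid_box_def)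
  next
    case (step q q')
    show ?case
    proof (cases "crossing S z L")
      case False
      then have q: "star_connected ?S p q" "q \<in> grid_box z (3 * L)" using step.IH by auto
      then have "q \<in> ?S" "q' \<in> ?S" using step.hyps(2) by (auto simp: grid_box_def star_adjacent_def)
      then have q': "star_connected ?S p q'"
        using q(1) step.hyps(2) unfolding star_connected_def by (auto intro: rtrancl_into_rtrancl)
      then show ?thesis using False assms(2) unfolding crossing_def by metis
    qed simp
  qed
  then show ?thesis using assms(3) by auto
qed

lemma div_mult_near: "0 < L \<Longrightarrow> L * (k div L) \<le> k \<and> k < L * (k div L) + L" for k L :: int
  using pos_mod_bound[of L k] pos_mod_sign[of L k] mult_div_mod_eq[of L k] by linarith

text \<open>
  Both ends of the long path start a crossing at the smaller scale: round them down to the lattice \<open>z + L \<int>\<^sup>2\<close>.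
  Each end is within \<open>L\<close> of its lattice point, and the other end is at distance more than \<open>3 L\<close> from it, since
  the ends are more than \<open>32 L\<close> apart.
\<close>

lemma crossing_cascade:
  assumes cr: "crossing S z (16 * L)" and L: "1 \<le> L"
  shows "\<exists>i \<in> {-49..49} \<times> {-49..49}. \<exists>j \<in> {-49..49} \<times> {-49..49}.
     crossing S (fst z + L * fst i, snd z + L * snd i) L \<and>
     crossing S (fst z + L * fst j, snd z + L * snd j) L \<and>
     (31 \<le> \<bar>fst i - fst j\<bar> \<or> 31 \<le> \<bar>snd i - snd j\<bar>)"
proof -
  obtain p q where pq: "p \<in> grid_box z (16 * L)" "q \<notin> grid_box z (48 * L)"
    and con: "star_connected (S \<inter> grid_box z (48 * L + 1)) p q"
    using cr unfolding crossing_def by auto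
  have "p \<noteq> q" using pq L by (auto simp: grid_box_def)
  then have q: "q \<in> grid_box z (48 * L + 1)"
    using con unfolding star_connected_def by (auto elim: rtranclE)
  have con: "star_connected S p q"
    by (rule star_connected_mono[OF _ con]) simp
  define f where "f k = k div L" for k
  define i where "i = (f (fst p - fst z), f (snd p - snd z))"
  define j where "j = (f (fst q - fst z), f (snd q - snd z))"
  have near: "L * f k \<le> k \<and> k < L * f k + L" for k
    unfolding f_def using L div_mult_near by simp
  have range: "f k \<in> {-49..49}" if "\<bar>k\<bar> \<le> 49 * L" for k
  proof -
    have "L * f k < L * 50" "L * (-50) < L * f k" using near[of k] that L by linarith+
    then have "f k < 50" "-50 < f k" using L by (simp_all only: mult_less_cancel_left_pos)
    then show ?thesis by simp
  qed
  have pz: "\<bar>fst p - fst z\<bar> \<le> 16 * L" "\<bar>snd p - snd z\<bar> \<le> 16 * L"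
    and qz: "\<bar>fst q - fst z\<bar> \<le> 48 * L + 1" "\<bar>snd q - snd z\<bar> \<le> 48 * L + 1"
    and qz': "48 * L < \<bar>fst q - fst z\<bar> \<or> 48 * L < \<bar>snd q - snd z\<bar>"
    using pq q by (auto simp: grid_box_def)
  have "i \<in> {-49..49} \<times> {-49..49}"
    unfolding i_def using range[of "fst p - fst z"] range[of "snd p - snd z"] pz L by simp
  moreover have "j \<in> {-49..49} \<times> {-49..49}"
    unfolding j_def using range[of "fst q - fst z"] range[of "snd q - snd z"] qz L by simp
  moreover have "crossing S (fst z + L * fst i, snd z + L * snd i) L"
  proof (rule star_connected_crossing[OF con])
    show "p \<in> grid_box (fst z + L * fst i, snd z + L * snd i) L"
      using near[of "fst p - fst z"] near[of "snd p - snd z"]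
      unfolding grid_box_def mem_Collect_eq fst_conv snd_conv i_def by linarith
    have "3 * L < \<bar>b - L * f a\<bar>" if "\<bar>a\<bar> \<le> 16 * L" "48 * L < \<bar>b\<bar>" for a b
      using near[of a] that L by linarith
    from this[OF pz(1), of "fst q - fst z"] this[OF pz(2), of "snd q - snd z"] qz'
    show "q \<notin> grid_box (fst z + L * fst i, snd z + L * snd i) (3 * L)"
      unfolding grid_box_def mem_Collect_eq fst_conv snd_conv i_def by (simp only: diff_diff_eq) linarith
  qed (use L in simp)
  moreover have "crossing S (fst z + L * fst j, snd z + L * snd j) L"
  proof (rule star_connected_crossing[OF star_connected_sym[OF con]])
    show "q \<in> grid_box (fst z + L * fst j, snd z + L * snd j) L"
      using near[of "fst q - fst z"] near[of "snd q - snd z"]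
      unfolding grid_box_def mem_Collect_eq fst_conv snd_conv j_def by linarith
    have "3 * L < \<bar>a - L * f b\<bar>" if "\<bar>a\<bar> \<le> 16 * L" "48 * L < \<bar>b\<bar>" for a b
      using near[of b] that L by linarith
    from this[OF pz(1), of "fst q - fst z"] this[OF pz(2), of "snd q - snd z"] qz'
    show "p \<notin> grid_box (fst z + L * fst j, snd z + L * snd j) (3 * L)"
      unfolding grid_box_def mem_Collect_eq fst_conv snd_conv j_def by (simp only: diff_diff_eq) linarith
  qed (use L in simp)
  moreover have "31 \<le> \<bar>fst i - fst j\<bar> \<or> 31 \<le> \<bar>snd i - snd j\<bar>"
  proof -
    have far: "31 \<le> \<bar>f k - f k'\<bar>" if "\<bar>k - k'\<bar> > 32 * L" for k k'
    proof -
      have "L * 31 < \<bar>L * f k - L * f k'\<bar>" using near[of k] near[of k'] that L by linarith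
      also have "\<dots> = L * \<bar>f k - f k'\<bar>" using L by (simp add: abs_mult flip: right_diff_distrib)
      finally have "31 < \<bar>f k - f k'\<bar>" using L by (simp only: mult_less_cancel_left_pos)
      then show ?thesis by simp
    qed
    have "\<bar>(fst p - fst z) - (fst q - fst z)\<bar> > 32 * L \<or> \<bar>(snd p - snd z) - (snd q - snd z)\<bar> > 32 * L"
      using pz qz' by linarith
    then show ?thesis using far unfolding i_def j_def fst_conv snd_conv by blast
  qed
  ultimately show ?thesis by (intro bexI[of _ i] bexI[of _ j] conjI)
qed

section \<open>The Dirichlet form of a weighted graph\<close>

context weighted_graph begin

lemma irreflexive: "{x, x} \<notin> E"
  using edgeE[of "{x, x}"] by (auto simp: doubleton_eq_iff)

lemma weight_zero: "{x, y} \<notin> E \<Longrightarrow> a x y = 0"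
  using weight_pos_iff[of x y] weight_nonneg[of x y] by auto

lemma boundary_weight_eq_sum:
  assumes fin: "\<And>x. finite {y. {x, y} \<in> E}" and A: "finite A"
  shows "boundary_weight a A = (\<Sum>x\<in>A. \<Sum>y\<in>{y. {x, y} \<in> E} - A. a x y)"
proof -
  let ?S = "Sigma A (\<lambda>x. {y. {x, y} \<in> E} - A)"
  have "boundary_weight a A = infsum (\<lambda>(x, y). a x y) ?S"
    unfolding boundary_weight_def
    by (rule infsum_cong_neutral) (auto, metis weight_zero)
  also have "\<dots> = (\<Sum>(x, y)\<in>?S. a x y)"
    by (rule infsum_finite) (use A fin in auto)
  also have "\<dots> = (\<Sum>x\<in>A. \<Sum>y\<in>{y. {x, y} \<in> E} - A. a x y)"
    by (rule sum.Sigma[symmetric]) (use A fin in auto)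
  finally show ?thesis .
qed

lemma degree_bound:
  assumes "bounded_degree E"
  obtains D where "\<And>x. finite {y. {x, y} \<in> E}" "\<And>x. card {y. {x, y} \<in> E} \<le> D"
proof -
  obtain D where D: "\<And>x. finite {e \<in> E. x \<in> e} \<and> card {e \<in> E. x \<in> e} \<le> D"
    using assms unfolding bounded_degree_def by blast
  have inj: "inj_on (\<lambda>y. {x, y}) {y. {x, y} \<in> E}" for x
    by (auto simp: inj_on_def doubleton_eq_iff)
  have sub: "(\<lambda>y. {x, y}) ` {y. {x, y} \<in> E} \<subseteq> {e \<in> E. x \<in> e}" for x by auto
  have "finite {y. {x, y} \<in> E}" for x
    using finite_imageD[OF finite_subset[OF sub] inj] D by blast
  moreover have "card {y. {x, y} \<in> E} \<le> D" for x
    using card_mono[OF _ sub[of x]] D[of x] card_image[OF inj, of x] by auto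
  ultimately show ?thesis using that by blast
qed

end

locale bounded_graph = weighted_graph E a
  for E :: "'v::countable set set" and a :: "'v \<Rightarrow> 'v \<Rightarrow> real" +
  fixes lo hi :: real
  assumes finite_nb: "finite {y. {x, y} \<in> E}"
    and lo_pos: "0 < lo"
    and weight_ge: "lo \<le> vertex_weight E a x"
    and weight_le: "vertex_weight E a x \<le> hi"
begin

abbreviation nb :: "'v \<Rightarrow> 'v set" where "nb x \<equiv> {y. {x, y} \<in> E}"

abbreviation mu :: "'v \<Rightarrow> real" where "mu \<equiv> vertex_weight E a"

abbreviation supp :: "('v \<Rightarrow> real) \<Rightarrow> 'v set" where "supp f \<equiv> {x. f x \<noteq> 0}"

text \<open>
  The transition operator of the walk. The walk that stays put with probability one half, with operator
  \<open>lazy\<close>, has the same Green function up to a factor two and has no parity obstruction.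
\<close>

definition avg :: "('v \<Rightarrow> real) \<Rightarrow> 'v \<Rightarrow> real" where
  "avg f x = (\<Sum>y\<in>nb x. a x y * f y) / mu x"

definition lazy :: "('v \<Rightarrow> real) \<Rightarrow> 'v \<Rightarrow> real" where
  "lazy f x = (f x + avg f x) / 2"

text \<open>
  The inner product of \<open>\<ell>\<^sup>2(\<mu>)\<close>, meant for finitely supported \<open>f\<close>; then \<open>g\<close> may be arbitrary, for
  instance constant.
\<close>

definition ip :: "('v \<Rightarrow> real) \<Rightarrow> ('v \<Rightarrow> real) \<Rightarrow> real" where
  "ip f g = (\<Sum>x\<in>supp f. f x * g x * mu x)"

definition energy :: "('v \<Rightarrow> real) \<Rightarrow> real" where
  "energy f = ip f f - ip f (avg f)"

lemma mu_pos: "0 < mu x"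
  using lo_pos weight_ge[of x] by linarith

lemma weight_eq_0: "y \<notin> nb x \<Longrightarrow> a x y = 0"
  by (simp add: weight_zero)

lemma nb_sym: "y \<in> nb x \<longleftrightarrow> x \<in> nb y"
  by (simp add: insert_commute)

lemma mu_eq_sum: "mu x = (\<Sum>y\<in>nb x. a x y)"
  by (simp add: vertex_weight_def infsum_finite[OF finite_nb])

lemma sum_nb_eq:
  assumes "finite F" "\<And>y. y \<in> nb x \<Longrightarrow> y \<notin> F \<Longrightarrow> f y = 0"
  shows "(\<Sum>y\<in>nb x. a x y * f y) = (\<Sum>y\<in>F. a x y * f y)"
proof -
  have "(\<Sum>y\<in>nb x. a x y * f y) = (\<Sum>y\<in>nb x \<union> F. a x y * f y)"
    by (rule sum.mono_neutral_left) (use assms finite_nb weight_eq_0 in auto)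
  also have "\<dots> = (\<Sum>y\<in>F. a x y * f y)"
    by (rule sum.mono_neutral_right) (use assms finite_nb in auto)
  finally show ?thesis .
qed

lemma sum_weights_le: "finite F \<Longrightarrow> (\<Sum>y\<in>F. a x y) \<le> mu x"
proof -
  assume F: "finite F"
  have "(\<Sum>y\<in>F. a x y) = (\<Sum>y\<in>F \<inter> nb x. a x y)"
    by (rule sum.mono_neutral_right) (use F weight_eq_0 in auto)
  also have "\<dots> \<le> mu x"
    unfolding mu_eq_sum by (rule sum_mono2) (use finite_nb weight_nonneg in auto)
  finally show ?thesis .
qed

lemma sum_weights_eq: "finite F \<Longrightarrow> nb x \<subseteq> F \<Longrightarrow> (\<Sum>y\<in>F. a x y) = mu x"
  unfolding mu_eq_sum by (rule sum.mono_neutral_right) (use weight_eq_0 in auto)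

lemma avg_mult_mu: "finite F \<Longrightarrow> supp f \<subseteq> F \<Longrightarrow> avg f x * mu x = (\<Sum>y\<in>F. a x y * f y)"
  using mu_pos[of x] sum_nb_eq[of F x f] by (auto simp: avg_def)

lemma finite_supp_avg [simp, intro]: "finite (supp f) \<Longrightarrow> finite (supp (avg f))"
proof -
  assume f: "finite (supp f)"
  have "supp (avg f) \<subseteq> (\<Union>y\<in>supp f. nb y)"
  proof (clarify)
    fix x assume "avg f x \<noteq> 0"
    then obtain y where "y \<in> nb x" "a x y * f y \<noteq> 0"
      unfolding avg_def by (auto elim: sum.not_neutral_contains_not_neutral)
    then show "x \<in> (\<Union>y\<in>supp f. nb y)" using nb_sym[of y x] by auto
  qed
  then show ?thesis using f finite_nb by (auto intro: finite_subset)
qed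

lemma finite_supp_add [simp, intro]:
  "finite (supp f) \<Longrightarrow> finite (supp g) \<Longrightarrow> finite (supp (\<lambda>x. f x + g x))"
  by (rule finite_subset[of _ "supp f \<union> supp g"]) auto

lemma finite_supp_diff [simp, intro]:
  "finite (supp f) \<Longrightarrow> finite (supp g) \<Longrightarrow> finite (supp (\<lambda>x. f x - g x))"
  by (rule finite_subset[of _ "supp f \<union> supp g"]) auto

lemma finite_supp_lazy [simp, intro]: "finite (supp f) \<Longrightarrow> finite (supp (lazy f))"
  by (rule finite_subset[of _ "supp f \<union> supp (avg f)"]) (auto simp: lazy_def)

lemma ip_eq_sum: "finite F \<Longrightarrow> supp f \<subseteq> F \<Longrightarrow> ip f g = (\<Sum>x\<in>F. f x * g x * mu x)"
  unfolding ip_def by (rule sum.mono_neutral_left) auto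

lemma ip_commute: "finite (supp f) \<Longrightarrow> finite (supp g) \<Longrightarrow> ip f g = ip g f"
  by (subst (1 2) ip_eq_sum[of "supp f \<union> supp g"]) (auto simp: mult.commute)

lemma ip_add_left: "finite (supp f) \<Longrightarrow> finite (supp g) \<Longrightarrow> ip (\<lambda>x. f x + g x) h = ip f h + ip g h"
  by (subst (1 2 3) ip_eq_sum[of "supp f \<union> supp g"]) (auto simp: algebra_simps sum.distrib)

lemma ip_diff_left: "finite (supp f) \<Longrightarrow> finite (supp g) \<Longrightarrow> ip (\<lambda>x. f x - g x) h = ip f h - ip g h"
  by (subst (1 2 3) ip_eq_sum[of "supp f \<union> supp g"]) (auto simp: algebra_simps sum_subtractf)

lemma ip_add_right: "ip f (\<lambda>x. g x + h x) = ip f g + ip f h"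
  unfolding ip_def by (auto simp: algebra_simps sum.distrib)

lemma ip_diff_right: "ip f (\<lambda>x. g x - h x) = ip f g - ip f h"
  unfolding ip_def by (auto simp: algebra_simps sum_subtractf)

lemma ip_self_nonneg: "0 \<le> ip f f"
  unfolding ip_def using mu_pos by (auto intro!: sum_nonneg simp: less_imp_le)

lemma ip_avg_eq_sum:
  assumes "finite F" "supp f \<subseteq> F" "supp g \<subseteq> F"
  shows "ip f (avg g) = (\<Sum>x\<in>F. \<Sum>y\<in>F. a x y * (f x * g y))"
proof -
  have "ip f (avg g) = (\<Sum>x\<in>F. f x * (avg g x * mu x))"
    by (simp add: ip_eq_sum[OF assms(1,2)] algebra_simps)
  also have "\<dots> = (\<Sum>x\<in>F. \<Sum>y\<in>F. a x y * (f x * g y))"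
    by (simp add: avg_mult_mu[OF assms(1,3)] sum_distrib_left mult.left_commute)
  finally show ?thesis .
qed

lemma ip_avg_sym:
  assumes "finite (supp f)" "finite (supp g)"
  shows "ip (avg f) g = ip f (avg g)"
proof -
  let ?F = "supp f \<union> supp g"
  have "ip (avg f) g = ip g (avg f)" using assms by (auto intro: ip_commute)
  also have "\<dots> = (\<Sum>x\<in>?F. \<Sum>y\<in>?F. a x y * (g x * f y))"
    using assms by (intro ip_avg_eq_sum) auto
  also have "\<dots> = (\<Sum>y\<in>?F. \<Sum>x\<in>?F. a x y * (g x * f y))"
    by (rule sum.swap)
  also have "\<dots> = (\<Sum>x\<in>?F. \<Sum>y\<in>?F. a x y * (f x * g y))"
    by (intro sum.cong) (auto simp: weight_sym algebra_simps)
  also have "\<dots> = ip f (avg g)"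
    using assms by (intro ip_avg_eq_sum[symmetric]) auto
  finally show ?thesis .
qed

lemma ip_half_right: "ip f (\<lambda>x. g x / 2) = ip f g / 2"
  unfolding ip_def by (simp add: sum_divide_distrib)

lemma ip_lazy_right: "ip f (lazy g) = (ip f g + ip f (avg g)) / 2"
  using ip_half_right[of f "\<lambda>x. g x + avg g x"] unfolding lazy_def[abs_def] by (simp add: ip_add_right)

lemma ip_lazy_left:
  assumes "finite (supp f)" "finite (supp g)"
  shows "ip (lazy f) g = (ip f g + ip (avg f) g) / 2"
  using ip_lazy_right[of g f] assms by (simp add: ip_commute[of _ g])

lemma ip_lazy_sym: "finite (supp f) \<Longrightarrow> finite (supp g) \<Longrightarrow> ip (lazy f) g = ip f (lazy g)"
  by (simp add: ip_lazy_left ip_lazy_right ip_avg_sym)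

text \<open>
  Jensen: the variance of \<open>f\<close> under one step of the walk from \<open>x\<close> is nonnegative.
\<close>

lemma avg_contraction:
  assumes f: "finite (supp f)"
  shows "ip (avg f) (avg f) \<le> ip f f"
proof -
  let ?F = "supp f \<union> supp (avg f)"
  have F: "finite ?F" using f by auto
  have *: "avg f x * avg f x * mu x \<le> (\<Sum>y\<in>?F. a x y * (f y)\<^sup>2)" for x
  proof -
    have "0 \<le> (\<Sum>y\<in>nb x. a x y * (f y - avg f x)\<^sup>2)"
      using weight_nonneg by (intro sum_nonneg) auto
    also have "\<dots> = (\<Sum>y\<in>nb x. a x y * (f y)\<^sup>2) - 2 * avg f x * (\<Sum>y\<in>nb x. a x y * f y)
        + (avg f x)\<^sup>2 * (\<Sum>y\<in>nb x. a x y)"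
      by (simp add: power2_diff algebra_simps sum.distrib sum_subtractf sum_distrib_left)
    also have "(\<Sum>y\<in>nb x. a x y * f y) = avg f x * mu x"
      using mu_pos[of x] by (simp add: avg_def)
    also have "(\<Sum>y\<in>nb x. a x y) = mu x" by (simp add: mu_eq_sum)
    also have "(\<Sum>y\<in>nb x. a x y * (f y)\<^sup>2) = (\<Sum>y\<in>?F. a x y * (f y)\<^sup>2)"
      by (rule sum_nb_eq[OF F]) auto
    finally show ?thesis by (simp add: power2_eq_square algebra_simps)
  qed
  have "ip (avg f) (avg f) = (\<Sum>x\<in>?F. avg f x * avg f x * mu x)"
    by (rule ip_eq_sum[OF F]) auto
  also have "\<dots> \<le> (\<Sum>x\<in>?F. \<Sum>y\<in>?F. a x y * (f y)\<^sup>2)"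
    by (intro sum_mono *)
  also have "\<dots> = (\<Sum>y\<in>?F. (f y)\<^sup>2 * (\<Sum>x\<in>?F. a y x))"
    by (subst sum.swap) (simp add: sum_distrib_left weight_sym mult.commute)
  also have "\<dots> \<le> (\<Sum>y\<in>?F. (f y)\<^sup>2 * mu y)"
    by (intro sum_mono mult_left_mono sum_weights_le F) auto
  also have "\<dots> = ip f f"
    by (subst ip_eq_sum[OF F]) (auto simp: power2_eq_square)
  finally show ?thesis .
qed

text \<open>
  The finite set \<open>F\<close> has to contain the neighbours of the support as well, so that every edge on which
  \<open>f\<close> varies is counted.
\<close>

lemma dirichlet_sum:
  assumes F: "finite F" and supp: "\<And>x. f x \<noteq> 0 \<Longrightarrow> x \<in> F \<and> nb x \<subseteq> F"
  shows "(\<Sum>x\<in>F. \<Sum>y\<in>F. a x y * (f x - f y)\<^sup>2) = 2 * energy f"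
    and "(\<Sum>x\<in>F. \<Sum>y\<in>F. a x y * (f x + f y)\<^sup>2) = 2 * (ip f f + ip f (avg f))"
proof -
  have sF: "supp f \<subseteq> F" using supp by auto
  have 1: "(\<Sum>x\<in>F. \<Sum>y\<in>F. a x y * (f x)\<^sup>2) = ip f f"
  proof -
    have "(\<Sum>y\<in>F. a x y * (f x)\<^sup>2) = f x * f x * mu x" if "x \<in> F" for x
      using sum_weights_eq[OF F, of x] supp[of x]
      by (cases "f x = 0") (auto simp: power2_eq_square simp flip: sum_distrib_right)
    then show ?thesis using ip_eq_sum[OF F sF, of f] by simp
  qed
  have 2: "(\<Sum>x\<in>F. \<Sum>y\<in>F. a x y * (f y)\<^sup>2) = ip f f"
    unfolding 1[symmetric] by (subst sum.swap) (simp add: weight_sym)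
  have 3: "(\<Sum>x\<in>F. \<Sum>y\<in>F. a x y * (f x * f y)) = ip f (avg f)"
    using ip_avg_eq_sum[OF F sF sF] by simp
  have "(\<Sum>x\<in>F. \<Sum>y\<in>F. a x y * (f x - f y)\<^sup>2) =
     (\<Sum>x\<in>F. \<Sum>y\<in>F. a x y * (f x)\<^sup>2) + (\<Sum>x\<in>F. \<Sum>y\<in>F. a x y * (f y)\<^sup>2)
     - 2 * (\<Sum>x\<in>F. \<Sum>y\<in>F. a x y * (f x * f y))"
    by (simp add: power2_diff algebra_simps sum.distrib sum_subtractf sum_distrib_left)
  then show "(\<Sum>x\<in>F. \<Sum>y\<in>F. a x y * (f x - f y)\<^sup>2) = 2 * energy f"
    unfolding 1 2 3 energy_def by simp
  have "(\<Sum>x\<in>F. \<Sum>y\<in>F. a x y * (f x + f y)\<^sup>2) =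
     (\<Sum>x\<in>F. \<Sum>y\<in>F. a x y * (f x)\<^sup>2) + (\<Sum>x\<in>F. \<Sum>y\<in>F. a x y * (f y)\<^sup>2)
     + 2 * (\<Sum>x\<in>F. \<Sum>y\<in>F. a x y * (f x * f y))"
    by (simp add: power2_sum algebra_simps sum.distrib sum_distrib_left)
  then show "(\<Sum>x\<in>F. \<Sum>y\<in>F. a x y * (f x + f y)\<^sup>2) = 2 * (ip f f + ip f (avg f))"
    unfolding 1 2 3 by simp
qed

lemma support_hull:
  assumes "finite (supp f)"
  obtains F where "finite F" "\<And>x. f x \<noteq> 0 \<Longrightarrow> x \<in> F \<and> nb x \<subseteq> F"
proof (rule that)
  show "finite (supp f \<union> (\<Union>x\<in>supp f. nb x))" using assms finite_nb by auto
qed auto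

lemma energy_nonneg: "finite (supp f) \<Longrightarrow> 0 \<le> energy f"
proof -
  assume "finite (supp f)"
  then obtain F where F: "finite F" "\<And>x. f x \<noteq> 0 \<Longrightarrow> x \<in> F \<and> nb x \<subseteq> F"
    using support_hull by blast
  have "0 \<le> (\<Sum>x\<in>F. \<Sum>y\<in>F. a x y * (f x - f y)\<^sup>2)"
    using weight_nonneg by (intro sum_nonneg) auto
  then show ?thesis using dirichlet_sum(1)[OF F] by simp
qed

text \<open>
  With \<open>P = avg\<close> the difference of norms is \<open>(\<langle>f, f\<rangle> - \<langle>f, P f\<rangle>) / 2 + (\<langle>f, f\<rangle> - \<langle>P f, P f\<rangle>) / 4\<close> and the last term is
  nonnegative. For \<open>P\<close> in place of \<open>lazy\<close> no such bound holds: on a finite bipartite graph \<open>P\<close> can preserve the norm of a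
  function of positive energy.
\<close>

lemma lazy_energy:
  assumes f: "finite (supp f)"
  shows "energy f \<le> 2 * (ip f f - ip (lazy f) (lazy f))"
proof -
  have "ip (lazy f) (lazy f) = (ip f f + 2 * ip f (avg f) + ip (avg f) (avg f)) / 4"
    using f ip_avg_sym[of f f] by (simp add: ip_lazy_right ip_lazy_left field_simps)
  then show ?thesis using avg_contraction[OF f] unfolding energy_def by simp
qed

lemma lazy_contraction:
  assumes "finite (supp f)"
  shows "ip (lazy f) (lazy f) \<le> ip f f"
proof -
  have "0 \<le> 2 * (ip f f - ip (lazy f) (lazy f))"
    by (rule order_trans[OF energy_nonneg[OF assms] lazy_energy[OF assms]])
  then show ?thesis by simp
qed

end

section \<open>From isoperimetry to a Nash inequality\<close>

locale isoperimetric_graph = bounded_graph E a lo hi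
  for E :: "'v::countable set set" and a lo hi +
  fixes d \<kappa> :: real
  assumes dim: "1 \<le> d" and kappa_pos: "0 < \<kappa>"
    and isoperimetry: "finite A \<Longrightarrow>
      (\<Sum>x\<in>A. vertex_weight E a x) powr (1 - 1 / d) \<le> \<kappa> * (\<Sum>x\<in>A. \<Sum>y\<in>{y. {x, y} \<in> E} - A. a x y)"
begin

text \<open>
  A discrete coarea formula: \<open>f\<close> is a sum of multiples of indicators of its superlevel sets, and both sides are
  additive over these layers. The induction removes the lowest layer, whose height is the least positive
  value of \<open>f\<close>. Each superlevel set has weight at most \<open>m\<close>, which turns \<open>\<mu>(S)\<^sup>1\<^sup>-\<^sup>1\<^sup>/\<^sup>d\<close> into \<open>\<mu>(S) m\<^sup>-\<^sup>1\<^sup>/\<^sup>d\<close>.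
\<close>

lemma l1_gradient:
  assumes F: "finite F" and supp: "\<And>x. f x \<noteq> 0 \<Longrightarrow> x \<in> F \<and> nb x \<subseteq> F"
    and nonneg: "\<And>x. 0 \<le> f x" and m: "(\<Sum>x\<in>supp f. mu x) \<le> m"
  shows "2 / \<kappa> * m powr (- 1 / d) * (\<Sum>x\<in>F. f x * mu x) \<le> (\<Sum>x\<in>F. \<Sum>y\<in>F. a x y * \<bar>f x - f y\<bar>)"
  using supp nonneg m
proof (induction "card (supp f)" arbitrary: f rule: less_induct)
  case less
  define S where "S = supp f"
  have SF: "S \<subseteq> F" using less.prems(1) unfolding S_def by auto
  then have fS: "finite S" using F finite_subset by auto
  let ?c0 = "2 / \<kappa> * m powr (- 1 / d)"
  show ?case
  proof (cases "S = {}")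
    case True
    then have "f x = 0" for x by (auto simp: S_def)
    then show ?thesis by simp
  next
    case False
    define c where "c = Min (f ` S)"
    have c_le: "c \<le> f x" if "x \<in> S" for x unfolding c_def using fS that by auto
    have "c \<in> f ` S" unfolding c_def using fS False by auto
    then obtain x0 where x0: "x0 \<in> S" "f x0 = c" by auto
    then have c_pos: "0 < c" using less.prems(2)[of x0] by (auto simp: S_def)
    define g where "g x = f x - c * of_bool (x \<in> S)" for x
    have gS: "supp g \<subseteq> S - {x0}" using x0 by (auto simp: g_def S_def)
    have gpos: "0 \<le> g x" for x using c_le less.prems(2) by (auto simp: g_def)
    have muS: "0 < (\<Sum>x\<in>S. mu x)" using fS False mu_pos by (intro sum_pos) auto
    have gm: "(\<Sum>x\<in>supp g. mu x) \<le> m"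
    proof -
      have "(\<Sum>x\<in>supp g. mu x) \<le> (\<Sum>x\<in>S. mu x)"
        by (rule sum_mono2) (use fS gS mu_pos in \<open>auto simp: less_imp_le\<close>)
      then show ?thesis using less.prems(3) unfolding S_def by linarith
    qed
    have IH: "?c0 * (\<Sum>x\<in>F. g x * mu x) \<le> (\<Sum>x\<in>F. \<Sum>y\<in>F. a x y * \<bar>g x - g y\<bar>)"
    proof (rule less.hyps)
      show "card (supp g) < card (supp f)"
        by (rule psubset_card_mono) (use fS gS x0 in \<open>auto simp: S_def\<close>)
      show "x \<in> F \<and> nb x \<subseteq> F" if "g x \<noteq> 0" for x
        using that gS less.prems(1)[of x] by (auto simp: S_def)
    qed (use gpos gm in auto)
    have diff: "\<bar>f x - f y\<bar> = \<bar>g x - g y\<bar> + c * of_bool ((x \<in> S) \<noteq> (y \<in> S))" for x y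
    proof -
      have "f z = 0" if "z \<notin> S" for z using that by (simp add: S_def)
      then show ?thesis
        using gpos[of x] gpos[of y] c_pos by (cases "x \<in> S"; cases "y \<in> S") (auto simp: g_def)
    qed
    have cut: "(\<Sum>x\<in>F. \<Sum>y\<in>F. a x y * of_bool ((x \<in> S) \<noteq> (y \<in> S)))
      = 2 * (\<Sum>x\<in>S. \<Sum>y\<in>nb x - S. a x y)"
    proof -
      have inner: "(\<Sum>y\<in>F. a x y * of_bool (y \<notin> S)) = (\<Sum>y\<in>nb x - S. a x y)" if "x \<in> S" for x
      proof -
        have nF: "nb x \<subseteq> F" using that less.prems(1)[of x] by (auto simp: S_def)
        have "(\<Sum>y\<in>F. a x y * of_bool (y \<notin> S)) = (\<Sum>y\<in>nb x - S. a x y * of_bool (y \<notin> S))"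
          by (rule sum.mono_neutral_right) (use F nF weight_eq_0 in auto)
        then show ?thesis by simp
      qed
      have half: "(\<Sum>x\<in>F. \<Sum>y\<in>F. a x y * of_bool (x \<in> S \<and> y \<notin> S)) = (\<Sum>x\<in>S. \<Sum>y\<in>nb x - S. a x y)"
      proof -
        have "(\<Sum>x\<in>F. \<Sum>y\<in>F. a x y * of_bool (x \<in> S \<and> y \<notin> S))
           = (\<Sum>x\<in>S. \<Sum>y\<in>F. a x y * of_bool (x \<in> S \<and> y \<notin> S))"
          by (rule sum.mono_neutral_right) (use F SF in auto)
        then show ?thesis using inner by simp
      qed
      have half': "(\<Sum>x\<in>F. \<Sum>y\<in>F. a x y * of_bool (x \<notin> S \<and> y \<in> S)) = (\<Sum>x\<in>S. \<Sum>y\<in>nb x - S. a x y)"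
        unfolding half[symmetric]
        by (subst sum.swap) (intro sum.cong refl, simp add: weight_sym conj_commute)
      have "of_bool ((x \<in> S) \<noteq> (y \<in> S)) = (of_bool (x \<in> S \<and> y \<notin> S) + of_bool (x \<notin> S \<and> y \<in> S) :: real)" for x y
        by auto
      then have "(\<Sum>x\<in>F. \<Sum>y\<in>F. a x y * of_bool ((x \<in> S) \<noteq> (y \<in> S))) =
         (\<Sum>x\<in>F. \<Sum>y\<in>F. a x y * of_bool (x \<in> S \<and> y \<notin> S)) + (\<Sum>x\<in>F. \<Sum>y\<in>F. a x y * of_bool (x \<notin> S \<and> y \<in> S))"
        by (simp only: ring_distribs sum.distrib)
      then show ?thesis using half half' by simp
    qed
    have "?c0 * (\<Sum>x\<in>S. mu x) \<le> 2 * (\<Sum>x\<in>S. \<Sum>y\<in>nb x - S. a x y)"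
    proof -
      have "m powr (- 1 / d) \<le> (\<Sum>x\<in>S. mu x) powr (- 1 / d)"
        using less.prems(3) muS dim unfolding S_def[symmetric] by (intro powr_mono2') auto
      then have "(\<Sum>x\<in>S. mu x) * m powr (- 1 / d) \<le> (\<Sum>x\<in>S. mu x) * (\<Sum>x\<in>S. mu x) powr (- 1 / d)"
        using muS by (intro mult_left_mono) auto
      also have "\<dots> = (\<Sum>x\<in>S. mu x) powr (1 - 1 / d)"
        using muS powr_add[of "\<Sum>x\<in>S. mu x" 1 "- 1 / d"] by simp
      also have "\<dots> \<le> \<kappa> * (\<Sum>x\<in>S. \<Sum>y\<in>nb x - S. a x y)"
        by (rule isoperimetry[OF fS])
      finally show ?thesis using kappa_pos by (simp add: field_simps)
    qed
    moreover have "(\<Sum>x\<in>F. f x * mu x) = (\<Sum>x\<in>F. g x * mu x) + c * (\<Sum>x\<in>S. mu x)"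
    proof -
      have "(\<Sum>x\<in>F. f x * mu x) = (\<Sum>x\<in>F. g x * mu x) + c * (\<Sum>x\<in>F. of_bool (x \<in> S) * mu x)"
        by (simp add: g_def algebra_simps sum.distrib sum_subtractf sum_distrib_left)
      also have "(\<Sum>x\<in>F. of_bool (x \<in> S) * mu x) = (\<Sum>x\<in>S. of_bool (x \<in> S) * mu x)"
        by (rule sum.mono_neutral_right) (use F SF in auto)
      finally show ?thesis by simp
    qed
    moreover have "(\<Sum>x\<in>F. \<Sum>y\<in>F. a x y * \<bar>f x - f y\<bar>) = (\<Sum>x\<in>F. \<Sum>y\<in>F. a x y * \<bar>g x - g y\<bar>)
       + c * (\<Sum>x\<in>F. \<Sum>y\<in>F. a x y * of_bool ((x \<in> S) \<noteq> (y \<in> S)))"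
      by (simp only: diff ring_distribs sum.distrib sum_distrib_left mult.left_commute)
    ultimately show ?thesis
      using IH c_pos cut mult_left_mono[of "?c0 * (\<Sum>x\<in>S. mu x)" "2 * (\<Sum>x\<in>S. \<Sum>y\<in>nb x - S. a x y)" c]
      by (simp add: algebra_simps)
  qed
qed

text \<open>
  The previous inequality for \<open>f\<^sup>2\<close>, as in the proof of Cheeger's inequality.
\<close>

lemma faber_krahn:
  assumes f: "finite (supp f)" and nonneg: "\<And>x. 0 \<le> f x"
    and m: "(\<Sum>x\<in>supp f. mu x) \<le> m" and m_pos: "0 < m"
  shows "ip f f \<le> 2 * \<kappa>\<^sup>2 * m powr (2 / d) * energy f"
proof -
  obtain F where F: "finite F" "\<And>x. f x \<noteq> 0 \<Longrightarrow> x \<in> F \<and> nb x \<subseteq> F"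
    using support_hull[OF f] by blast
  define c where "c = 2 / \<kappa> * m powr (- 1 / d)"
  have c: "0 < c" unfolding c_def using kappa_pos m_pos by simp
  \<comment> \<open>The weights of the two squares are chosen so that, after summation, half of the left-hand side is absorbed.\<close>
  have young: "\<bar>x\<^sup>2 - y\<^sup>2\<bar> \<le> 2 / c * (x - y)\<^sup>2 + c / 8 * (x + y)\<^sup>2" for x y :: real
  proof -
    have "0 \<le> 2 / c * (\<bar>x - y\<bar> - c / 4 * \<bar>x + y\<bar>)\<^sup>2" using c by simp
    also have "\<dots> = 2 / c * (x - y)\<^sup>2 + c / 8 * (x + y)\<^sup>2 - \<bar>x - y\<bar> * \<bar>x + y\<bar>"
      using c by (simp add: power2_diff field_simps power2_eq_square)
    finally show ?thesis by (simp add: power2_eq_square square_diff_square_factored flip: abs_mult) (simp add: algebra_simps)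
  qed
  have "c * ip f f = c * (\<Sum>x\<in>F. (f x)\<^sup>2 * mu x)"
    using ip_eq_sum[OF F(1), of f f] F(2) by (auto simp: power2_eq_square subset_iff)
  also have "\<dots> \<le> (\<Sum>x\<in>F. \<Sum>y\<in>F. a x y * \<bar>(f x)\<^sup>2 - (f y)\<^sup>2\<bar>)"
    unfolding c_def by (rule l1_gradient) (use F m in auto)
  also have "\<dots> \<le> (\<Sum>x\<in>F. \<Sum>y\<in>F. a x y * (2 / c * (f x - f y)\<^sup>2 + c / 8 * (f x + f y)\<^sup>2))"
    by (intro sum_mono mult_left_mono young weight_nonneg)
  also have "\<dots> = 2 / c * (\<Sum>x\<in>F. \<Sum>y\<in>F. a x y * (f x - f y)\<^sup>2)
      + c / 8 * (\<Sum>x\<in>F. \<Sum>y\<in>F. a x y * (f x + f y)\<^sup>2)"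
    by (simp only: ring_distribs sum.distrib sum_distrib_left mult.left_commute)
  also have "\<dots> = 4 / c * energy f + c / 4 * (ip f f + ip f (avg f))"
  proof -
    have "(\<Sum>x\<in>F. \<Sum>y\<in>F. a x y * (f x - f y)\<^sup>2) = 2 * energy f"
      by (rule dirichlet_sum(1)) (use F in auto)
    moreover have "(\<Sum>x\<in>F. \<Sum>y\<in>F. a x y * (f x + f y)\<^sup>2) = 2 * (ip f f + ip f (avg f))"
      by (rule dirichlet_sum(2)) (use F in auto)
    ultimately show ?thesis by simp
  qed
  also have "\<dots> \<le> 4 / c * energy f + c / 4 * (2 * ip f f)"
    using energy_nonneg[OF f] c unfolding energy_def by (intro add_left_mono mult_left_mono) auto
  finally have "c\<^sup>2 * ip f f \<le> 8 * energy f"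
    using c by (simp add: field_simps power2_eq_square)
  moreover have "c\<^sup>2 = 4 / (\<kappa>\<^sup>2 * m powr (2 / d))"
  proof -
    have "(m powr (- 1 / d))\<^sup>2 = m powr (- (2 / d))"
      by (simp add: power2_eq_square flip: powr_add)
    also have "\<dots> = 1 / m powr (2 / d)" by (simp add: powr_minus_divide)
    finally show ?thesis unfolding c_def power_mult_distrib power_divide by simp
  qed
  ultimately have "4 * ip f f \<le> 8 * energy f * (\<kappa>\<^sup>2 * m powr (2 / d))"
    using kappa_pos m_pos by (simp add: pos_divide_le_eq)
  then show ?thesis by (simp add: mult_ac)
qed

text \<open>
  The part \<open>(f - t)\<^sup>+\<close> above the level \<open>t\<close> is supported on a set of weight at most \<open>\<parallel>f\<parallel>\<^sub>1 / t\<close>, has no more energy than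
  \<open>f\<close>, and \<open>f\<^sup>2 \<le> ((f - t)\<^sup>+)\<^sup>2 + 2 t f\<close>. The level is left free; optimising it gives the usual form.
\<close>

lemma nash:
  assumes f: "finite (supp f)" and nonneg: "\<And>x. 0 \<le> f x"
    and t: "0 < t" and N: "0 < ip f (\<lambda>_. 1)"
  shows "ip f f \<le> 2 * \<kappa>\<^sup>2 * (ip f (\<lambda>_. 1) / t) powr (2 / d) * energy f + 2 * t * ip f (\<lambda>_. 1)"
proof -
  obtain F where F: "finite F" "\<And>x. f x \<noteq> 0 \<Longrightarrow> x \<in> F \<and> nb x \<subseteq> F"
    using support_hull[OF f] by blast
  have sF: "supp f \<subseteq> F" using F(2) by auto
  define g where "g x = max 0 (f x - t)" for x
  have gf: "supp g \<subseteq> supp f" using nonneg t by (auto simp: g_def max_def)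
  have sg: "finite (supp g)" using gf f finite_subset by blast
  have Fg: "x \<in> F \<and> nb x \<subseteq> F" if "g x \<noteq> 0" for x using that gf F(2) by auto
  have m: "(\<Sum>x\<in>supp g. mu x) \<le> ip f (\<lambda>_. 1) / t"
  proof -
    have "(\<Sum>x\<in>supp g. mu x) \<le> (\<Sum>x\<in>supp g. f x * mu x / t)"
      using t mu_pos by (intro sum_mono) (auto simp: g_def max_def field_simps split: if_splits)
    also have "\<dots> \<le> (\<Sum>x\<in>supp f. f x * mu x / t)"
      by (rule sum_mono2) (use f gf nonneg t mu_pos in \<open>auto simp: less_imp_le\<close>)
    also have "\<dots> = ip f (\<lambda>_. 1) / t" by (simp add: ip_def sum_divide_distrib)
    finally show ?thesis .
  qed
  have "ip f f \<le> ip g g + 2 * t * ip f (\<lambda>_. 1)"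
  proof -
    have "f x * f x \<le> g x * g x + 2 * t * f x" for x
      using nonneg[of x] t by (cases "t \<le> f x") (auto simp: g_def algebra_simps intro: mult_mono)
    then have "f x * f x * mu x \<le> g x * g x * mu x + 2 * t * (f x * 1 * mu x)" for x
      using mult_right_mono[of "f x * f x" "g x * g x + 2 * t * f x" "mu x"] mu_pos[of x] by (simp add: algebra_simps)
    then have "(\<Sum>x\<in>F. f x * f x * mu x) \<le> (\<Sum>x\<in>F. g x * g x * mu x) + 2 * t * (\<Sum>x\<in>F. f x * 1 * mu x)"
      unfolding sum_distrib_left sum.distrib[symmetric] by (rule sum_mono)
    moreover have "supp g \<subseteq> F" using Fg by auto
    ultimately show ?thesis using ip_eq_sum[OF F(1)] sF by simp
  qed
  also have "ip g g \<le> 2 * \<kappa>\<^sup>2 * (ip f (\<lambda>_. 1) / t) powr (2 / d) * energy g"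
    by (rule faber_krahn) (use sg m t N in \<open>auto simp: g_def\<close>)
  also have "energy g \<le> energy f"
  proof -
    have "(g x - g y)\<^sup>2 \<le> (f x - f y)\<^sup>2" for x y
      by (rule abs_le_square_iff[THEN iffD1]) (auto simp: g_def max_def)
    then have "(\<Sum>x\<in>F. \<Sum>y\<in>F. a x y * (g x - g y)\<^sup>2) \<le> (\<Sum>x\<in>F. \<Sum>y\<in>F. a x y * (f x - f y)\<^sup>2)"
      by (intro sum_mono mult_left_mono weight_nonneg)
    also have "(\<Sum>x\<in>F. \<Sum>y\<in>F. a x y * (g x - g y)\<^sup>2) = 2 * energy g"
      by (rule dirichlet_sum(1)) (use F(1) Fg in auto)
    also have "(\<Sum>x\<in>F. \<Sum>y\<in>F. a x y * (f x - f y)\<^sup>2) = 2 * energy f"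
      by (rule dirichlet_sum(1)) (use F in auto)
    finally show ?thesis by simp
  qed
  finally show ?thesis by (simp add: mult_left_mono)
qed

end

section \<open>The Gaussian bound of Carne and Varopoulos\<close>

lemma cosh_le_exp_square:
  fixes s :: real assumes "0 \<le> s"
  shows "cosh s \<le> exp (s\<^sup>2)"
proof (cases "s \<le> 1")
  case True
  have "exp (- s) \<le> 1 - s + s\<^sup>2"
  proof -
    have "exp (- s) \<le> 1 / (1 + s)"
      using exp_ge_add_one_self[of s] assms by (simp add: exp_minus field_simps)
    also have "\<dots> \<le> 1 - s + s\<^sup>2"
    proof -
      have "1 \<le> (1 - s + s\<^sup>2) * (1 + s)"
        using assms by (simp add: algebra_simps power2_eq_square)
      then show ?thesis using assms by (simp add: pos_divide_le_eq)
    qed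
    finally show ?thesis .
  qed
  moreover have "exp s \<le> 1 + s + s\<^sup>2" by (rule exp_bound) (use assms True in auto)
  ultimately have "cosh s \<le> 1 + s\<^sup>2" by (simp add: cosh_def)
  also have "\<dots> \<le> exp (s\<^sup>2)" by (rule exp_ge_add_one_self)
  finally show ?thesis .
next
  case False
  then have "s \<le> s\<^sup>2" by (simp add: power2_eq_square)
  have "exp (- s) \<le> exp s" using assms by simp
  then have "cosh s \<le> exp s" by (simp add: cosh_def)
  also have "\<dots> \<le> exp (s\<^sup>2)" using \<open>s \<le> s\<^sup>2\<close> by simp
  finally show ?thesis .
qed

section \<open>Decay of the heat kernel\<close>

text \<open>
  The discrete form of \<open>u' \<le> - u\<^sup>1\<^sup>+\<^sup>b / K\<close>: the quantity \<open>u\<^sup>-\<^sup>b\<close> grows by at least \<open>b / K\<close> in each step.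
\<close>

lemma powr_decay_of_differences:
  fixes u :: "nat \<Rightarrow> real"
  assumes pos: "\<And>n. 0 < u n" and b: "0 < b" and K: "0 < K"
    and diff: "\<And>n. u n powr (1 + b) \<le> K * (u n - u (Suc n))" and n: "0 < n"
  shows "u n \<le> (b * n / K) powr (- 1 / b)"
proof -
  have step: "u n powr (- b) + b / K \<le> u (Suc n) powr (- b)" for n
  proof -
    define z where "z = 1 - u (Suc n) / u n"
    have un: "u (Suc n) = u n * (1 - z)" using pos[of n] by (simp add: z_def)
    then have z1: "0 < 1 - z" using pos[of n] pos[of "Suc n"] by (simp add: zero_less_mult_iff)
    have "u n * u n powr b \<le> K * (u n * z)"
      using diff[of n] pos[of n] by (simp add: un powr_add algebra_simps)
    then have zb: "u n powr b \<le> K * z"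
      using pos[of n] by (simp add: mult.left_commute[of K])
    have "1 + b * z \<le> exp (b * z)" by (rule exp_ge_add_one_self)
    also have "\<dots> \<le> exp (- b * ln (1 - z))"
      using mult_left_mono[OF ln_le_minus_one[OF z1], of b] b by (simp add: algebra_simps)
    also have "\<dots> = (1 - z) powr (- b)" using z1 by (simp add: powr_def)
    finally have "u n powr (- b) * (1 + b * z) \<le> u n powr (- b) * (1 - z) powr (- b)"
      by (intro mult_left_mono) auto
    also have "\<dots> = u (Suc n) powr (- b)"
      unfolding un using pos[of n] z1 by (simp add: powr_mult)
    finally have "u n powr (- b) + u n powr (- b) * (b * z) \<le> u (Suc n) powr (- b)"
      by (simp add: algebra_simps)
    moreover have "b / K \<le> u n powr (- b) * (b * z)"
    proof -
      have "u n powr (- b) * u n powr b = 1" using pos[of n] by (simp flip: powr_add)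
      moreover have "u n powr (- b) * u n powr b \<le> u n powr (- b) * (K * z)"
        using zb by (intro mult_left_mono) auto
      ultimately have "1 \<le> K * (u n powr (- b) * z)" by (simp add: algebra_simps)
      then have "b * 1 \<le> b * (K * (u n powr (- b) * z))" using b by (intro mult_left_mono) auto
      then show ?thesis using K by (simp add: field_simps)
    qed
    ultimately show ?thesis by linarith
  qed
  have "b * n / K \<le> u n powr (- b)" for n :: nat
  proof (induction n)
    case (Suc n)
    then show ?case using step[of n] by (simp add: distrib_left add_divide_distrib)
  qed simp
  then have "(u n powr (- b)) powr (- 1 / b) \<le> (b * n / K) powr (- 1 / b)"
    using b K n by (intro powr_mono2') auto
  then show ?thesis using pos[of n] b by (simp add: powr_powr)
qed

context bounded_graph
begin

text \<open>
  \<open>heat n x y\<close> is the probability that the lazy walk from \<open>y\<close> is at \<open>x\<close> after \<open>n\<close> steps, as a function of the starting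
  point \<open>y\<close>.
\<close>

definition heat :: "nat \<Rightarrow> 'v \<Rightarrow> 'v \<Rightarrow> real" where
  "heat n x = (lazy ^^ n) (\<lambda>y. of_bool (y = x))"

lemma finite_supp_lazy_power [simp, intro]: "finite (supp f) \<Longrightarrow> finite (supp ((lazy ^^ n) f))"
  by (induction n) auto

lemma finite_supp_heat [simp, intro]: "finite (supp (heat n x))"
  unfolding heat_def by (intro finite_supp_lazy_power) auto

lemma heat_0: "heat 0 x y = of_bool (y = x)"
  by (simp add: heat_def)

lemma heat_Suc: "heat (Suc n) x = lazy (heat n x)"
  by (simp add: heat_def)

lemma finite_supp_neq [simp, intro]:
  "finite (supp f) \<Longrightarrow> finite (supp g) \<Longrightarrow> finite {x. f x \<noteq> g x}"
  using finite_supp_diff[of f g] by simp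

lemma avg_add: "avg (\<lambda>y. f y + g y) x = avg f x + avg g x"
  by (simp add: avg_def distrib_left sum.distrib add_divide_distrib)

lemma avg_diff: "avg (\<lambda>y. f y - g y) x = avg f x - avg g x"
  by (simp add: avg_def right_diff_distrib sum_subtractf diff_divide_distrib)

lemma lazy_add: "lazy (\<lambda>y. f y + g y) = (\<lambda>y. lazy f y + lazy g y)"
  by (simp add: lazy_def[abs_def] avg_add add_divide_distrib fun_eq_iff)

lemma lazy_diff: "lazy (\<lambda>y. f y - g y) = (\<lambda>y. lazy f y - lazy g y)"
  by (simp add: lazy_def[abs_def] avg_diff add_divide_distrib diff_divide_distrib fun_eq_iff)

lemma avg_mono: "(\<And>y. f y \<le> g y) \<Longrightarrow> avg f x \<le> avg g x"
  unfolding avg_def using mu_pos[of x] weight_nonneg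
  by (intro divide_right_mono sum_mono mult_left_mono) (auto simp: less_imp_le)

lemma avg_const: "avg (\<lambda>_. c) x = c"
  using mu_pos[of x] unfolding avg_def by (simp flip: sum_distrib_right mu_eq_sum)

lemma lazy_nonneg: "(\<And>y. 0 \<le> f y) \<Longrightarrow> 0 \<le> lazy f x"
  using avg_mono[of "\<lambda>_. 0" f x] by (simp add: lazy_def avg_const)

lemma lazy_le_const: "(\<And>y. f y \<le> c) \<Longrightarrow> lazy f x \<le> c"
  using avg_mono[of f "\<lambda>_. c" x] by (simp add: lazy_def avg_const field_simps) (smt (verit))

lemma heat_nonneg: "0 \<le> heat n x y"
  by (induction n arbitrary: y) (auto simp: heat_0 heat_Suc intro: lazy_nonneg)

lemma heat_le_1: "heat n x y \<le> 1"
  by (induction n arbitrary: y) (auto simp: heat_0 heat_Suc intro: lazy_le_const)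

lemma ip_delta_right: "finite (supp f) \<Longrightarrow> ip f (\<lambda>y. of_bool (y = x)) = f x * mu x"
proof -
  assume "finite (supp f)"
  then have "ip f (\<lambda>y. of_bool (y = x)) = (\<Sum>y\<in>insert x (supp f). f y * of_bool (y = x) * mu y)"
    by (intro ip_eq_sum) auto
  also have "\<dots> = (\<Sum>y\<in>{x}. f y * of_bool (y = x) * mu y)"
    by (rule sum.mono_neutral_right) (use \<open>finite (supp f)\<close> in auto)
  finally show ?thesis by simp
qed

text \<open>
  By symmetry, since \<open>lazy\<close> fixes constants; the constant is truncated to a finite set to apply
  symmetry.
\<close>

lemma ip_lazy_one:
  assumes f: "finite (supp f)"
  shows "ip (lazy f) (\<lambda>_. 1) = ip f (\<lambda>_. 1)"
proof -
  obtain F where F: "finite F" "\<And>x. f x \<noteq> 0 \<Longrightarrow> x \<in> F \<and> nb x \<subseteq> F"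
    using support_hull[OF f] by blast
  define g where "g x = (of_bool (x \<in> F \<union> supp (lazy f)) :: real)" for x
  have g: "finite (supp g)" by (rule finite_subset[of _ "F \<union> supp (lazy f)"]) (use F f in \<open>auto simp: g_def\<close>)
  have "ip (lazy f) (\<lambda>_. 1) = ip (lazy f) g" by (auto simp: ip_def g_def)
  also have "\<dots> = ip f (lazy g)" by (rule ip_lazy_sym[OF f g])
  also have "\<dots> = ip f (\<lambda>_. 1)"
  proof -
    have "lazy g x = 1" if "f x \<noteq> 0" for x
    proof -
      have "avg g x = avg (\<lambda>_. 1) x" unfolding avg_def using F(2)[OF that]
        by (intro arg_cong2[where f = "(/)"] sum.cong) (auto simp: g_def)
      then show ?thesis using F(2)[OF that] by (simp add: avg_const lazy_def g_def)
    qed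
    then show ?thesis by (auto simp: ip_def)
  qed
  finally show ?thesis .
qed

lemma heat_mass: "ip (heat n x) (\<lambda>_. 1) = mu x"
proof (induction n)
  case 0
  show ?case by (subst ip_eq_sum[of "{x}"]) (auto simp: heat_0)
next
  case (Suc n)
  then show ?case by (simp add: heat_Suc ip_lazy_one)
qed

lemma heat_diag_pos: "0 < heat n x x"
proof (induction n)
  case 0 show ?case by (simp add: heat_0)
next
  case (Suc n)
  have "0 \<le> avg (heat n x) x" using avg_mono[of "\<lambda>_. 0" "heat n x" x] heat_nonneg by (simp add: avg_const)
  then show ?case using Suc by (simp add: heat_Suc lazy_def)
qed

lemma ip_heat_split: "ip (heat (m + n) x) (heat k y) = ip (heat n x) (heat (m + k) y)"
proof (induction m arbitrary: k)
  case (Suc m)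
  have "ip (heat (Suc m + n) x) (heat k y) = ip (heat (m + n) x) (heat (Suc k) y)"
    by (simp add: heat_Suc ip_lazy_sym)
  then show ?case using Suc.IH[of "Suc k"] by simp
qed simp

lemma ip_le_half:
  assumes "finite (supp f)" "finite (supp g)"
  shows "ip f g \<le> (ip f f + ip g g) / 2"
proof -
  have "0 \<le> ip (\<lambda>x. f x - g x) (\<lambda>x. f x - g x)" by (rule ip_self_nonneg)
  also have "\<dots> = ip f f + ip g g - 2 * ip f g"
    using assms ip_commute[of g f] by (simp add: ip_diff_left ip_diff_right)
  finally show ?thesis by simp
qed

end

text \<open>
  Let \<open>u n\<close> be the squared norm of \<open>heat n x\<close>, whose mass is \<open>\<mu>\<^sub>x\<close>. In the Nash inequality the level
  \<open>t = u n / (4 \<mu>\<^sub>x)\<close> absorbs half of the left-hand side, and the energy is controlled by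
  \<open>u n - u (n + 1)\<close>; this is the difference inequality solved above. At even times \<open>2 n\<close> the kernel is an inner
  product of two kernels at time \<open>n\<close>, and at odd times the bound is inherited by the maximum principle.
\<close>

lemma (in isoperimetric_graph) heat_uniform_decay:
  "\<exists>C>0. \<forall>n>0. \<forall>x y. heat n x y \<le> C * real n powr (- d / 2)"
proof -
  define K where "K = 8 * \<kappa>\<^sup>2 * (4 * hi\<^sup>2) powr (2 / d)"
  have hi: "0 < hi" using mu_pos[of undefined] weight_le[of undefined] by linarith
  have K: "0 < K" using kappa_pos hi by (simp add: K_def)
  define u where "u x n = ip (heat n x) (heat n x)" for x n
  have u_pos: "0 < u x n" for x n
  proof -
    have "0 < heat n x x * heat n x x * mu x" using heat_diag_pos mu_pos by simp
    also have "\<dots> \<le> u x n"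
      unfolding u_def ip_def by (rule member_le_sum) (use heat_diag_pos[of n x] mu_pos in \<open>auto simp: less_imp_le\<close>)
    finally show ?thesis .
  qed
  have decay: "u x n powr (1 + 2 / d) \<le> K * (u x n - u x (Suc n))" for x n
  proof -
    let ?f = "heat n x"
    define t where "t = u x n / (4 * mu x)"
    have t: "0 < t" using u_pos mu_pos by (simp add: t_def)
    have "u x n \<le> 2 * \<kappa>\<^sup>2 * (mu x / t) powr (2 / d) * energy ?f + 2 * t * mu x"
      using nash[of ?f t] heat_nonneg t mu_pos[of x] by (simp add: heat_mass u_def)
    moreover have "2 * t * mu x = u x n / 2" using mu_pos[of x] by (simp add: t_def)
    ultimately have "u x n \<le> 4 * \<kappa>\<^sup>2 * (mu x / t) powr (2 / d) * energy ?f" by simp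
    also have "\<dots> \<le> 4 * \<kappa>\<^sup>2 * (mu x / t) powr (2 / d) * (2 * (u x n - u x (Suc n)))"
      using lazy_energy[of ?f] by (intro mult_left_mono) (auto simp: u_def heat_Suc)
    also have "mu x / t = 4 * (mu x)\<^sup>2 / u x n"
      using mu_pos[of x] u_pos[of x n] by (simp add: t_def power2_eq_square)
    also have "4 * \<kappa>\<^sup>2 * (4 * (mu x)\<^sup>2 / u x n) powr (2 / d) * (2 * (u x n - u x (Suc n)))
       = 8 * \<kappa>\<^sup>2 * (4 * (mu x)\<^sup>2) powr (2 / d) * (u x n - u x (Suc n)) / u x n powr (2 / d)"
      using u_pos[of x n] by (simp add: powr_divide)
    also have "\<dots> \<le> K * (u x n - u x (Suc n)) / u x n powr (2 / d)"
    proof -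
      have "(4 * (mu x)\<^sup>2) powr (2 / d) \<le> (4 * hi\<^sup>2) powr (2 / d)"
        using mu_pos[of x] weight_le[of x] dim by (intro powr_mono2 mult_left_mono power_mono) auto
      moreover have "0 \<le> u x n - u x (Suc n)"
        using lazy_contraction[of ?f] by (simp add: u_def heat_Suc)
      ultimately show ?thesis unfolding K_def
        by (intro divide_right_mono mult_right_mono mult_left_mono) auto
    qed
    finally have "u x n * u x n powr (2 / d) \<le> K * (u x n - u x (Suc n))"
      using u_pos[of x n] by (simp add: pos_le_divide_eq)
    then show ?thesis using u_pos[of x n] by (simp add: powr_add)
  qed
  define B where "B = (2 / (d * K)) powr (- d / 2)"
  have B: "0 < B" using dim K by (simp add: B_def)
  have u_le: "u x n \<le> B * real n powr (- d / 2)" if "0 < n" for x n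
  proof -
    have "u x n \<le> (2 / d * n / K) powr (- 1 / (2 / d))"
      by (rule powr_decay_of_differences[where u = "u x", OF u_pos _ K decay that]) (use dim in auto)
    also have "2 / d * n / K = 2 / (d * K) * n" by simp
    also have "(2 / (d * K) * n) powr (- 1 / (2 / d)) = B * real n powr (- d / 2)"
      unfolding B_def using dim K by (subst powr_mult) auto
    finally show ?thesis .
  qed
  have even: "heat (2 * n) x y \<le> B / lo * real n powr (- d / 2)" if "0 < n" for n x y
  proof -
    have "heat (2 * n) x y * mu y = ip (heat (n + n) x) (heat 0 y)"
      using ip_delta_right[of "heat (2 * n) x" y] by (simp add: heat_def[of 0] mult_2)
    also have "\<dots> = ip (heat n x) (heat n y)" by (subst ip_heat_split) simp
    also have "\<dots> \<le> (u x n + u y n) / 2" unfolding u_def by (rule ip_le_half) auto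
    also have "\<dots> \<le> B * real n powr (- d / 2)" using u_le[OF that, of x] u_le[OF that, of y] by simp
    finally have "heat (2 * n) x y * mu y \<le> B * real n powr (- d / 2)" .
    moreover have "heat (2 * n) x y * lo \<le> heat (2 * n) x y * mu y"
      using heat_nonneg weight_ge by (intro mult_left_mono) auto
    ultimately show ?thesis using lo_pos by (simp add: field_simps)
  qed
  define C where "C = max 1 (B / lo * 3 powr (d / 2))"
  have "heat n x y \<le> C * real n powr (- d / 2)" if n: "0 < n" for n x y
  proof (cases "n = 1")
    case True
    then show ?thesis using heat_le_1[of 1 x y] by (simp add: C_def)
  next
    case False
    define k where "k = n div 2"
    have "0 < k" "n \<le> 3 * k" using False n unfolding k_def by presburger+
    then have k: "0 < k" "real n \<le> 3 * real k" by linarith+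
    have "heat n x y \<le> B / lo * real k powr (- d / 2)"
    proof (cases "even n")
      case True
      then show ?thesis using even[OF k(1), of x y] by (simp add: k_def)
    next
      case False
      then have "n = Suc (2 * k)" by (simp add: k_def)
      then show ?thesis using even[OF k(1), of x] by (auto simp: heat_Suc intro: lazy_le_const)
    qed
    also have "\<dots> \<le> B / lo * (real n / 3) powr (- d / 2)"
      using k dim B lo_pos n by (intro mult_left_mono powr_mono2') auto
    also have "(real n / 3) powr (- d / 2) = 3 powr (d / 2) * real n powr (- d / 2)"
      using n by (simp add: powr_divide powr_minus_divide)
    finally have "heat n x y \<le> B / lo * 3 powr (d / 2) * real n powr (- d / 2)" by simp
    also have "\<dots> \<le> C * real n powr (- d / 2)" by (intro mult_right_mono) (auto simp: C_def)
    finally show ?thesis .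
  qed
  moreover have "0 < C" by (simp add: C_def)
  ultimately show ?thesis by blast
qed

context bounded_graph
begin

definition edge_lipschitz :: "('v \<Rightarrow> real) \<Rightarrow> bool" where
  "edge_lipschitz \<rho> \<longleftrightarrow> (\<forall>x y. {x, y} \<in> E \<longrightarrow> \<bar>\<rho> x - \<rho> y\<bar> \<le> 1)"

text \<open>
  \<open>wave x k\<close> consists of \<open>T\<^sub>k(lazy) \<delta>\<^sub>x\<close> and \<open>U\<^sub>k\<^sub>-\<^sub>1(lazy) \<delta>\<^sub>x\<close> for the Chebyshev polynomials of both kinds. With
  \<open>lazy = cos \<theta>\<close> these are \<open>cos (k \<theta>)\<close> and \<open>sin (k \<theta>) / sin \<theta>\<close>, and the recursion is the addition theorem.
\<close>

primrec wave :: "'v \<Rightarrow> nat \<Rightarrow> ('v \<Rightarrow> real) \<times> ('v \<Rightarrow> real)" where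
  "wave x 0 = ((\<lambda>y. of_bool (y = x)), (\<lambda>_. 0))"
| "wave x (Suc k) =
    ((\<lambda>y. lazy (fst (wave x k)) y - (snd (wave x k) y - lazy (lazy (snd (wave x k))) y)),
     (\<lambda>y. lazy (snd (wave x k)) y + fst (wave x k) y))"

abbreviation wave_cos :: "'v \<Rightarrow> nat \<Rightarrow> 'v \<Rightarrow> real" where "wave_cos x k \<equiv> fst (wave x k)"
abbreviation wave_sin :: "'v \<Rightarrow> nat \<Rightarrow> 'v \<Rightarrow> real" where "wave_sin x k \<equiv> snd (wave x k)"

lemma finite_supp_wave: "finite (supp (wave_cos x k)) \<and> finite (supp (wave_sin x k))"
proof (induction k)
  case (Suc k)
  show ?case unfolding wave.simps fst_conv snd_conv
    by (intro conjI finite_supp_add finite_supp_diff finite_supp_lazy) (use Suc in auto)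
qed auto

text \<open>
  The identity \<open>cos\<^sup>2 + sin\<^sup>2 = 1\<close> for operators. As \<open>lazy\<close> is a contraction, it bounds the norm of
  \<open>wave_cos\<close> without any spectral theory.
\<close>

lemma wave_energy:
  "ip (wave_cos x k) (wave_cos x k) + ip (wave_sin x k) (wave_sin x k)
     - ip (lazy (wave_sin x k)) (lazy (wave_sin x k)) = mu x"
proof (induction k)
  case 0
  have "ip (\<lambda>y. of_bool (y = x)) (\<lambda>y. of_bool (y = x)) = mu x"
    by (subst ip_delta_right) auto
  moreover have "ip (\<lambda>_. 0) g = 0" "ip (lazy (\<lambda>_. 0)) g = 0" for g
    by (auto simp: ip_def lazy_def avg_const)
  ultimately show ?case by simp
next
  case (Suc k)
  define c s where "c = wave_cos x k" and "s = wave_sin x k"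
  have f [simp]: "finite (supp c)" "finite (supp s)" using finite_supp_wave by (auto simp: c_def s_def)
  have fl: "finite (supp (lazy c))" "finite (supp (lazy s))" "finite (supp (lazy (lazy s)))" by simp_all
  note sym = ip_lazy_sym[OF f] ip_commute[OF f(2) fl(1)] ip_commute[OF fl(2) f(1)]
    ip_lazy_sym[OF fl(2) f(2)] ip_commute[OF f(2) fl(3)] ip_commute[OF fl(3) fl(1)]
  show ?case
    using Suc.IH unfolding wave.simps fst_conv snd_conv c_def[symmetric] s_def[symmetric] lazy_add
    by (simp add: ip_add_left ip_diff_left ip_add_right ip_diff_right sym)
qed

lemma wave_cos_bound: "\<bar>wave_cos x k y\<bar> \<le> sqrt (hi / lo)"
proof -
  have "ip (wave_cos x k) (wave_cos x k) \<le> mu x"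
    using wave_energy[of x k] lazy_contraction[of "wave_sin x k"] finite_supp_wave[of x k] by simp
  moreover have "(wave_cos x k y)\<^sup>2 * mu y \<le> ip (wave_cos x k) (wave_cos x k)"
  proof (cases "wave_cos x k y = 0")
    case True
    then show ?thesis using ip_self_nonneg by simp
  next
    case False
    have "wave_cos x k y * wave_cos x k y * mu y \<le> ip (wave_cos x k) (wave_cos x k)"
      unfolding ip_def by (rule member_le_sum) (use False finite_supp_wave[of x k] mu_pos in \<open>auto simp: less_imp_le\<close>)
    then show ?thesis by (simp add: power2_eq_square)
  qed
  moreover have "(wave_cos x k y)\<^sup>2 * lo \<le> (wave_cos x k y)\<^sup>2 * mu y"
    using weight_ge by (intro mult_left_mono) auto
  ultimately have "(wave_cos x k y)\<^sup>2 \<le> hi / lo"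
    using weight_le[of x] lo_pos by (simp add: field_simps)
  then show ?thesis using real_le_rsqrt[of "\<bar>wave_cos x k y\<bar>"] by simp
qed

lemma lazy_wave_cos:
  "lazy (wave_cos x (Suc k)) y = (wave_cos x (Suc (Suc k)) y + wave_cos x k y) / 2"
proof -
  define c s where "c = wave_cos x k" and "s = wave_sin x k"
  show ?thesis
    unfolding wave.simps fst_conv snd_conv c_def[symmetric] s_def[symmetric] lazy_add lazy_diff by simp
qed

lemma lazy_wave_cos_0: "lazy (wave_cos x 0) y = wave_cos x 1 y"
proof -
  have "lazy (\<lambda>_. 0) = (\<lambda>_. 0)" by (simp add: lazy_def[abs_def] avg_const)
  then show ?thesis by simp
qed

lemma lazy_nonzero:
  assumes "lazy f y \<noteq> 0" "edge_lipschitz \<rho>" "\<And>z. f z \<noteq> 0 \<Longrightarrow> \<bar>\<rho> z - b\<bar> \<le> r"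
  shows "\<bar>\<rho> y - b\<bar> \<le> r + 1"
proof (cases "f y = 0")
  case True
  with assms(1) have "avg f y \<noteq> 0" by (auto simp: lazy_def)
  then obtain z where z: "z \<in> nb y" "f z \<noteq> 0"
    unfolding avg_def by (auto elim: sum.not_neutral_contains_not_neutral)
  then have "\<bar>\<rho> y - \<rho> z\<bar> \<le> 1" using assms(2) by (auto simp: edge_lipschitz_def)
  then show ?thesis using assms(3)[OF z(2)] by linarith
next
  case False
  then show ?thesis using assms(3)[of y] by linarith
qed

text \<open>
  The degree of \<open>T\<^sub>k\<close> is \<open>k\<close>, so the wave travels at most one edge per unit of time.
\<close>

lemma wave_speed:
  assumes "edge_lipschitz \<rho>"
  shows "(wave_cos x k y \<noteq> 0 \<longrightarrow> \<bar>\<rho> y - \<rho> x\<bar> \<le> real k) \<and> (wave_sin x k y \<noteq> 0 \<longrightarrow> \<bar>\<rho> y - \<rho> x\<bar> \<le> real k - 1)"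
proof (induction k arbitrary: y)
  case 0
  then show ?case by simp
next
  case (Suc k)
  have c: "\<bar>\<rho> y - \<rho> x\<bar> \<le> real k + 1" if "lazy (wave_cos x k) y \<noteq> 0"
    by (rule lazy_nonzero[OF that assms]) (use Suc.IH in blast)
  have s: "\<bar>\<rho> y - \<rho> x\<bar> \<le> real k - 1 + 1" if "lazy (wave_sin x k) y \<noteq> 0" for y
    by (rule lazy_nonzero[OF that assms]) (use Suc.IH in blast)
  have ss: "\<bar>\<rho> y - \<rho> x\<bar> \<le> real k - 1 + 1 + 1" if "lazy (lazy (wave_sin x k)) y \<noteq> 0"
    by (rule lazy_nonzero[OF that assms]) (use s in blast)
  show ?case
    using Suc.IH[of y] c s[of y] ss by fastforce
qed

lemma lazy_power_half: "(lazy ^^ n) (\<lambda>y. (f y + g y) / 2) y = ((lazy ^^ n) f y + (lazy ^^ n) g y) / 2"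
proof (induction n arbitrary: y)
  case (Suc n)
  have half: "lazy (\<lambda>y. (f y + g y) / 2) = (\<lambda>y. (lazy f y + lazy g y) / 2)" for f g
  proof -
    have "avg (\<lambda>y. (f y + g y) / 2) y = (avg f y + avg g y) / 2" for y
      by (simp add: avg_def distrib_left sum.distrib add_divide_distrib flip: sum_divide_distrib)
    then show ?thesis by (simp add: lazy_def[abs_def] add_divide_distrib fun_eq_iff)
  qed
  have "(lazy ^^ n) (\<lambda>y. (f y + g y) / 2) = (\<lambda>y. ((lazy ^^ n) f y + (lazy ^^ n) g y) / 2)"
    using Suc.IH by blast
  then show ?case by (simp add: half)
qed simp

text \<open>
  Since \<open>lazy (wave_cos x k)\<close> is the mean of \<open>wave_cos x (k + 1)\<close> and \<open>wave_cos x (k - 1)\<close>, the heat kernel at time \<open>n\<close> is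
  the mean of \<open>wave_cos x \<bar>S\<^sub>n\<bar>\<close> over a simple random walk \<open>S\<^sub>n\<close> on the integers. The wave is bounded and vanishes
  unless \<open>\<bar>S\<^sub>n\<bar> \<ge> r\<close>, so the bound is Chernoff's for \<open>S\<^sub>n\<close>. In the induction \<open>b m k\<close> stands for a walk
  started at \<open>k\<close>, and \<open>cosh (s k)\<close> is the exponential moment; \<open>s = r / (2 n)\<close> optimises the exponent.
\<close>

lemma carne_varopoulos:
  assumes \<rho>: "edge_lipschitz \<rho>" and r: "0 \<le> r" "r \<le> \<bar>\<rho> y - \<rho> x\<bar>" and n: "0 < n"
  shows "heat n x y \<le> 2 * sqrt (hi / lo) * exp (- r\<^sup>2 / (4 * real n))"
proof -
  define B where "B = sqrt (hi / lo)"
  define s where "s = r / (2 * real n)"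
  have s: "0 \<le> s" using r by (simp add: s_def)
  define b where "b m k = (lazy ^^ m) (wave_cos x (nat \<bar>k\<bar>)) y" for m and k :: int
  have B0: "0 \<le> B" unfolding B_def using wave_cos_bound[of x 0 x] by (auto intro: order_trans[OF abs_ge_zero])
  have bound: "\<bar>b m k\<bar> \<le> 2 * B * exp (- s * r) * cosh s ^ m * cosh (s * real_of_int k)" for m k
  proof (induction m arbitrary: k)
    case 0
    show ?case
    proof (cases "wave_cos x (nat \<bar>k\<bar>) y = 0")
      case True
      then show ?thesis using B0 by (simp add: b_def)
    next
      case False
      then have "r \<le> \<bar>real_of_int k\<bar>"
        using wave_speed[OF \<rho>, of x "nat \<bar>k\<bar>" y] r by simp
      then have "s * r \<le> s * \<bar>real_of_int k\<bar>" using s by (intro mult_left_mono)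
      then have "exp (s * r) \<le> 2 * cosh (s * \<bar>real_of_int k\<bar>)"
        by (simp add: cosh_def) (smt (verit) exp_gt_zero exp_le_cancel_iff)
      also have "cosh (s * \<bar>real_of_int k\<bar>) = cosh (s * real_of_int k)"
        by (cases "0 \<le> k") auto
      finally have "1 \<le> 2 * exp (- s * r) * cosh (s * real_of_int k)"
        by (simp add: exp_minus field_simps)
      then have "B * 1 \<le> B * (2 * exp (- s * r) * cosh (s * real_of_int k))"
        using B0 by (intro mult_left_mono)
      then show ?thesis using wave_cos_bound[of x "nat \<bar>k\<bar>" y] by (simp add: b_def B_def mult_ac)
    qed
  next
    case (Suc m)
    have "lazy (wave_cos x (nat \<bar>k\<bar>)) = (\<lambda>y. (wave_cos x (nat \<bar>k + 1\<bar>) y + wave_cos x (nat \<bar>k - 1\<bar>) y) / 2)"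
    proof (cases "k = 0")
      case True
      then show ?thesis using lazy_wave_cos_0 by auto
    next
      case False
      then obtain j where "k = int (Suc j) \<or> k = - int (Suc j)"
        by (metis int_cases3 of_nat_Suc gr0_implies_Suc)
      then have "nat \<bar>k\<bar> = Suc j" "{nat \<bar>k + 1\<bar>, nat \<bar>k - 1\<bar>} = {Suc (Suc j), j}" by auto
      then show ?thesis using lazy_wave_cos[of x j] by (auto simp: doubleton_eq_iff add.commute simp del: wave.simps)
    qed
    then have "b (Suc m) k = (b m (k + 1) + b m (k - 1)) / 2"
      unfolding b_def funpow_Suc_right o_def by (simp only: lazy_power_half)
    then have "\<bar>b (Suc m) k\<bar> \<le> (\<bar>b m (k + 1)\<bar> + \<bar>b m (k - 1)\<bar>) / 2" by simp
    also have "\<dots> \<le> (2 * B * exp (- s * r) * cosh s ^ m * cosh (s * real_of_int (k + 1)) +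
        2 * B * exp (- s * r) * cosh s ^ m * cosh (s * real_of_int (k - 1))) / 2"
      by (intro divide_right_mono add_mono Suc.IH) auto
    also have "\<dots> = 2 * B * exp (- s * r) * cosh s ^ m * ((cosh (s * real_of_int k + s) + cosh (s * real_of_int k - s)) / 2)"
      by (simp add: algebra_simps)
    also have "(cosh (s * real_of_int k + s) + cosh (s * real_of_int k - s)) / 2 = cosh s * cosh (s * real_of_int k)"
      by (simp add: cosh_add cosh_diff)
    finally show ?case by (simp add: mult_ac)
  qed
  have "heat n x y = b n 0" by (simp add: b_def heat_def)
  also have "\<dots> \<le> 2 * B * exp (- s * r) * cosh s ^ n" using bound[of n 0] by simp
  also have "\<dots> \<le> 2 * B * exp (- s * r) * exp (s\<^sup>2) ^ n"
    using B0 by (intro mult_left_mono power_mono cosh_le_exp_square s) auto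
  also have "\<dots> = 2 * B * exp (- s * r + real n * s\<^sup>2)"
    by (simp only: exp_add exp_of_nat_mult mult.assoc)
  also have "- s * r + real n * s\<^sup>2 = - r\<^sup>2 / (4 * real n)"
    using n by (simp add: s_def field_simps power2_eq_square)
  finally show ?thesis by (simp add: B_def)
qed

end

section \<open>The Green function\<close>

context isoperimetric_graph begin

text \<open>
  The minimum of the two bounds on the heat kernel is at most their geometric mean with weights \<open>\<theta>\<close> and \<open>1 - \<theta>\<close>.
  The Gaussian factor, any power of it, is at most a constant times \<open>(r\<^sup>2 / n)\<^sup>-\<^sup>\<beta>\<^sup>/\<^sup>2\<close>. The remaining power of \<open>n\<close> is
  \<open>\<beta> / 2 - \<theta> d / 2\<close>, which can be made less than \<open>-1\<close> with \<open>\<theta> < 1\<close> precisely because \<open>\<beta> < d - 2\<close>.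
\<close>

lemma heat_space_time_decay:
  assumes \<beta>: "0 < \<beta>" "\<beta> < d - 2"
  obtains C \<epsilon> where "0 < C" "0 < \<epsilon>"
    "\<And>n x y \<rho> r. 0 < n \<Longrightarrow> edge_lipschitz \<rho> \<Longrightarrow> 0 < r \<Longrightarrow> r \<le> \<bar>\<rho> y - \<rho> x\<bar> \<Longrightarrow>
       heat n x y \<le> C * r powr (- \<beta>) * real n powr (- (1 + \<epsilon>))"
proof -
  obtain C1 where C1: "0 < C1" "\<And>n x y. 0 < n \<Longrightarrow> heat n x y \<le> C1 * real n powr (- d / 2)"
    using heat_uniform_decay by blast
  have hi: "0 < hi" using mu_pos[of undefined] weight_le[of undefined] by linarith
  define C2 where "C2 = 2 * sqrt (hi / lo)"
  have C2: "0 < C2" using hi lo_pos by (simp add: C2_def)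
  define \<epsilon> where "\<epsilon> = (d - 2 - \<beta>) / 4"
  define \<theta> where "\<theta> = (\<beta> + 2 + 2 * \<epsilon>) / d"
  have \<epsilon>: "0 < \<epsilon>" using \<beta> by (simp add: \<epsilon>_def)
  have \<theta>: "0 < \<theta>" "\<theta> < 1" "\<theta> * d = \<beta> + 2 + 2 * \<epsilon>"
    using \<beta> dim by (auto simp: \<theta>_def \<epsilon>_def field_simps)
  define c where "c = (1 - \<theta>) / (2 * \<beta>)"
  have c: "0 < c" using \<theta> \<beta> by (simp add: c_def)
  define C where "C = C1 powr \<theta> * C2 powr (1 - \<theta>) * c powr (- \<beta> / 2)"
  have "heat n x y \<le> C * r powr (- \<beta>) * real n powr (- (1 + \<epsilon>))"
    if n: "0 < n" and \<rho>: "edge_lipschitz \<rho>" and r: "0 < r" "r \<le> \<bar>\<rho> y - \<rho> x\<bar>" for n x y \<rho> r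
  proof (cases "heat n x y = 0")
    case True
    then show ?thesis by (simp add: C_def)
  next
    case False
    then have pos: "0 < heat n x y" using heat_nonneg[of n x y] by linarith
    define z where "z = r\<^sup>2 / real n"
    have z: "0 < z" using r n by (simp add: z_def)
    have gauss: "heat n x y \<le> C2 * exp (- z / 4)"
      using carne_varopoulos[OF \<rho> _ r(2) n] r(1) by (simp add: C2_def z_def mult.commute)
    have "heat n x y = heat n x y powr \<theta> * heat n x y powr (1 - \<theta>)"
      using pos by (simp flip: powr_add)
    also have "\<dots> \<le> (C1 * real n powr (- d / 2)) powr \<theta> * (C2 * exp (- z / 4)) powr (1 - \<theta>)"
      using C1(2)[OF n] gauss \<theta> pos by (intro mult_mono powr_mono2) auto
    also have "\<dots> = C1 powr \<theta> * C2 powr (1 - \<theta>) * real n powr (- (\<beta> / 2 + 1 + \<epsilon>)) * exp (- z / 4) powr (1 - \<theta>)"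
    proof -
      have "- d / 2 * \<theta> = - (\<beta> / 2 + 1 + \<epsilon>)" using \<theta>(3) by (simp add: mult.commute field_simps)
      then show ?thesis using C1(1) C2 by (simp add: powr_mult powr_powr)
    qed
    also have "\<dots> \<le> C1 powr \<theta> * C2 powr (1 - \<theta>) * real n powr (- (\<beta> / 2 + 1 + \<epsilon>)) * ((c * z) powr (- \<beta> / 2))"
    proof (intro mult_left_mono)
      have "c * z \<le> exp (c * z)" using exp_ge_add_one_self[of "c * z"] by linarith
      then have "exp (c * z) powr (- \<beta> / 2) \<le> (c * z) powr (- \<beta> / 2)"
        using c z \<beta> by (intro powr_mono2') auto
      moreover have "exp (c * z) powr (- \<beta> / 2) = exp (- z / 4) powr (1 - \<theta>)"
        using \<beta> by (simp add: exp_powr_real c_def field_simps)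
      ultimately show "exp (- z / 4) powr (1 - \<theta>) \<le> (c * z) powr (- \<beta> / 2)" by simp
    qed auto
    also have "(c * z) powr (- \<beta> / 2) = c powr (- \<beta> / 2) * (r powr (- \<beta>) * real n powr (\<beta> / 2))"
    proof -
      have "z powr (- \<beta> / 2) = (r powr 2) powr (- \<beta> / 2) / real n powr (- \<beta> / 2)"
        using r n by (simp add: z_def powr_divide flip: powr_numeral)
      also have "\<dots> = r powr (- \<beta>) * real n powr (\<beta> / 2)"
        by (simp add: powr_powr powr_minus_divide)
      finally show ?thesis using c z by (simp add: powr_mult)
    qed
    also have "C1 powr \<theta> * C2 powr (1 - \<theta>) * real n powr (- (\<beta> / 2 + 1 + \<epsilon>)) *
          (c powr (- \<beta> / 2) * (r powr (- \<beta>) * real n powr (\<beta> / 2)))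
        = C * r powr (- \<beta>) * (real n powr (- (\<beta> / 2 + 1 + \<epsilon>)) * real n powr (\<beta> / 2))"
      by (simp add: C_def)
    also have "real n powr (- (\<beta> / 2 + 1 + \<epsilon>)) * real n powr (\<beta> / 2) = real n powr (- (1 + \<epsilon>))"
      by (simp flip: powr_add)
    finally show ?thesis .
  qed
  moreover have "0 < C" using C1(1) C2 c by (simp add: C_def)
  ultimately show ?thesis using that \<epsilon> by blast
qed

text \<open>
  Half the sum of the lazy kernels over all times; it is the Green function of the walk
  itself. Summing \<open>heat (n + 1) x = lazy (heat n x)\<close> over \<open>n\<close> gives the equation.
\<close>

lemma green_function:
  assumes \<beta>: "0 < \<beta>" "\<beta> < d - 2"
  obtains C h where "0 < C" "\<And>x y. 0 \<le> h x y" "\<And>x y. h x y = of_bool (y = x) + avg (h x) y"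
    "\<And>x y \<rho> r. edge_lipschitz \<rho> \<Longrightarrow> 0 < r \<Longrightarrow> r \<le> \<bar>\<rho> y - \<rho> x\<bar> \<Longrightarrow> h x y \<le> C * r powr (- \<beta>)"
proof -
  obtain C0 \<epsilon> where C0: "0 < C0" "0 < \<epsilon>"
    "\<And>n x y \<rho> r. 0 < n \<Longrightarrow> edge_lipschitz \<rho> \<Longrightarrow> 0 < r \<Longrightarrow> r \<le> \<bar>\<rho> y - \<rho> x\<bar> \<Longrightarrow>
       heat n x y \<le> C0 * r powr (- \<beta>) * real n powr (- (1 + \<epsilon>))"
    using heat_space_time_decay[OF \<beta>] by blast
  obtain C1 where C1: "0 < C1" "\<And>n x y. 0 < n \<Longrightarrow> heat n x y \<le> C1 * real n powr (- d / 2)"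
    using heat_uniform_decay by blast
  have summable: "summable (\<lambda>n. heat n x y)" for x y
  proof (rule summable_comparison_test')
    show "summable (\<lambda>n. C1 * real n powr (- d / 2))"
      using \<beta> by (intro summable_mult) (simp add: summable_real_powr_iff)
    show "norm (heat n x y) \<le> C1 * real n powr (- d / 2)" if "1 \<le> n" for n
      using C1(2)[of n x y] heat_nonneg that by simp
  qed
  define S where "S x y = (\<Sum>n. heat n x y)" for x y
  have sums: "(\<lambda>n. heat n x y) sums S x y" for x y
    unfolding S_def using summable by (rule summable_sums)
  have S_eq: "S x y / 2 = of_bool (y = x) + avg (S x) y / 2" for x y
  proof -
    have "(\<lambda>n. avg (heat n x) y) sums avg (S x) y"
      unfolding avg_def by (intro sums_divide sums_sum sums_mult sums)
    then have "(\<lambda>n. lazy (heat n x) y) sums ((S x y + avg (S x) y) / 2)"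
      unfolding lazy_def by (intro sums_divide sums_add sums)
    moreover have "(\<lambda>n. heat (Suc n) x y) sums (S x y - heat 0 x y)"
      using sums_split_initial_segment[OF sums[of x y], of 1] by simp
    ultimately have "(S x y + avg (S x) y) / 2 = S x y - heat 0 x y"
      unfolding heat_Suc using sums_unique2 by blast
    then show ?thesis by (simp add: heat_0 field_simps)
  qed
  have avg_half: "avg (\<lambda>y. S x y / 2) y = avg (S x) y / 2" for x y
    by (simp add: avg_def flip: sum_divide_distrib)
  define Z where "Z = (\<Sum>n. real n powr (- (1 + \<epsilon>)))"
  have Zs: "summable (\<lambda>n. real n powr (- (1 + \<epsilon>)))"
    using C0(2) by (simp add: summable_real_powr_iff)
  have bound: "S x y / 2 \<le> (C0 * (Z + 1)) * r powr (- \<beta>)"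
    if \<rho>: "edge_lipschitz \<rho>" and r: "0 < r" "r \<le> \<bar>\<rho> y - \<rho> x\<bar>" for x y \<rho> r
  proof -
    have "y \<noteq> x" using r by auto
    then have "heat n x y \<le> C0 * r powr (- \<beta>) * real n powr (- (1 + \<epsilon>))" for n
      using C0(3)[OF _ \<rho> r, of n] by (cases "n = 0") (auto simp: heat_0)
    then have "S x y \<le> (\<Sum>n. C0 * r powr (- \<beta>) * real n powr (- (1 + \<epsilon>)))"
      unfolding S_def by (intro suminf_le summable summable_mult Zs)
    also have "\<dots> = C0 * r powr (- \<beta>) * Z"
      unfolding Z_def by (rule suminf_mult[OF Zs])
    finally have "S x y \<le> C0 * r powr (- \<beta>) * Z" .
    moreover have "0 \<le> S x y" unfolding S_def by (intro suminf_nonneg summable heat_nonneg)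
    moreover have "0 \<le> C0 * r powr (- \<beta>)" using C0(1) by simp
    ultimately show ?thesis by (simp add: algebra_simps)
  qed
  show thesis
  proof (rule that[of "C0 * (Z + 1)" "\<lambda>x y. S x y / 2"])
    have "0 \<le> Z" unfolding Z_def by (intro suminf_nonneg Zs) auto
    then show "0 < C0 * (Z + 1)" using C0(1) by simp
    show "0 \<le> S x y / 2" for x y
      unfolding S_def by (simp add: suminf_nonneg summable heat_nonneg)
    show "S x y / 2 = of_bool (y = x) + avg (\<lambda>y. S x y / 2) y" for x y
      using S_eq avg_half by simp
  qed (rule bound)
qed

end

section \<open>Hitting probabilities of the walk\<close>

abbreviation seq_space :: "(nat \<Rightarrow> 'v::countable) measure" where
  "seq_space \<equiv> \<Pi>\<^sub>M _\<in>UNIV. count_space UNIV"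

abbreviation cylinder :: "nat \<Rightarrow> (nat \<Rightarrow> 'v) \<Rightarrow> (nat \<Rightarrow> 'v) set" where
  "cylinder n q \<equiv> {w. \<forall>i\<le>n. w i = q i}"

lemma space_seq_space [simp]: "space seq_space = UNIV"
  by (simp add: space_PiM)

lemma sets_walk_law [simp, measurable_cong]: "sets (walk_law E a x) = sets seq_space"
proof -
  interpret IT: Ionescu_Tulcea "walk_kernel E a x" "\<lambda>_. count_space UNIV"
    by (rule Ionescu_Tulcea_walk_kernel)
  show ?thesis unfolding walk_law_def by simp
qed

lemma space_walk_law [simp]: "space (walk_law E a x) = UNIV"
  using sets_eq_imp_space_eq[OF sets_walk_law] by simp

lemma sets_cylinder [measurable]: "cylinder n q \<in> sets (seq_space :: (nat \<Rightarrow> 'v::countable) measure)"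
proof -
  have "{w \<in> space seq_space. \<forall>i\<le>n. w i = q i} \<in> sets (seq_space :: (nat \<Rightarrow> 'v) measure)"
    by measurable
  then show ?thesis by simp
qed

lemma prob_space_walk_law: "prob_space (walk_law E a x)"
proof
  have "emeasure (walk_law E a x) (\<Union>v\<in>UNIV. {w. w 0 = v})
      = (\<integral>\<^sup>+v. emeasure (walk_law E a x) {w. w 0 = v} \<partial>count_space UNIV)"
  proof (rule emeasure_UN_countable)
    show "{w. w 0 = v} \<in> sets (walk_law E a x)" for v
      using sets_cylinder[of 0 "\<lambda>_. v"] by simp
  qed (auto simp: disjoint_family_on_def)
  also have "\<dots> = (\<integral>\<^sup>+v. indicator {x} v \<partial>count_space UNIV)"
  proof (rule nn_integral_cong)
    fix v
    show "emeasure (walk_law E a x) {w. w 0 = v} = indicator {x} v"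
      using emeasure_walk_law_cylinder[of E a x 0 "\<lambda>_. v"] by simp
  qed
  also have "(\<Union>v\<in>UNIV. {w::nat \<Rightarrow> 'a. w 0 = v}) = UNIV" by auto
  finally show "emeasure (walk_law E a x) (space (walk_law E a x)) = 1" by simp
qed

lemma emeasure_walk_law_UNIV [simp]: "emeasure (walk_law E a x) UNIV = 1"
  using prob_space.emeasure_space_1[OF prob_space_walk_law, of E a x] by simp

lemma AE_walk_start: "AE w in walk_law E a (y :: 'v::countable). w 0 = y"
proof -
  have "emeasure (walk_law E a y) {w. w 0 = y} = 1"
    using emeasure_walk_law_cylinder[of E a y 0 "\<lambda>_. y"] by simp
  then show ?thesis
    using prob_space.AE_in_set_eq_1[OF prob_space_walk_law, of "{w. w 0 = y}" E a y]
      sets_cylinder[of 0 "\<lambda>_. y"] by (simp add: measure_def)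
qed

abbreviation cylinder_sets :: "(nat \<Rightarrow> 'v) set set" where
  "cylinder_sets \<equiv> insert {} {cylinder n q | n q. True}"

lemma seq_space_generated:
  "sets (seq_space :: (nat \<Rightarrow> 'v::countable) measure) = sigma_sets UNIV cylinder_sets"
proof
  let ?G = "cylinder_sets :: (nat \<Rightarrow> 'v) set set"
  show "sigma_sets UNIV ?G \<subseteq> sets seq_space"
  proof -
    have "?G \<subseteq> sets seq_space" using sets_cylinder by auto
    from sets.sigma_sets_subset[OF this] show ?thesis by simp
  qed
  have "{f. f i \<in> A} \<in> sigma_sets UNIV ?G" for i and A :: "'v set"
  proof -
    have "{f. f i \<in> A} = (\<Union>l\<in>{l. l ! i \<in> A}. cylinder i ((!) l))"
    proof (intro equalityI subsetI)
      fix f assume "f \<in> {f. f i \<in> A}"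
      then show "f \<in> (\<Union>l\<in>{l. l ! i \<in> A}. cylinder i ((!) l))"
        by (intro UN_I[of "map f [0..<Suc i]"]) (auto simp del: upt_Suc simp: nth_append)
    qed auto
    also have "\<dots> \<in> sigma_sets UNIV ?G"
      by (rule sigma_sets_UNION) (auto intro: sigma_sets.Basic)
    finally show ?thesis .
  qed
  then show "sets seq_space \<subseteq> sigma_sets UNIV ?G"
    unfolding sets_PiM_single space_count_space PiE_UNIV_domain by (simp, intro sigma_sets_mono) auto
qed

lemma measurable_case_nat [measurable]: "case_nat x \<in> measurable seq_space (seq_space :: (nat \<Rightarrow> 'v::countable) measure)"
proof (rule measurable_PiM_single')
  fix i :: nat
  show "(\<lambda>w. case_nat x w i) \<in> measurable seq_space (count_space UNIV)"
    by (cases i) auto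
qed auto

text \<open>
  The Markov property at time one. Both sides are measures in \<open>A\<close>, and they agree on cylinders, which
  form a generator stable under intersection.
\<close>

lemma emeasure_walk_law_step:
  assumes A: "A \<in> sets seq_space"
  shows "emeasure (walk_law E a x) A = (\<integral>\<^sup>+y. emeasure (walk_law E a y) {w. case_nat x w \<in> A} \<partial>walk_step E a x)"
proof -
  define N where "N = measure_pmf (walk_step E a x) \<bind> (\<lambda>y. distr (walk_law E a y) seq_space (case_nat x))"
  have meas: "case_nat x \<in> measurable (walk_law E a y) seq_space" for y
    using measurable_case_nat[of x] by (simp cong: measurable_cong_sets)
  have ker: "(\<lambda>y. distr (walk_law E a y) seq_space (case_nat x)) \<in> measurable (measure_pmf (walk_step E a x)) (subprob_algebra seq_space)"
    using prob_space_walk_law prob_space.prob_space_distr[OF prob_space_walk_law meas]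
    by (auto simp: space_subprob_algebra intro!: prob_space_imp_subprob_space)
  have N: "emeasure N B = (\<integral>\<^sup>+y. emeasure (walk_law E a y) {w. case_nat x w \<in> B} \<partial>walk_step E a x)"
    if "B \<in> sets seq_space" for B
    unfolding N_def using that meas
    by (subst emeasure_bind[OF _ ker that]) (auto intro!: nn_integral_cong simp: emeasure_distr vimage_def)
  have "walk_law E a x = N"
  proof (rule measure_eqI_generator_eq_countable[where E = cylinder_sets and \<Omega> = UNIV])
    have C: "cylinder n q \<inter> cylinder m q' \<in> cylinder_sets" if "n \<le> m"
      for n m and q q' :: "nat \<Rightarrow> 'a"
    proof (cases "\<forall>i\<le>n. q i = q' i")
      case True
      then have "cylinder n q \<inter> cylinder m q' = cylinder m q'" using that by auto
      then show ?thesis by blast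
    next
      case False
      then have "cylinder n q \<inter> cylinder m q' = {}" using that by auto
      then show ?thesis by auto
    qed
    show "Int_stable (cylinder_sets :: (nat \<Rightarrow> 'a) set set)"
    proof (rule Int_stableI)
      fix A B :: "(nat \<Rightarrow> 'a) set"
      assume "A \<in> cylinder_sets" "B \<in> cylinder_sets"
      then consider "A = {} \<or> B = {}" | n q m q' where "A = cylinder n q" "B = cylinder m q'" by blast
      then show "A \<inter> B \<in> cylinder_sets"
      proof cases
        case 2
        then show ?thesis using C[of n m q q'] C[of m n q' q] by (cases "n \<le> m") (simp_all add: Int_commute)
      qed auto
    qed
    show "sets (walk_law E a x) = sigma_sets UNIV cylinder_sets"
      by (simp add: seq_space_generated)
    show "sets N = sigma_sets UNIV cylinder_sets"
      unfolding N_def seq_space_generated[symmetric] by (subst sets_bind) auto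
    show "emeasure (walk_law E a x) X = emeasure N X" if X: "X \<in> cylinder_sets" for X
    proof (cases "X = {}")
      case False
      then obtain n q where nq: "X = cylinder n q" using X by blast
      have sets: "X \<in> sets seq_space" unfolding nq by (rule sets_cylinder)
      show ?thesis
      proof (cases n)
        case 0
        have "{w. case_nat x w \<in> X} = (if q 0 = x then UNIV else {})" unfolding nq 0 by auto
        then have "emeasure N X = of_bool (q 0 = x)"
          unfolding N[OF sets] by simp
        then show ?thesis unfolding nq 0 by (subst emeasure_walk_law_cylinder) simp
      next
        case (Suc m)
        have "{w. case_nat x w \<in> X} = (if q 0 = x then cylinder m (\<lambda>i. q (Suc i)) else {})"
          unfolding nq Suc by (auto split: nat.split simp: less_Suc_eq_le)
        then have "emeasure N X = (\<integral>\<^sup>+y. of_bool (q 0 = x) *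
           (of_bool (q 1 = y) * (\<Prod>i<m. ennreal (pmf (walk_step E a (q (Suc i))) (q (Suc (Suc i)))))) \<partial>walk_step E a x)"
          unfolding N[OF sets]
          by (intro nn_integral_cong) (auto simp: emeasure_walk_law_cylinder)
        also have "\<dots> = (\<integral>\<^sup>+y. (of_bool (q 0 = x) * (\<Prod>i<m. ennreal (pmf (walk_step E a (q (Suc i))) (q (Suc (Suc i))))))
             * indicator {q 1} y \<partial>walk_step E a x)"
          by (intro nn_integral_cong) (simp add: indicator_def mult_ac)
        also have "\<dots> = of_bool (q 0 = x) * (\<Prod>i<m. ennreal (pmf (walk_step E a (q (Suc i))) (q (Suc (Suc i)))))
             * emeasure (walk_step E a x) {q 1}"
          by (rule nn_integral_cmult_indicator) simp
        also have "\<dots> = emeasure (walk_law E a x) X"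
          unfolding nq Suc
          by (subst emeasure_walk_law_cylinder) (simp add: prod.lessThan_Suc_shift emeasure_pmf_single mult_ac del: prod.lessThan_Suc)
        finally show ?thesis by simp
      qed
    qed simp
    show "range (\<lambda>v. cylinder 0 (\<lambda>_. v)) \<subseteq> cylinder_sets" by auto
    show "\<Union> (range (\<lambda>v::'a. cylinder 0 (\<lambda>_. v))) = UNIV" by auto
    show "emeasure (walk_law E a x) b \<noteq> \<infinity>" for b
      using finite_measure.emeasure_finite[OF prob_space.finite_measure[OF prob_space_walk_law]] by simp
  qed auto
  then show ?thesis using N[OF A] by simp
qed

lemma return_time_singleton: "return_time {x} w = \<infinity> \<longleftrightarrow> (\<forall>n. w (Suc n) \<noteq> x)"
proof -
  have "return_time {x} w = \<infinity> \<longleftrightarrow> {n. 1 \<le> n \<and> w n = x} = {}"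
    unfolding return_time_def Inf_enat_def
    by (auto simp: image_iff) (smt (verit) LeastI enat.distinct(1) mem_Collect_eq)
  also have "\<dots> \<longleftrightarrow> (\<forall>n. w (Suc n) \<noteq> x)"
    by (auto simp: Suc_le_eq gr0_conv_Suc)
  finally show ?thesis .
qed

lemma sets_seq_spaceI: "Measurable.pred seq_space P \<Longrightarrow> {w. P w} \<in> sets seq_space"
  by (simp add: pred_def)

context bounded_graph begin

lemma nn_integral_walk_step:
  assumes "\<And>y. 0 \<le> f y"
  shows "(\<integral>\<^sup>+y. ennreal (f y) \<partial>walk_step E a x) = ennreal (avg f x)"
proof -
  have pmf: "pmf (walk_step E a x) y = a x y / mu x" for y
    by (rule pmf_walk_step[OF finite_nb mu_pos])
  have "(\<integral>\<^sup>+y. ennreal (f y) \<partial>walk_step E a x) = (\<integral>\<^sup>+y. ennreal (a x y / mu x * f y) \<partial>count_space UNIV)"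
    unfolding nn_integral_measure_pmf pmf
    by (intro nn_integral_cong ennreal_mult[symmetric]) (use assms weight_nonneg mu_pos[of x] in \<open>auto simp: less_imp_le\<close>)
  also have "\<dots> = (\<Sum>y\<in>nb x. ennreal (a x y / mu x * f y))"
    by (rule nn_integral_count_space'[OF finite_nb]) (use weight_eq_0 in auto)
  also have "\<dots> = ennreal (\<Sum>y\<in>nb x. a x y / mu x * f y)"
    by (rule sum_ennreal) (use assms weight_nonneg mu_pos[of x] in \<open>auto simp: less_imp_le\<close>)
  also have "(\<Sum>y\<in>nb x. a x y / mu x * f y) = avg f x"
    by (simp add: avg_def sum_divide_distrib)
  finally show ?thesis .
qed

text \<open>
  The maximum principle: by induction on \<open>n\<close>, using the Markov property at time one, \<open>h\<close> dominates the probability to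
  hit \<open>x\<close> up to time \<open>n\<close>.
\<close>

lemma hitting_le_superharmonic:
  assumes h0: "\<And>y. 0 \<le> h y" and h: "\<And>y. of_bool (y = x) + avg h y \<le> h y"
  shows "emeasure (walk_law E a y) {w. \<exists>n. w n = x} \<le> ennreal (h y)"
proof -
  have sets: "{w. \<exists>k\<le>n. w k = x} \<in> sets seq_space" for n
    by (rule sets_seq_spaceI) measurable
  have le1: "emeasure (walk_law E a y) B \<le> 1" for y B
    by (rule prob_space.measure_le_1[OF prob_space_walk_law])
  have avg0: "0 \<le> avg h y" for y
    using h0 weight_nonneg mu_pos[of y] unfolding avg_def by (intro divide_nonneg_pos sum_nonneg) auto
  have "emeasure (walk_law E a y) {w. \<exists>k\<le>n. w k = x} \<le> ennreal (h y)" for n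
  proof (induction n arbitrary: y)
    case 0
    show ?case
    proof (cases "y = x")
      case True
      then have "1 \<le> h y" using h[of y] avg0[of y] by simp
      then show ?thesis using le1 by (meson ennreal_ge_1 order_trans)
    next
      case False
      then show ?thesis using emeasure_walk_law_cylinder[of E a y 0 "\<lambda>_. x"] by simp
    qed
  next
    case (Suc n)
    show ?case
    proof (cases "y = x")
      case True
      then have "1 \<le> h y" using h[of y] avg0[of y] by simp
      then show ?thesis using le1 by (meson ennreal_ge_1 order_trans)
    next
      case False
      have "{w. case_nat y w \<in> {w. \<exists>k\<le>Suc n. w k = x}} = {w. \<exists>k\<le>n. w k = x}"
      proof (intro Collect_cong iffI)
        fix w assume "case_nat y w \<in> {w. \<exists>k\<le>Suc n. w k = x}"
        then obtain k where "k \<le> Suc n" "case_nat y w k = x" by auto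
        then show "\<exists>k\<le>n. w k = x" using False by (cases k) auto
      next
        fix w assume "\<exists>k\<le>n. w k = x"
        then obtain k where "k \<le> n" "w k = x" by auto
        then show "case_nat y w \<in> {w. \<exists>k\<le>Suc n. w k = x}" by (auto intro!: exI[of _ "Suc k"])
      qed
      then have "emeasure (walk_law E a y) {w. \<exists>k\<le>Suc n. w k = x}
          = (\<integral>\<^sup>+z. emeasure (walk_law E a z) {w. \<exists>k\<le>n. w k = x} \<partial>walk_step E a y)"
        by (subst emeasure_walk_law_step[OF sets]) simp
      also have "\<dots> \<le> (\<integral>\<^sup>+z. ennreal (h z) \<partial>walk_step E a y)"
        by (intro nn_integral_mono Suc.IH)
      also have "\<dots> = ennreal (avg h y)" by (rule nn_integral_walk_step[OF h0])
      also have "\<dots> \<le> ennreal (h y)" using h[of y] False by (intro ennreal_leI) simp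
      finally show ?thesis .
    qed
  qed
  then have "(SUP n. emeasure (walk_law E a y) {w. \<exists>k\<le>n. w k = x}) \<le> ennreal (h y)"
    by (rule SUP_least)
  also have "(SUP n. emeasure (walk_law E a y) {w. \<exists>k\<le>n. w k = x}) = emeasure (walk_law E a y) (\<Union>n. {w. \<exists>k\<le>n. w k = x})"
    by (rule SUP_emeasure_incseq) (use sets in \<open>auto simp: incseq_def intro: le_trans\<close>)
  also have "(\<Union>n. {w. \<exists>k\<le>n. w k = x}) = {w :: nat \<Rightarrow> 'v. \<exists>n. w n = x}"
  proof (intro equalityI subsetI)
    fix w :: "nat \<Rightarrow> 'v" assume "w \<in> {w. \<exists>n. w n = x}"
    then obtain n where "w n = x" by auto
    then show "w \<in> (\<Union>n. {w. \<exists>k\<le>n. w k = x})" by (intro UN_I[of n]) auto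
  qed auto
  finally show ?thesis .
qed

definition avoidance :: "'v \<Rightarrow> 'v \<Rightarrow> real" where
  "avoidance x y = measure (walk_law E a y) {w. \<forall>n. w n \<noteq> x}"

lemma avoidance_nonneg: "0 \<le> avoidance x y"
  by (simp add: avoidance_def)

lemma avoidance_next:
  "measure (walk_law E a y) {w. \<forall>n. w (Suc n) \<noteq> x} = avg (avoidance x) y"
proof -
  have sets: "{w. \<forall>n. w (Suc n) \<noteq> x} \<in> sets seq_space"
    by (rule sets_seq_spaceI) measurable
  have fin: "emeasure (walk_law E a y) B = ennreal (measure (walk_law E a y) B)" for y B
    by (rule finite_measure.emeasure_eq_measure[OF prob_space.finite_measure[OF prob_space_walk_law]])
  have "ennreal (measure (walk_law E a y) {w. \<forall>n. w (Suc n) \<noteq> x}) = ennreal (avg (avoidance x) y)"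
    unfolding fin[symmetric]
    by (subst emeasure_walk_law_step[OF sets])
       (simp add: fin avoidance_def[symmetric] nn_integral_walk_step[OF avoidance_nonneg])
  moreover have "0 \<le> avg (avoidance x) y"
    using avg_mono[of "\<lambda>_. 0" "avoidance x" y] by (simp add: avg_const avoidance_def)
  ultimately show ?thesis by simp
qed

lemma avoidance_self: "avoidance x x = 0"
proof -
  have "measure (walk_law E a x) {w. \<forall>n. w n \<noteq> x} = measure (walk_law E a x) {}"
  proof (rule measure_eq_AE)
    show "AE w in walk_law E a x. (w \<in> {w. \<forall>n. w n \<noteq> x}) = (w \<in> {})"
      using AE_walk_start[where E = E and a = a and y = x] by eventually_elim auto
    have "{w. \<forall>n. w n \<noteq> x} \<in> sets seq_space" by (rule sets_seq_spaceI) measurable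
    then show "{w. \<forall>n. w n \<noteq> x} \<in> sets (walk_law E a x)" by simp
  qed simp
  then show ?thesis by (simp add: avoidance_def)
qed

lemma avoidance_harmonic:
  assumes "y \<noteq> x"
  shows "avoidance x y = avg (avoidance x) y"
proof -
  have "measure (walk_law E a y) {w. \<forall>n. w n \<noteq> x} = measure (walk_law E a y) {w. \<forall>n. w (Suc n) \<noteq> x}"
  proof (rule measure_eq_AE)
    show "AE w in walk_law E a y. (w \<in> {w. \<forall>n. w n \<noteq> x}) = (w \<in> {w. \<forall>n. w (Suc n) \<noteq> x})"
      using AE_walk_start[where E = E and a = a and y = y]
    proof eventually_elim
      case (elim w)
      show ?case
      proof
        assume *: "w \<in> {w. \<forall>n. w (Suc n) \<noteq> x}"
        have "w n \<noteq> x" for n using * elim assms by (cases n) auto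
        then show "w \<in> {w. \<forall>n. w n \<noteq> x}" by simp
      qed simp
    qed
    have "{w. \<forall>n. w n \<noteq> x} \<in> sets seq_space" by (rule sets_seq_spaceI) measurable
    then show "{w. \<forall>n. w n \<noteq> x} \<in> sets (walk_law E a y)" by simp
    have "{w. \<forall>n. w (Suc n) \<noteq> x} \<in> sets seq_space" by (rule sets_seq_spaceI) measurable
    then show "{w. \<forall>n. w (Suc n) \<noteq> x} \<in> sets (walk_law E a y)" by simp
  qed
  then show ?thesis by (simp add: avoidance_def[symmetric] avoidance_next)
qed

lemma equilibrium_measure_point:
  "equilibrium_measure E a {x} x = avg (avoidance x) x * mu x"
  unfolding equilibrium_measure_def return_time_singleton using avoidance_next[of x x] by simp

end

section \<open>Products with the line\<close>

lemma int_edge_iff [simp]: "{i, j} \<in> int_edges \<longleftrightarrow> \<bar>i - j\<bar> = 1"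
  unfolding int_edges_def by (auto simp: doubleton_eq_iff)

lemma product_edge_iff:
  "{(x, i), (y, j)} \<in> product_edges E int_edges \<longleftrightarrow> {x, y} \<in> E \<and> i = j \<or> x = y \<and> \<bar>i - j\<bar> = 1"
  unfolding product_edges_def by (auto simp: doubleton_eq_iff insert_commute)

lemma product_weight_simp:
  "product_weight a int_weight (x, i) (y, j) = a x y * of_bool (i = j) + of_bool (x = y \<and> \<bar>i - j\<bar> = 1)"
  by (auto simp: product_weight_def int_weight_def)

lemma (in weighted_graph) weighted_graph_product:
  "weighted_graph (product_edges E int_edges) (product_weight a int_weight)"
proof
  let ?E = "product_edges E int_edges"
  show "\<exists>p q. p \<noteq> q \<and> e = {p, q}" if e: "e \<in> ?E" for e
  proof -
    obtain x i y j where eq: "e = {(x, i), (y, j)}" and *: "{x, y} \<in> E \<and> i = j \<or> x = y \<and> {i, j} \<in> int_edges"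
      using e unfolding product_edges_def by blast
    from * have "(x, i) \<noteq> (y, j)" using irreflexive[of x] by auto
    with eq show ?thesis by blast
  qed
  show "(p, q) \<in> {(p, q). {p, q} \<in> ?E}\<^sup>*" for p q
  proof -
    let ?R = "{(p, q). {p, q} \<in> ?E}"
    obtain x i y j where pq: "p = (x, i)" "q = (y, j)" by (metis surj_pair)
    have horizontal: "((x, i), (y, i)) \<in> ?R\<^sup>*"
      using connected_edges[of x y]
    proof (induction rule: rtrancl_induct)
      case (step y z)
      then have "((y, i), (z, i)) \<in> ?R" by (simp add: product_edge_iff)
      then show ?case using step.IH by (rule rtrancl_into_rtrancl[rotated])
    qed simp
    have up: "((y, i), (y, i + int n)) \<in> ?R\<^sup>*" for i n
    proof (induction n)
      case (Suc n)
      have "((y, i + int n), (y, i + int (Suc n))) \<in> ?R" by (simp add: product_edge_iff)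
      then show ?case using Suc.IH by (rule rtrancl_into_rtrancl[rotated])
    qed simp
    have down: "((y, i + int n), (y, i)) \<in> ?R\<^sup>*" for i n
    proof (induction n)
      case (Suc n)
      have "((y, i + int (Suc n)), (y, i + int n)) \<in> ?R" by (simp add: product_edge_iff)
      then show ?case using Suc.IH by (rule converse_rtrancl_into_rtrancl)
    qed simp
    have "((y, i), (y, j)) \<in> ?R\<^sup>*"
      using up[of i "nat (j - i)"] down[of j "nat (i - j)"] by (cases "i \<le> j") auto
    with horizontal show ?thesis unfolding pq by (rule rtrancl_trans)
  qed
  show "0 \<le> product_weight a int_weight p q" for p q
    by (cases p; cases q) (simp add: product_weight_simp weight_nonneg)
  show "product_weight a int_weight p q = product_weight a int_weight q p" for p q
    by (cases p; cases q) (auto simp: product_weight_simp weight_sym abs_minus_commute)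
  show "(0 < product_weight a int_weight p q) = ({p, q} \<in> ?E)" for p q
    by (cases p; cases q) (auto simp: product_weight_simp product_edge_iff weight_pos_iff weight_zero irreflexive of_bool_def)
qed

lemma product_neighbours:
  "{q. {(x, i), q} \<in> product_edges E int_edges} = (\<lambda>y. (y, i)) ` {y. {x, y} \<in> E} \<union> {(x, i + 1), (x, i - 1)}"
proof (intro set_eqI)
  fix q :: "'a \<times> int"
  obtain y j where q: "q = (y, j)" by (cases q)
  show "q \<in> {q. {(x, i), q} \<in> product_edges E int_edges} \<longleftrightarrow>
     q \<in> (\<lambda>y. (y, i)) ` {y. {x, y} \<in> E} \<union> {(x, i + 1), (x, i - 1)}"
    unfolding q by (auto simp: product_edge_iff image_iff)
qed

lemma (in weighted_graph) product_neighbour_sum: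
  assumes fin: "finite {y. {x, y} \<in> E}"
  shows "(\<Sum>q\<in>{q. {(x, i), q} \<in> product_edges E int_edges}. product_weight a int_weight (x, i) q * g q)
    = (\<Sum>y\<in>{y. {x, y} \<in> E}. a x y * g (y, i)) + g (x, i + 1) + g (x, i - 1)"
proof -
  have "(\<Sum>q\<in>{q. {(x, i), q} \<in> product_edges E int_edges}. product_weight a int_weight (x, i) q * g q)
    = (\<Sum>q\<in>(\<lambda>y. (y, i)) ` {y. {x, y} \<in> E}. product_weight a int_weight (x, i) q * g q)
      + (\<Sum>q\<in>{(x, i + 1), (x, i - 1)}. product_weight a int_weight (x, i) q * g q)"
    unfolding product_neighbours by (rule sum.union_disjoint) (use fin in auto)
  also have "(\<Sum>q\<in>(\<lambda>y. (y, i)) ` {y. {x, y} \<in> E}. product_weight a int_weight (x, i) q * g q)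
     = (\<Sum>y\<in>{y. {x, y} \<in> E}. a x y * g (y, i))"
    by (subst sum.reindex) (auto simp: inj_on_def product_weight_simp)
  also have "(\<Sum>q\<in>{(x, i + 1), (x, i - 1)}. product_weight a int_weight (x, i) q * g q) = g (x, i + 1) + g (x, i - 1)"
    by (simp add: product_weight_simp)
  finally show ?thesis by simp
qed

lemma (in weighted_graph) vertex_weight_bounds:
  assumes fin: "\<And>x. finite {y. {x, y} \<in> E}" and card: "\<And>x. card {y. {x, y} \<in> E} \<le> D"
    and bw: "bounded_weights E a"
  obtains m M where "0 < m" "\<And>x. {y. {x, y} \<in> E} \<noteq> {} \<Longrightarrow> m \<le> vertex_weight E a x"
    "\<And>x. 0 \<le> vertex_weight E a x" "\<And>x. vertex_weight E a x \<le> M"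
proof -
  obtain m M where mM: "0 < m" "m \<le> M" "\<And>x y. {x, y} \<in> E \<Longrightarrow> m \<le> a x y \<and> a x y \<le> M"
    using bw unfolding bounded_weights_def by blast
  have vw: "vertex_weight E a x = (\<Sum>y\<in>{y. {x, y} \<in> E}. a x y)" for x
    by (simp add: vertex_weight_def fin)
  show ?thesis
  proof (rule that[of m "real D * M"])
    show "m \<le> vertex_weight E a x" if ne: "{y. {x, y} \<in> E} \<noteq> {}" for x
    proof -
      obtain y where y: "{x, y} \<in> E" using ne by auto
      have "m \<le> a x y" using mM(3)[OF y] by simp
      also have "\<dots> \<le> vertex_weight E a x"
        unfolding vw by (rule member_le_sum) (use y fin weight_nonneg in auto)
      finally show ?thesis .
    qed
    show "0 \<le> vertex_weight E a x" for x unfolding vw by (intro sum_nonneg weight_nonneg)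
    show "vertex_weight E a x \<le> real D * M" for x
    proof -
      have "vertex_weight E a x \<le> real (card {y. {x, y} \<in> E}) * M"
        unfolding vw using sum_bounded_above[of "{y. {x, y} \<in> E}" "a x" M] mM(3) by simp
      also have "\<dots> \<le> real D * M" using card[of x] mM by (intro mult_right_mono) auto
      finally show ?thesis .
    qed
  qed (use mM in auto)
qed

lemma (in weighted_graph) vertex_weight_product:
  assumes fin: "\<And>x. finite {y. {x, y} \<in> E}"
  shows "vertex_weight (product_edges E int_edges) (product_weight a int_weight) (x, i) = vertex_weight E a x + 2"
proof -
  have "finite {q. {(x, i), q} \<in> product_edges E int_edges}" unfolding product_neighbours using fin by auto
  then show ?thesis
    using product_neighbour_sum[OF fin, of x i "\<lambda>_. 1"] fin by (simp add: vertex_weight_def)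
qed

lemma (in weighted_graph) bounded_graph_product:
  assumes "bounded_degree E" "bounded_weights E a"
  obtains hi where "bounded_graph (product_edges E int_edges) (product_weight a int_weight) 2 hi"
proof -
  obtain D where D: "\<And>x. finite {y. {x, y} \<in> E}" "\<And>x. card {y. {x, y} \<in> E} \<le> D"
    using degree_bound[OF assms(1)] by blast
  obtain M where M: "\<And>x. 0 \<le> vertex_weight E a x" "\<And>x. vertex_weight E a x \<le> M"
    by (rule vertex_weight_bounds[OF D assms(2)]) metis
  have "bounded_graph (product_edges E int_edges) (product_weight a int_weight) 2 (M + 2)"
  proof (intro bounded_graph.intro bounded_graph_axioms.intro weighted_graph_product)
    fix p :: "'v \<times> int"
    obtain x i where p: "p = (x, i)" by (cases p)
    show "finite {q. {p, q} \<in> product_edges E int_edges}"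
      unfolding p product_neighbours using D(1) by simp
    show "2 \<le> vertex_weight (product_edges E int_edges) (product_weight a int_weight) p"
      "vertex_weight (product_edges E int_edges) (product_weight a int_weight) p \<le> M + 2"
      unfolding p vertex_weight_product[OF D(1)] using M by auto
  qed simp
  then show ?thesis by (rule that)
qed

text \<open>
  Each nonempty column of \<open>A\<close> has a top element.
\<close>

lemma card_fst_le_vertical_boundary:
  fixes A :: "('v \<times> int) set"
  assumes A: "finite A"
  shows "card (fst ` A) \<le> card {p \<in> A. (fst p, snd p + 1) \<notin> A}"
proof -
  have "fst ` A \<subseteq> fst ` {p \<in> A. (fst p, snd p + 1) \<notin> A}"
  proof
    fix x assume "x \<in> fst ` A"
    define I where "I = {i. (x, i) \<in> A}"
    have I: "finite I" "I \<noteq> {}"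
      using finite_subset[of I "snd ` A"] A \<open>x \<in> fst ` A\<close> by (force simp: I_def)+
    have "Max I \<in> I" using I by simp
    moreover have "Max I + 1 \<notin> I" using Max_ge[OF I(1), of "Max I + 1"] by auto
    ultimately show "x \<in> fst ` {p \<in> A. (fst p, snd p + 1) \<notin> A}"
      by (intro image_eqI[of _ _ "(x, Max I)"]) (auto simp: I_def)
  qed
  then have "card (fst ` A) \<le> card (fst ` {p \<in> A. (fst p, snd p + 1) \<notin> A})"
    using A by (intro card_mono) auto
  also have "\<dots> \<le> card {p \<in> A. (fst p, snd p + 1) \<notin> A}"
    using A by (intro card_image_le) auto
  finally show ?thesis .
qed

text \<open>
  \<open>N\<close> is the size of a set and \<open>M\<close> the size of its projection. Either the projection is large, or
  all horizontal slices are small and have a relatively large boundary.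
\<close>

lemma slices_and_projection:
  fixes c d M N :: real
  assumes d: "1 \<le> d" and c: "0 < c" and M: "0 < M" and N: "0 < N"
  shows "min 1 c * N powr (1 - 1 / (d + 1)) \<le> c * N * M powr (- 1 / d) + M"
proof (cases "N powr (1 - 1 / (d + 1)) \<le> M")
  case True
  have "min 1 c * N powr (1 - 1 / (d + 1)) \<le> 1 * M"
    using True M by (intro mult_mono) auto
  also have "\<dots> \<le> c * N * M powr (- 1 / d) + M" using c N M by simp
  finally show ?thesis .
next
  case False
  have "1 - 1 / (d + 1) = d / (d + 1)" using d by (simp add: field_simps)
  have "N powr (- 1 / (d + 1)) = (N powr (1 - 1 / (d + 1))) powr (- 1 / d)"
    using d by (simp add: powr_powr field_simps)
  also have "\<dots> \<le> M powr (- 1 / d)"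
    using False M d by (intro powr_mono2') auto
  finally have "c * N * N powr (- 1 / (d + 1)) \<le> c * N * M powr (- 1 / d)"
    using c N by (intro mult_left_mono) auto
  moreover have "N * N powr (- 1 / (d + 1)) = N powr (1 - 1 / (d + 1))"
    using N powr_add[of N 1 "- 1 / (d + 1)"] by simp
  moreover have "min 1 c * N powr (1 - 1 / (d + 1)) \<le> c * N powr (1 - 1 / (d + 1))"
    by (intro mult_right_mono) auto
  ultimately show ?thesis using M by (simp add: mult.assoc)
qed

text \<open>
  Vertical edges contribute at least the size of the projection of \<open>A\<close> to the graph, and horizontal edges
  the boundaries of the slices, each of size at most that of the projection. An edge is
  needed to have a positive lower bound on the vertex weights of the graph.
\<close>

lemma (in weighted_graph) isoperimetric_graph_product:
  assumes deg: "bounded_degree E" and bw: "bounded_weights E a"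
    and iso: "isoperimetric_ineq d E a" and d: "1 \<le> d" and E: "E \<noteq> {}"
  obtains hi \<kappa> where "isoperimetric_graph (product_edges E int_edges) (product_weight a int_weight) 2 hi (d + 1) \<kappa>"
    "\<And>x. finite {y. {x, y} \<in> E}" "infinite (UNIV :: 'v set)"
proof -
  obtain D where D: "\<And>x. finite {y. {x, y} \<in> E}" "\<And>x. card {y. {x, y} \<in> E} \<le> D"
    using degree_bound[OF deg] by blast
  have ne: "{y. {x, y} \<in> E} \<noteq> {}" for x
  proof -
    obtain e where e: "e \<in> E" using E by auto
    obtain u v :: 'v where "u \<noteq> v" using edgeE[OF e] by auto
    then obtain z where z: "z \<noteq> x" by metis
    from connected_edges[of x z] z show ?thesis by (cases rule: converse_rtranclE) auto
  qed
  obtain m M where M: "0 < m" "\<And>x. m \<le> vertex_weight E a x" "\<And>x. vertex_weight E a x \<le> M"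
    by (rule vertex_weight_bounds[OF D bw]) (metis ne)
  obtain \<kappa> where \<kappa>: "0 < \<kappa>" and iso: "\<And>A. finite A \<Longrightarrow>
        (\<Sum>x\<in>A. vertex_weight E a x) powr (1 - 1 / d) \<le> \<kappa> * (\<Sum>x\<in>A. \<Sum>y\<in>{y. {x, y} \<in> E} - A. a x y)"
    using iso boundary_weight_eq_sum[OF D(1)] unfolding isoperimetric_ineq_def by auto
  obtain hi where bg: "bounded_graph (product_edges E int_edges) (product_weight a int_weight) 2 hi"
    using bounded_graph_product[OF deg bw] by blast
  interpret bg: bounded_graph "product_edges E int_edges" "product_weight a int_weight" 2 hi by (rule bg)
  have inf: "infinite (UNIV :: 'v set)"
  proof
    assume fin: "finite (UNIV :: 'v set)"
    have "0 < (\<Sum>x\<in>UNIV. vertex_weight E a x)"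
      using fin M(1,2) by (intro sum_pos) (auto intro: less_le_trans)
    then have "0 < (\<Sum>x\<in>UNIV. vertex_weight E a x) powr (1 - 1 / d)" by simp
    also have "\<dots> \<le> 0" using iso[OF fin] by simp
    finally show False by simp
  qed
  define c where "c = m powr (1 - 1 / d) / \<kappa>"
  have c: "0 < c" using M(1) \<kappa> by (simp add: c_def)
  define b where "b A = (\<Sum>p\<in>A. \<Sum>q\<in>bg.nb p - A. product_weight a int_weight p q)" for A
  have slice: "c * real (card S) powr (1 - 1 / d) \<le> (\<Sum>x\<in>S. \<Sum>y\<in>{y. {x, y} \<in> E} - S. a x y)"
    if S: "finite S" for S
  proof -
    have "m powr (1 - 1 / d) * real (card S) powr (1 - 1 / d) = (\<Sum>x\<in>S. m) powr (1 - 1 / d)"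
      using M(1) by (simp add: powr_mult mult.commute)
    also have "\<dots> \<le> (\<Sum>x\<in>S. vertex_weight E a x) powr (1 - 1 / d)"
      using M(1,2) d by (intro powr_mono2 sum_mono sum_nonneg) auto
    also have "\<dots> \<le> \<kappa> * (\<Sum>x\<in>S. \<Sum>y\<in>{y. {x, y} \<in> E} - S. a x y)" by (rule iso[OF S])
    finally show ?thesis using \<kappa> by (simp add: c_def field_simps)
  qed
  have lower: "min 1 c * real (card A) powr (1 - 1 / (d + 1)) \<le> b A" if A: "finite A" for A
  proof (cases "A = {}")
    case True
    then show ?thesis by (simp add: b_def)
  next
    case False
    define S where "S i = {x. (x, i) \<in> A}" for i
    have S: "finite (S i)" for i
      using finite_subset[of "S i" "fst ` A"] A by (force simp: S_def)
    have A_Sigma: "A = (\<lambda>(i, x). (x, i)) ` Sigma (snd ` A) S"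
      by (force simp: S_def image_iff)
    have sum_A: "(\<Sum>p\<in>A. g (fst p) (snd p)) = (\<Sum>i\<in>snd ` A. \<Sum>x\<in>S i. g x i)" for g :: "'v \<Rightarrow> int \<Rightarrow> real"
    proof -
      have "(\<Sum>i\<in>snd ` A. \<Sum>x\<in>S i. g x i) = (\<Sum>(i, x)\<in>Sigma (snd ` A) S. g x i)"
        by (rule sum.Sigma) (use A S in auto)
      also have "\<dots> = (\<Sum>p\<in>A. g (fst p) (snd p))"
        by (rule sum.reindex_bij_witness[of _ "\<lambda>p. (snd p, fst p)" "\<lambda>(i, x). (x, i)"]) (auto simp: S_def)
      finally show ?thesis by simp
    qed
    have inner: "(\<Sum>q\<in>bg.nb p - A. product_weight a int_weight p q)
      \<ge> (\<Sum>y\<in>{y. {fst p, y} \<in> E} - S (snd p). a (fst p) y) + of_bool ((fst p, snd p + 1) \<notin> A)" for p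
    proof -
      obtain x i where p: "p = (x, i)" by (cases p)
      have "(\<Sum>q\<in>bg.nb p - A. product_weight a int_weight p q)
         = (\<Sum>q\<in>bg.nb p. product_weight a int_weight p q * of_bool (q \<notin> A))"
        by (rule sum.mono_neutral_cong_left) (use bg.finite_nb in auto)
      also have "\<dots> = (\<Sum>y\<in>{y. {x, y} \<in> E}. a x y * of_bool ((y, i) \<notin> A)) + of_bool ((x, i + 1) \<notin> A) + of_bool ((x, i - 1) \<notin> A)"
        unfolding p by (rule product_neighbour_sum[OF D(1)])
      also have "(\<Sum>y\<in>{y. {x, y} \<in> E}. a x y * of_bool ((y, i) \<notin> A)) = (\<Sum>y\<in>{y. {x, y} \<in> E} - S i. a x y)"
        by (rule sum.mono_neutral_cong_right) (use D(1) in \<open>auto simp: S_def\<close>)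
      finally show ?thesis by (simp add: p)
    qed
    have "(\<Sum>p\<in>A. (\<Sum>y\<in>{y. {fst p, y} \<in> E} - S (snd p). a (fst p) y) + of_bool ((fst p, snd p + 1) \<notin> A)) \<le> b A"
      unfolding b_def by (intro sum_mono inner)
    then have b1: "(\<Sum>i\<in>snd ` A. \<Sum>x\<in>S i. \<Sum>y\<in>{y. {x, y} \<in> E} - S i. a x y) +
       (\<Sum>p\<in>A. of_bool ((fst p, snd p + 1) \<notin> A)) \<le> b A"
      using sum_A[of "\<lambda>x i. \<Sum>y\<in>{y. {x, y} \<in> E} - S i. a x y"] by (simp only: sum.distrib)
    have vert: "real (card (fst ` A)) \<le> (\<Sum>p\<in>A. of_bool ((fst p, snd p + 1) \<notin> A))"
      using card_fst_le_vertical_boundary[OF A] A by (simp add: Int_def)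
    have pos: "0 < real (card (fst ` A))" "0 < real (card A)"
      using False A by (auto simp: card_gt_0_iff)
    have "c * real (card A) * real (card (fst ` A)) powr (- 1 / d)
       = (\<Sum>i\<in>snd ` A. c * (real (card (S i)) * real (card (fst ` A)) powr (- 1 / d)))"
      using sum_A[of "\<lambda>_ _. 1"] by (simp add: sum_distrib_left sum_distrib_right mult.assoc)
    also have "\<dots> \<le> (\<Sum>i\<in>snd ` A. \<Sum>x\<in>S i. \<Sum>y\<in>{y. {x, y} \<in> E} - S i. a x y)"
    proof (rule sum_mono)
      fix i assume "i \<in> snd ` A"
      then have ne: "S i \<noteq> {}" by (force simp: S_def)
      then have posi: "0 < real (card (S i))" using S[of i] by (auto simp: card_gt_0_iff)
      have "card (S i) \<le> card (fst ` A)"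
        by (rule card_mono) (use A in \<open>force simp: S_def\<close>)+
      then have "real (card (fst ` A)) powr (- 1 / d) \<le> real (card (S i)) powr (- 1 / d)"
        using posi d by (intro powr_mono2') auto
      then have "real (card (S i)) * real (card (fst ` A)) powr (- 1 / d) \<le> real (card (S i)) * real (card (S i)) powr (- 1 / d)"
        by (intro mult_left_mono) auto
      also have "\<dots> = real (card (S i)) powr (1 - 1 / d)"
        using posi powr_add[of "real (card (S i))" 1 "- 1 / d"] by simp
      finally have "c * (real (card (S i)) * real (card (fst ` A)) powr (- 1 / d)) \<le> c * real (card (S i)) powr (1 - 1 / d)"
        using c by (intro mult_left_mono) auto
      also have "\<dots> \<le> (\<Sum>x\<in>S i. \<Sum>y\<in>{y. {x, y} \<in> E} - S i. a x y)" by (rule slice[OF S])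
      finally show "c * (real (card (S i)) * real (card (fst ` A)) powr (- 1 / d)) \<le> \<dots>" .
    qed
    finally show ?thesis
      using slices_and_projection[OF d c pos] b1 vert by linarith
  qed
  have hi: "0 < hi" using bg.weight_ge[of undefined] bg.weight_le[of undefined] by linarith
  define \<kappa>' where "\<kappa>' = hi powr (1 - 1 / (d + 1)) / min 1 c"
  have "isoperimetric_graph (product_edges E int_edges) (product_weight a int_weight) 2 hi (d + 1) \<kappa>'"
  proof (intro isoperimetric_graph.intro bg isoperimetric_graph_axioms.intro)
    show "0 < \<kappa>'" using hi c by (simp add: \<kappa>'_def)
    show "(\<Sum>p\<in>A. bg.mu p) powr (1 - 1 / (d + 1)) \<le> \<kappa>' * (\<Sum>p\<in>A. \<Sum>q\<in>bg.nb p - A. product_weight a int_weight p q)"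
      if A: "finite A" for A
    proof -
      have "(\<Sum>p\<in>A. bg.mu p) powr (1 - 1 / (d + 1)) \<le> (\<Sum>p\<in>A. hi) powr (1 - 1 / (d + 1))"
        using bg.weight_le bg.mu_pos d by (intro powr_mono2 sum_mono sum_nonneg) (auto simp: less_imp_le)
      also have "\<dots> = hi powr (1 - 1 / (d + 1)) * real (card A) powr (1 - 1 / (d + 1))"
        using hi by (simp add: powr_mult mult.commute)
      also have "\<dots> = \<kappa>' * (min 1 c * real (card A) powr (1 - 1 / (d + 1)))"
        using c by (simp add: \<kappa>'_def)
      also have "\<dots> \<le> \<kappa>' * b A"
        using lower[OF A] hi c by (intro mult_left_mono) (auto simp: \<kappa>'_def)
      finally show ?thesis by (simp add: b_def)
    qed
  qed (use d in simp)
  then show ?thesis using that D(1) inf by blast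
qed

section \<open>Geodesic rays\<close>

context weighted_graph begin

definition edge_rel :: "('v \<times> 'v) set" where
  "edge_rel = {(x, y). {x, y} \<in> E}"

definition graph_dist :: "'v \<Rightarrow> 'v \<Rightarrow> nat" where
  "graph_dist v w = (LEAST n. (v, w) \<in> edge_rel ^^ n)"

lemma graph_dist_path: "(v, w) \<in> edge_rel ^^ graph_dist v w"
proof -
  have "\<exists>n. (v, w) \<in> edge_rel ^^ n"
    using connected_edges[of v w] unfolding edge_rel_def by (simp add: rtrancl_is_UN_relpow)
  then show ?thesis unfolding graph_dist_def by (rule LeastI_ex)
qed

lemma graph_dist_le: "(v, w) \<in> edge_rel ^^ n \<Longrightarrow> graph_dist v w \<le> n"
  unfolding graph_dist_def by (rule Least_le)

lemma graph_dist_self [simp]: "graph_dist v v = 0"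
  using graph_dist_le[of v v 0] by simp

lemma graph_dist_relpow: "(w, z) \<in> edge_rel ^^ n \<Longrightarrow> graph_dist v z \<le> graph_dist v w + n"
  by (rule graph_dist_le) (use graph_dist_path[of v w] in \<open>auto simp: relpow_add\<close>)

lemma graph_dist_edge: "{w, z} \<in> E \<Longrightarrow> graph_dist v z \<le> graph_dist v w + 1"
  using graph_dist_relpow[of w z 1 v] by (simp add: edge_rel_def)

text \<open>
  The vertices that can be reached from \<open>v\<close> by a geodesic through \<open>w\<close>.
\<close>

definition descendants :: "'v \<Rightarrow> 'v \<Rightarrow> 'v set" where
  "descendants v w = {z. \<exists>n. (w, z) \<in> edge_rel ^^ n \<and> graph_dist v z = graph_dist v w + n}"

lemma descendants_subset:
  "descendants v w \<subseteq> {w} \<union> (\<Union>w'\<in>{w'. {w, w'} \<in> E \<and> graph_dist v w' = graph_dist v w + 1}. descendants v w')"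
proof
  fix z assume "z \<in> descendants v w"
  then obtain n where n: "(w, z) \<in> edge_rel ^^ n" "graph_dist v z = graph_dist v w + n"
    by (auto simp: descendants_def)
  show "z \<in> {w} \<union> (\<Union>w'\<in>{w'. {w, w'} \<in> E \<and> graph_dist v w' = graph_dist v w + 1}. descendants v w')"
  proof (cases n)
    case 0
    then show ?thesis using n by simp
  next
    case (Suc k)
    then obtain w' where w': "(w, w') \<in> edge_rel" "(w', z) \<in> edge_rel ^^ k"
      using n(1) relpow_Suc_D2 by metis
    then have e: "{w, w'} \<in> E" by (simp add: edge_rel_def)
    have "graph_dist v w' = graph_dist v w + 1" "graph_dist v z = graph_dist v w' + k"
      using graph_dist_edge[OF e, of v] graph_dist_relpow[OF w'(2), of v] n(2) Suc by linarith+
    then show ?thesis using e w'(2) by (auto simp: descendants_def)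
  qed
qed

text \<open>
  Koenig's lemma: a vertex with infinitely many descendants has a neighbour, one step further from \<open>v\<close>, with
  infinitely many descendants.
\<close>

lemma geodesic_ray:
  assumes fin: "\<And>x. finite {y. {x, y} \<in> E}" and inf: "infinite (UNIV :: 'v set)"
  obtains \<gamma> where "\<gamma> 0 = v" "\<And>i. {\<gamma> i, \<gamma> (Suc i)} \<in> E" "\<And>i. graph_dist v (\<gamma> i) = i"
proof -
  define Q where "Q n w \<longleftrightarrow> infinite (descendants v w) \<and> graph_dist v w = n \<and> (n = 0 \<longrightarrow> w = v)" for n w
  have "\<exists>\<gamma>. \<forall>n. Q n (\<gamma> n) \<and> {\<gamma> n, \<gamma> (Suc n)} \<in> E"
  proof (rule dependent_nat_choice)
    have "descendants v v = UNIV"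
      using graph_dist_path by (fastforce simp: descendants_def)
    then show "\<exists>w. Q 0 w" using inf by (intro exI[of _ v]) (simp add: Q_def)
    fix w n assume w: "Q n w"
    let ?N = "{w'. {w, w'} \<in> E \<and> graph_dist v w' = graph_dist v w + 1}"
    have "finite ?N" by (rule finite_subset[OF _ fin[of w]]) auto
    moreover have "infinite ({w} \<union> (\<Union>w'\<in>?N. descendants v w'))"
      using w infinite_super[OF descendants_subset] unfolding Q_def by blast
    ultimately obtain w' where "w' \<in> ?N" "infinite (descendants v w')" by auto
    then show "\<exists>w'. Q (Suc n) w' \<and> {w, w'} \<in> E" using w by (auto simp: Q_def)
  qed
  then show thesis using that by (auto simp: Q_def)
qed

end

section \<open>Recurrence of the line\<close>

lemma bounded_arithmetic_progression:
  fixes g :: "nat \<Rightarrow> real"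
  assumes "g 0 = 0" "\<And>n. g (Suc n) = (g (Suc (Suc n)) + g n) / 2" "\<And>n. \<bar>g n\<bar> \<le> 1"
  shows "g 1 = 0"
proof -
  have "g n = real n * g 1 \<and> g (Suc n) = real (Suc n) * g 1" for n
  proof (induction n)
    case (Suc n)
    then show ?case using assms(2)[of n] by (simp add: algebra_simps)
  qed (use assms(1) in simp)
  then have "real n * \<bar>g 1\<bar> \<le> 1" for n
    using assms(3)[of n] by (metis abs_mult abs_of_nat)
  moreover obtain n where "1 < real n * \<bar>g 1\<bar>" if "g 1 \<noteq> 0"
    using reals_Archimedean3[of "\<bar>g 1\<bar>"] by (metis abs_of_nat zero_less_abs_iff)
  ultimately show ?thesis by (meson not_le)
qed

text \<open>
  The probability never to hit the point \<open>p\<close> is harmonic off \<open>p\<close>, hence affine on each half-line; being bounded and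
  zero at \<open>p\<close>, it vanishes.
\<close>

lemma (in weighted_graph) line_recurrent:
  assumes E: "E = {}" and bg: "bounded_graph (product_edges E int_edges) (product_weight a int_weight) 2 hi"
  shows "equilibrium_measure (product_edges E int_edges) (product_weight a int_weight) {p} p = 0"
proof -
  interpret bg: bounded_graph "product_edges E int_edges" "product_weight a int_weight" 2 hi by (rule bg)
  obtain x i where p: "p = (x, i)" by (cases p)
  have avg: "bg.avg f (y, j) = (f (y, j + 1) + f (y, j - 1)) / 2" for f y j
  proof -
    have "vertex_weight E a y = 0" by (simp add: E vertex_weight_def)
    then show ?thesis
      unfolding bg.avg_def using product_neighbour_sum[of y j f] vertex_weight_product[of y j] by (simp add: E)
  qed
  let ?g = "\<lambda>s n. bg.avoidance p (x, i + s * int n)"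
  have zero: "?g s 1 = 0" if s: "s = 1 \<or> s = - 1" for s
  proof (rule bounded_arithmetic_progression)
    show "?g s 0 = 0" using bg.avoidance_self[of p] by (simp add: p)
    show "?g s (Suc n) = (?g s (Suc (Suc n)) + ?g s n) / 2" for n
    proof -
      have "?g s (Suc n) = bg.avg (bg.avoidance p) (x, i + s * int (Suc n))"
        by (rule bg.avoidance_harmonic) (use s in \<open>auto simp: p\<close>)
      then show ?thesis using s by (auto simp: avg algebra_simps)
    qed
    show "\<bar>?g s n\<bar> \<le> 1" for n
      using prob_space.prob_le_1[OF prob_space_walk_law] bg.avoidance_nonneg by (simp add: bg.avoidance_def)
  qed
  have "bg.avg (bg.avoidance p) p = 0"
    using zero[of 1] zero[of "- 1"] avg[of "bg.avoidance p" x i] by (simp add: p)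
  then show ?thesis by (simp add: bg.equilibrium_measure_point)
qed

section \<open>Trajectories through two vertices\<close>

definition trajectories_through :: "'v set set \<Rightarrow> 'v \<Rightarrow> (int \<Rightarrow> 'v) set set" where
  "trajectories_through E x = {c \<in> trajectories_mod_shift E. x \<in> class_range c}"

lemma class_range_shift_class [simp]: "class_range (shift_class w) = range w"
proof -
  have "w (n + k) \<in> range w" for n k by simp
  moreover have "w \<in> shift_class w" by (auto simp: shift_class_def intro: exI[of _ 0])
  ultimately show ?thesis by (fastforce simp: class_range_def shift_class_def)
qed

lemma shift_class_hitting: "shift_class ` trajectories_hitting E {x} = trajectories_through E x"
  unfolding trajectories_hitting_def trajectories_through_def trajectories_mod_shift_def
  by auto blast

lemma space_trajectory_space [simp]: "space (trajectory_space E) = trajectories E"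
  by (simp add: trajectory_space_def space_restrict_space space_PiM)

lemma sets_trajectory_spaceI:
  assumes "Measurable.pred (\<Pi>\<^sub>M n\<in>UNIV. count_space UNIV) Q"
  shows "{w \<in> trajectories E. Q w} \<in> sets (trajectory_space E)"
proof -
  have "{w. Q w} \<in> sets (\<Pi>\<^sub>M n\<in>UNIV. count_space UNIV)"
    using assms by (simp add: pred_def space_PiM)
  moreover have "{w \<in> trajectories E. Q w} = trajectories E \<inter> {w. Q w}" by auto
  ultimately show ?thesis unfolding trajectory_space_def sets_restrict_space by blast
qed

lemma sets_half_trajectory_spaceI:
  assumes "Measurable.pred seq_space Q"
  shows "{w \<in> half_trajectories E. Q w} \<in> sets (half_trajectory_space E)"
proof -
  have "{w. Q w} \<in> sets seq_space"
    using assms by (simp add: pred_def space_PiM)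
  moreover have "{w \<in> half_trajectories E. Q w} = half_trajectories E \<inter> {w. Q w}" by auto
  ultimately show ?thesis unfolding half_trajectory_space_def sets_restrict_space by blast
qed

lemma space_trajectory_mod_shift_space [simp]:
  "space (trajectory_mod_shift_space E) = trajectories_mod_shift E"
  unfolding trajectory_mod_shift_space_def by (rule space_measure_of) auto

lemma sets_trajectories_through:
  "trajectories_through E (x :: 'v :: countable) \<in> sets (trajectory_mod_shift_space E)"
proof -
  have "{w \<in> trajectories E. shift_class w \<in> trajectories_through E x} = {w \<in> trajectories E. \<exists>n. w n = x}"
    by (auto simp: trajectories_through_def trajectories_mod_shift_def)
  also have "\<dots> \<in> sets (trajectory_space E)"
    by (rule sets_trajectory_spaceI) measurable
  finally have "trajectories_through E x \<in> {A. A \<subseteq> trajectories_mod_shift E \<and>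
           {w \<in> trajectories E. shift_class w \<in> A} \<in> sets (trajectory_space E)}"
    by (auto simp: trajectories_through_def)
  then show ?thesis unfolding trajectory_mod_shift_space_def
    by (subst sets_measure_of) (auto intro: sigma_sets.Basic)
qed

lemma measurable_shift_class:
  "shift_class \<in> measurable (trajectory_space E) (trajectory_mod_shift_space E)"
  unfolding trajectory_mod_shift_space_def
proof (rule measurable_measure_of)
  fix A assume A: "A \<in> {A. A \<subseteq> trajectories_mod_shift E \<and>
           {w \<in> trajectories E. shift_class w \<in> A} \<in> sets (trajectory_space E)}"
  have "shift_class -` A \<inter> space (trajectory_space E) = {w \<in> trajectories E. shift_class w \<in> A}" by auto
  then show "shift_class -` A \<inter> space (trajectory_space E) \<in> sets (trajectory_space E)" using A by simp
qed (auto simp: trajectories_mod_shift_def)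

lemma trajectory_halves:
  assumes w: "w \<in> trajectories E"
  shows "(\<lambda>n. w (- int n)) \<in> half_trajectories E" "(\<lambda>n. w (int n)) \<in> half_trajectories E"
proof -
  have e: "{w k, w (k + 1)} \<in> E" for k using w by (auto simp: trajectories_def)
  have f: "finite {k. w k = x}" for x using w by (auto simp: trajectories_def)
  have "{w (int n), w (int (Suc n))} \<in> E" for n using e[of "int n"] by (simp add: add.commute)
  moreover have "finite {n. w (int n) = x}" for x
    by (rule finite_imageD[of int], rule finite_subset[OF _ f[of x]]) auto
  ultimately show "(\<lambda>n. w (int n)) \<in> half_trajectories E" by (simp add: half_trajectories_def)
  have "{w (- int n), w (- int (Suc n))} \<in> E" for n using e[of "- int (Suc n)"] by (simp add: insert_commute)
  moreover have "finite {n. w (- int n) = x}" for x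
    by (rule finite_imageD[of "\<lambda>n. - int n"], rule finite_subset[OF _ f[of x]]) (auto simp: inj_on_def)
  ultimately show "(\<lambda>n. w (- int n)) \<in> half_trajectories E" by (simp add: half_trajectories_def)
qed

text \<open>
  Under \<open>Q\<close> for the set \<open>{x}\<close> a trajectory is at \<open>x\<close> at time zero, and it meets \<open>y\<close> in the future or in the past. The
  future is a walk from \<open>x\<close>; the past is such a walk conditioned not to return, and the probability of
  the condition is a factor of the total mass \<open>escape x\<close> of \<open>Q\<close>. The minimum covers two uses: the
  hitting probability is small for distant vertices, and \<open>escape x\<close> is zero in the recurrent case.
\<close>

lemma (in bounded_graph) intensity_through_two:
  assumes \<nu>: "is_interlacement_intensity E a \<nu>"
  defines "escape \<equiv> (\<lambda>x. equilibrium_measure E a {x} x)"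
  defines "hits \<equiv> (\<lambda>x y. measure (walk_law E a x) {w. \<exists>n. w n = y})"
  shows "emeasure \<nu> (trajectories_through E x \<inter> trajectories_through E y) \<le> ennreal (2 * min (escape x) (hi * hits x y))"
proof -
  let ?H = "half_trajectories E" and ?W = "trajectories_hitting E {x}" and ?M = "walk_law E a x"
  let ?ret = "\<lambda>w. return_time {x} w = \<infinity>"
  interpret M: prob_space ?M by (rule prob_space_walk_law)
  obtain Q where Q: "is_interlacement_Q E a {x} Q"
    and dens: "density \<nu> (indicator (trajectories_through E x)) = distr Q (trajectory_mod_shift_space E) shift_class"
    using \<nu> unfolding is_interlacement_intensity_def by (metis finite.emptyI finite.insertI shift_class_hitting)
  have sets_nu: "sets \<nu> = sets (trajectory_mod_shift_space E)"
    using \<nu> by (simp add: is_interlacement_intensity_def)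
  have sets_Q: "sets Q = sets (restrict_space (trajectory_space E) ?W)"
    using Q unfolding is_interlacement_Q_def by auto
  have Q_rect': "A \<in> sets (half_trajectory_space E) \<Longrightarrow> B \<in> sets (half_trajectory_space E) \<Longrightarrow>
        emeasure Q {w \<in> ?W. (\<lambda>n. w (- int n)) \<in> A \<and> w 0 = z \<and> (\<lambda>n. w (int n)) \<in> B} =
        ennreal (\<P>(w in walk_law E a z. w \<in> A \<bar> ?ret w) * equilibrium_measure E a {x} z * \<P>(w in walk_law E a z. w \<in> B))" for A B z
    using Q unfolding is_interlacement_Q_def by auto
  have WT: "?W \<subseteq> trajectories E" by (auto simp: trajectories_hitting_def)
  have space_Q: "space Q = ?W"
    using sets_eq_imp_space_eq[OF sets_Q] WT by (auto simp: space_restrict_space)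
  have in_Q: "{w \<in> ?W. R w} \<in> sets Q" if "Measurable.pred (\<Pi>\<^sub>M n\<in>UNIV. count_space UNIV) R" for R
  proof -
    have "{w \<in> ?W. R w} = ?W \<inter> {w \<in> trajectories E. R w}" using WT by auto
    then show ?thesis unfolding sets_Q sets_restrict_space using sets_trajectory_spaceI[OF that, of E] by blast
  qed
  define hit where "hit = {w \<in> ?H. \<exists>n. w n = y}"
  have hit: "hit \<in> sets (half_trajectory_space E)"
    unfolding hit_def by (rule sets_half_trajectory_spaceI) measurable
  have all: "?H \<in> sets (half_trajectory_space E)"
    using sets_half_trajectory_spaceI[of "\<lambda>_. True" E] by simp
  define U where "U A B z = {w \<in> ?W. (\<lambda>n. w (- int n)) \<in> A \<and> w 0 = z \<and> (\<lambda>n. w (int n)) \<in> B}" for A B z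
  have sets_U: "U hit ?H z \<in> sets Q" "U ?H hit z \<in> sets Q" "U ?H ?H z \<in> sets Q" for z
  proof -
    have "U hit ?H z = {w \<in> ?W. (\<exists>n. w (- int n) = y) \<and> w 0 = z}"
      "U ?H hit z = {w \<in> ?W. (\<exists>n. w (int n) = y) \<and> w 0 = z}"
      "U ?H ?H z = {w \<in> ?W. w 0 = z}"
      using trajectory_halves WT unfolding U_def hit_def by blast+
    moreover have "{w \<in> ?W. (\<exists>n. w (- int n) = y) \<and> w 0 = z} \<in> sets Q" by (rule in_Q) measurable
    moreover have "{w \<in> ?W. (\<exists>n. w (int n) = y) \<and> w 0 = z} \<in> sets Q" by (rule in_Q) measurable
    moreover have "{w \<in> ?W. w 0 = z} \<in> sets Q" by (rule in_Q) measurable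
    ultimately show "U hit ?H z \<in> sets Q" "U ?H hit z \<in> sets Q" "U ?H ?H z \<in> sets Q" by simp_all
  qed
  have null: "U ?H ?H z \<in> null_sets Q" if "z \<noteq> x" for z
    using Q_rect'[OF all all, of z] sets_U(3)[of z] that by (simp add: null_sets_def U_def equilibrium_measure_def)
  have e0: "0 \<le> escape x" unfolding escape_def equilibrium_measure_def using mu_pos[of x] by (simp add: less_imp_le)
  have through: "trajectories_through E x \<inter> trajectories_through E y \<in> sets (trajectory_mod_shift_space E)"
    using sets_trajectories_through by auto
  have "emeasure \<nu> (trajectories_through E x \<inter> trajectories_through E y)
     = emeasure (density \<nu> (indicator (trajectories_through E x))) (trajectories_through E x \<inter> trajectories_through E y)"
    using through sets_trajectories_through[of E x] sets_nu
    by (subst emeasure_density) (auto simp flip: nn_integral_indicator intro!: nn_integral_cong split: split_indicator)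
  also have "\<dots> = emeasure Q (shift_class -` (trajectories_through E x \<inter> trajectories_through E y) \<inter> space Q)"
    unfolding dens
  proof (rule emeasure_distr[OF _ through])
    show "shift_class \<in> measurable Q (trajectory_mod_shift_space E)"
      using measurable_restrict_space1[OF measurable_shift_class, of E ?W] measurable_cong_sets[OF sets_Q refl] by blast
  qed
  also have "\<dots> \<le> emeasure Q ((U hit ?H x \<union> U ?H hit x) \<union> (\<Union>z\<in>-{x}. U ?H ?H z))"
  proof (rule emeasure_mono)
    show "shift_class -` (trajectories_through E x \<inter> trajectories_through E y) \<inter> space Q
      \<subseteq> (U hit ?H x \<union> U ?H hit x) \<union> (\<Union>z\<in>-{x}. U ?H ?H z)"
    proof
      fix w assume w: "w \<in> shift_class -` (trajectories_through E x \<inter> trajectories_through E y) \<inter> space Q"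
      then have wW: "w \<in> ?W" using space_Q by auto
      then have halves: "(\<lambda>n. w (- int n)) \<in> ?H" "(\<lambda>n. w (int n)) \<in> ?H"
        using trajectory_halves[OF subsetD[OF WT]] by auto
      have "y \<in> range w" using w by (auto simp: trajectories_through_def)
      then obtain k where k: "w k = y" by auto
      have "(\<exists>n. w (int n) = y) \<or> (\<exists>n. w (- int n) = y)" using k by (metis int_cases2)
      then show "w \<in> (U hit ?H x \<union> U ?H hit x) \<union> (\<Union>z\<in>-{x}. U ?H ?H z)"
        using halves wW unfolding U_def hit_def by (cases "w 0 = x") auto
    qed
    show "(U hit ?H x \<union> U ?H hit x) \<union> (\<Union>z\<in>-{x}. U ?H ?H z) \<in> sets Q"
      using sets_U by (intro sets.Un sets.countable_UN') auto
  qed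
  also have "\<dots> = emeasure Q (U hit ?H x \<union> U ?H hit x)"
    using null sets_U by (intro emeasure_Un_null_set null_sets_UN') auto
  also have "\<dots> \<le> emeasure Q (U hit ?H x) + emeasure Q (U ?H hit x)"
    by (rule emeasure_subadditive) (use sets_U in auto)
  also have "\<dots> = ennreal (\<P>(w in ?M. w \<in> hit \<bar> ?ret w) * escape x * \<P>(w in ?M. w \<in> ?H))
      + ennreal (\<P>(w in ?M. w \<in> ?H \<bar> ?ret w) * escape x * \<P>(w in ?M. w \<in> hit))"
    unfolding U_def escape_def using Q_rect'[OF hit all, of x] Q_rect'[OF all hit, of x] by simp
  also have "\<dots> \<le> ennreal (min (escape x) (hi * hits x y)) + ennreal (min (escape x) (hi * hits x y))"
  proof (intro add_mono ennreal_leI)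
    have cond_le: "\<P>(w in ?M. w \<in> A \<bar> ?ret w) \<le> 1" for A
    proof -
      have "{w \<in> space ?M. ?ret w} \<in> sets ?M"
      proof -
        have "{w. ?ret w} = {w. \<forall>n. w (Suc n) \<noteq> x}"
          unfolding return_time_singleton by simp
        moreover have "{w. \<forall>n. w (Suc n) \<noteq> x} \<in> sets seq_space" by (rule sets_seq_spaceI) measurable
        ultimately show ?thesis by simp
      qed
      then have "\<P>(w in ?M. w \<in> A \<and> ?ret w) \<le> \<P>(w in ?M. ?ret w)"
        by (intro M.finite_measure_mono) auto
      then show ?thesis unfolding cond_prob_def by (simp add: divide_le_eq_1 zero_less_measure_iff)
    qed
    have cond_ge: "0 \<le> \<P>(w in ?M. w \<in> A \<bar> ?ret w)" for A unfolding cond_prob_def by simp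
    have sets_hits: "{w. \<exists>n. w n = y} \<in> sets ?M"
      by (simp, rule sets_seq_spaceI) measurable
    have hit_le: "\<P>(w in ?M. w \<in> hit) \<le> hits x y" "\<P>(w in ?M. w \<in> hit \<and> ?ret w) \<le> hits x y"
      unfolding hits_def by (intro M.finite_measure_mono sets_hits; auto simp: hit_def)+
    have esc_hi: "escape x \<le> hi"
    proof -
      have "escape x = \<P>(w in ?M. ?ret w) * mu x" by (simp add: escape_def equilibrium_measure_def)
      also have "\<dots> \<le> 1 * hi" using weight_le[of x] mu_pos[of x] by (intro mult_mono) (auto simp: less_imp_le)
      finally show ?thesis by simp
    qed
    have hi0: "0 \<le> hi" using e0 esc_hi by linarith
    have "\<P>(w in ?M. w \<in> hit \<bar> ?ret w) * escape x \<le> hi * hits x y"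
    proof -
      have "\<P>(w in ?M. w \<in> hit \<bar> ?ret w) * escape x \<le> \<P>(w in ?M. w \<in> hit \<and> ?ret w) * mu x"
        using mu_pos[of x] by (simp add: cond_prob_def escape_def equilibrium_measure_def)
      also have "\<dots> \<le> hits x y * hi"
        using hit_le(2) weight_le[of x] mu_pos[of x] by (intro mult_mono) (auto simp: less_imp_le hits_def)
      finally show ?thesis by (simp add: mult.commute)
    qed
    moreover have "\<P>(w in ?M. w \<in> hit \<bar> ?ret w) * escape x \<le> escape x"
      using mult_right_mono[OF cond_le e0] by simp
    moreover have "\<P>(w in ?M. w \<in> hit \<bar> ?ret w) * escape x * \<P>(w in ?M. w \<in> ?H)
        \<le> \<P>(w in ?M. w \<in> hit \<bar> ?ret w) * escape x * 1"
      by (intro mult_left_mono mult_nonneg_nonneg cond_ge e0) auto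
    ultimately show "\<P>(w in ?M. w \<in> hit \<bar> ?ret w) * escape x * \<P>(w in ?M. w \<in> ?H) \<le> min (escape x) (hi * hits x y)"
      by simp
    have "\<P>(w in ?M. w \<in> ?H \<bar> ?ret w) * escape x * \<P>(w in ?M. w \<in> hit) \<le> 1 * escape x * \<P>(w in ?M. w \<in> hit)"
      by (intro mult_right_mono cond_le e0) auto
    moreover have "escape x * \<P>(w in ?M. w \<in> hit) \<le> escape x * 1"
      by (intro mult_left_mono e0) auto
    moreover have "escape x * \<P>(w in ?M. w \<in> hit) \<le> hi * hits x y"
      using hit_le(1) esc_hi hi0 by (intro mult_mono) auto
    ultimately show "\<P>(w in ?M. w \<in> ?H \<bar> ?ret w) * escape x * \<P>(w in ?M. w \<in> hit) \<le> min (escape x) (hi * hits x y)"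
      by simp
  qed
  also have "\<dots> = ennreal (2 * min (escape x) (hi * hits x y))"
  proof -
    have "0 \<le> hi" using mu_pos[of x] weight_le[of x] by linarith
    then have "0 \<le> min (escape x) (hi * hits x y)" using e0 by (simp add: hits_def)
    then show ?thesis by (simp flip: ennreal_plus)
  qed
  finally show ?thesis .
qed

section \<open>Poisson processes and decoupling\<close>

lemma sets_Collect_finite_pattern:
  assumes K: "finite K" and Z: "\<And>y. y \<in> K \<Longrightarrow> {w \<in> space M. Z w y} \<in> sets M"
  shows "{w \<in> space M. \<Phi> {y \<in> K. Z w y}} \<in> sets M"
proof -
  have "{w \<in> space M. \<Phi> {y \<in> K. Z w y}}
      = (\<Union>T\<in>{T \<in> Pow K. \<Phi> T}. {w \<in> space M. \<forall>y\<in>K. Z w y \<longleftrightarrow> y \<in> T})" (is "?L = ?R")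
  proof (intro equalityI subsetI)
    fix w assume "w \<in> ?L"
    then show "w \<in> ?R" by (intro UN_I[of "{y \<in> K. Z w y}"]) auto
  next
    fix w assume "w \<in> ?R"
    then obtain T where T: "T \<subseteq> K" "\<Phi> T" "w \<in> space M" "\<forall>y\<in>K. Z w y \<longleftrightarrow> y \<in> T" by blast
    then have "{y \<in> K. Z w y} = T" by blast
    then show "w \<in> ?L" using T by simp
  qed
  also have "\<dots> \<in> sets M"
  proof (intro sets.finite_UN)
    show "{w \<in> space M. \<forall>y\<in>K. Z w y \<longleftrightarrow> y \<in> T} \<in> sets M" for T
    proof (rule sets.sets_Collect_finite_All[OF _ K])
      fix y assume "y \<in> K"
      then show "{w \<in> space M. Z w y \<longleftrightarrow> y \<in> T} \<in> sets M"
        using Z[of y] sets.sets_Collect_neg[OF Z[of y]] by (cases "y \<in> T") auto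
    qed
  qed (use K in auto)
  finally show ?thesis .
qed

locale interlacement = bounded_graph E a lo hi
  for E :: "'v::countable set set" and a lo hi +
  fixes P :: "'w measure" and I :: "'w \<Rightarrow> nat set"
    and p :: "'w \<Rightarrow> nat \<Rightarrow> (int \<Rightarrow> 'v) set \<times> real" and \<nu> :: "(int \<Rightarrow> 'v) set measure"
  assumes intensity: "is_interlacement_intensity E a \<nu>"
    and poisson: "poisson_point_process P (\<nu> \<Otimes>\<^sub>M restrict_space lborel {0::real..}) I p"
begin

abbreviation through :: "'v \<Rightarrow> (int \<Rightarrow> 'v) set set" where "through \<equiv> trajectories_through E"

abbreviation occupied :: "real \<Rightarrow> 'w \<Rightarrow> 'v set" where
  "occupied u \<xi> \<equiv> - vacant_set (I \<xi>) (p \<xi>) u"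

abbreviation number :: "real \<Rightarrow> (int \<Rightarrow> 'v) set set \<Rightarrow> 'w \<Rightarrow> ennreal" where
  "number u B \<xi> \<equiv> point_count (I \<xi>) (p \<xi>) (B \<times> {0..u})"

lemma prob_space_P: "prob_space P"
  using poisson by (simp add: poisson_point_process_def)

sublocale prob_space P by (rule prob_space_P)

lemmas poisson_parts = poisson[unfolded poisson_point_process_def]
lemmas poisson_points = poisson_parts[THEN conjunct2, THEN conjunct1, rule_format]
lemmas poisson_measurable = poisson_parts[THEN conjunct2, THEN conjunct2, THEN conjunct1, rule_format]
lemmas poisson_law = poisson_parts[THEN conjunct2, THEN conjunct2, THEN conjunct2, THEN conjunct1, rule_format]
lemmas poisson_indep = poisson_parts[THEN conjunct2, THEN conjunct2, THEN conjunct2, THEN conjunct2, THEN conjunct2, rule_format]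

lemma sets_nu: "sets \<nu> = sets (trajectory_mod_shift_space E)"
  using intensity by (simp add: is_interlacement_intensity_def)

lemma space_nu: "space \<nu> = trajectories_mod_shift E"
  using sets_eq_imp_space_eq[OF sets_nu] by simp

lemma sets_through [measurable]: "through x \<in> sets \<nu>"
  by (simp add: sets_nu sets_trajectories_through)

lemma sets_time: "{0..u} \<in> sets (restrict_space lborel {0::real..})"
  by (auto simp: sets_restrict_space intro!: image_eqI[of _ _ "{0..u}"])

lemma sets_window: "B \<in> sets \<nu> \<Longrightarrow> B \<times> {0..u} \<in> sets (\<nu> \<Otimes>\<^sub>M restrict_space lborel {0::real..})"
  by (rule pair_measureI[OF _ sets_time])

lemma emeasure_window:
  assumes "B \<in> sets \<nu>" "0 \<le> u"
  shows "emeasure (\<nu> \<Otimes>\<^sub>M restrict_space lborel {0::real..}) (B \<times> {0..u}) = emeasure \<nu> B * ennreal u"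
proof -
  interpret time: sigma_finite_measure "restrict_space lborel {0::real..}"
    by (rule sigma_finite_measure_restrict_space) (auto intro: sigma_finite_lborel)
  have "emeasure (restrict_space lborel {0::real..}) {0..u} = ennreal u"
    using assms(2) by (subst emeasure_restrict_space) auto
  then show ?thesis
    using time.emeasure_pair_measure_Times[OF assms(1) sets_time] by simp
qed

lemma number_measurable: "B \<in> sets \<nu> \<Longrightarrow> number u B \<in> borel_measurable P"
  by (rule poisson_measurable[OF sets_window])

lemma number_eq_0_iff:
  "number u B \<xi> = 0 \<longleftrightarrow> (\<forall>i\<in>I \<xi>. p \<xi> i \<notin> B \<times> {0..u})"
  unfolding point_count_def by (subst emeasure_count_space_eq_0) auto

lemma number_neq_0_iff:
  assumes "\<xi> \<in> space P"
  shows "number u B \<xi> \<noteq> 0 \<longleftrightarrow> (\<exists>i\<in>I \<xi>. fst (p \<xi> i) \<in> B \<and> snd (p \<xi> i) \<le> u)"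
proof -
  have "p \<xi> i \<in> trajectories_mod_shift E \<times> {0..}" if "i \<in> I \<xi>" for i
    using poisson_points[OF assms that] by (auto simp: space_pair_measure space_nu space_restrict_space)
  then show ?thesis unfolding number_eq_0_iff by (force simp: mem_Times_iff)
qed

lemma occupied_iff:
  assumes "\<xi> \<in> space P"
  shows "y \<in> occupied u \<xi> \<longleftrightarrow> number u (through y) \<xi> \<noteq> 0"
proof -
  have "fst (p \<xi> i) \<in> trajectories_mod_shift E" if "i \<in> I \<xi>" for i
    using poisson_points[OF assms that] by (auto simp: space_pair_measure space_nu)
  then show ?thesis
    unfolding number_neq_0_iff[OF assms] by (auto simp: vacant_set_def trajectories_through_def)
qed

lemma occupied_event: "{\<xi> \<in> space P. y \<in> occupied u \<xi>} \<in> sets P"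
proof -
  have [measurable]: "number u (through y) \<in> borel_measurable P"
    by (rule number_measurable[OF sets_through])
  have "{\<xi> \<in> space P. y \<in> occupied u \<xi>} = {\<xi> \<in> space P. number u (through y) \<xi> \<noteq> 0}"
    using occupied_iff by auto
  also have "\<dots> \<in> sets P" by measurable
  finally show ?thesis .
qed

lemma occupied_local_event:
  assumes "finite K"
  shows "{\<xi> \<in> space P. \<Phi> (occupied u \<xi> \<inter> K)} \<in> sets P"
proof -
  have "{y \<in> K. y \<in> occupied u \<xi>} = occupied u \<xi> \<inter> K" for \<xi> by blast
  then show ?thesis
    using sets_Collect_finite_pattern[OF assms, of P "\<lambda>\<xi> y. y \<in> occupied u \<xi>" \<Phi>] occupied_event by simp
qed

lemma prob_number_le:
  assumes B: "B \<in> sets \<nu>" and u: "0 \<le> u" and fin: "emeasure \<nu> B < \<infinity>"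
  shows "prob {\<xi> \<in> space P. number u B \<xi> \<noteq> 0} \<le> u * measure \<nu> B"
proof -
  let ?L = "\<nu> \<Otimes>\<^sub>M restrict_space lborel {0::real..}"
  have L: "emeasure ?L (B \<times> {0..u}) = ennreal (u * measure \<nu> B)"
    using emeasure_window[OF B u] fin u by (simp add: emeasure_eq_ennreal_measure ennreal_mult mult.commute)
  then have mL: "measure ?L (B \<times> {0..u}) = u * measure \<nu> B"
    using u by (simp add: measure_def)
  have "prob {\<xi> \<in> space P. number u B \<xi> = of_nat 0} = exp (- measure ?L (B \<times> {0..u})) * measure ?L (B \<times> {0..u}) ^ 0 / fact 0"
    by (rule poisson_law[OF sets_window[OF B]]) (simp add: L)
  then have zero: "prob {\<xi> \<in> space P. number u B \<xi> = 0} = exp (- (u * measure \<nu> B))"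
    by (simp add: mL)
  have [measurable]: "number u B \<in> borel_measurable P" by (rule number_measurable[OF B])
  have "{\<xi> \<in> space P. number u B \<xi> \<noteq> 0} = space P - {\<xi> \<in> space P. number u B \<xi> = 0}" by auto
  then have "prob {\<xi> \<in> space P. number u B \<xi> \<noteq> 0} = 1 - exp (- (u * measure \<nu> B))"
    using zero by (simp add: prob_compl)
  also have "\<dots> \<le> u * measure \<nu> B"
    using exp_ge_add_one_self[of "- (u * measure \<nu> B)"] by linarith
  finally show ?thesis .
qed

text \<open>
  For fixed \<open>K\<close> these sets are disjoint, so the Poisson process has independent numbers of points in
  them, and those that contain a point determine the occupied sites in \<open>K\<close>.
\<close>

definition atom :: "'v set \<Rightarrow> 'v set \<Rightarrow> (int \<Rightarrow> 'v) set set" where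
  "atom K S = {c \<in> trajectories_mod_shift E. class_range c \<inter> K = S}"

lemma sets_atom:
  assumes "finite K"
  shows "atom K S \<in> sets \<nu>"
proof -
  have "{y \<in> K. c \<in> through y} = class_range c \<inter> K" if "c \<in> space \<nu>" for c
    using that by (auto simp: space_nu trajectories_through_def)
  then have "atom K S = {c \<in> space \<nu>. {y \<in> K. c \<in> through y} = S}"
    by (auto simp: atom_def space_nu)
  also have "\<dots> \<in> sets \<nu>"
  proof (rule sets_Collect_finite_pattern[OF assms])
    fix y
    have "{c \<in> space \<nu>. c \<in> through y} = through y"
      using sets.sets_into_space[OF sets_through[of y]] by auto
    then show "{c \<in> space \<nu>. c \<in> through y} \<in> sets \<nu>" using sets_through[of y] by simp
  qed
  finally show ?thesis .
qed

text \<open>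
  The trajectories that meet \<open>K1\<close> but not \<open>K2\<close> and those that meet \<open>K2\<close> but not \<open>K1\<close> form independent processes. If no
  trajectory meets both sets, they account for all occupied sites in \<open>K1\<close> and \<open>K2\<close>; in general they account for a
  part of them, and monotonicity of \<open>f1\<close> and \<open>f2\<close> compares the probabilities. The last term bounds the
  probability that some trajectory meets both sets.
\<close>

lemma decoupling:
  assumes K1: "finite K1" and K2: "finite K2" and u: "0 \<le> u"
    and mono1: "\<And>S S'. S \<subseteq> S' \<Longrightarrow> f1 S \<Longrightarrow> f1 S'" and mono2: "\<And>S S'. S \<subseteq> S' \<Longrightarrow> f2 S \<Longrightarrow> f2 S'"
    and fin: "\<And>x y. emeasure \<nu> (through x \<inter> through y) < \<infinity>"
  shows "prob {\<xi> \<in> space P. f1 (occupied u \<xi> \<inter> K1) \<and> f2 (occupied u \<xi> \<inter> K2)}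
    \<le> prob {\<xi> \<in> space P. f1 (occupied u \<xi> \<inter> K1)} * prob {\<xi> \<in> space P. f2 (occupied u \<xi> \<inter> K2)}
      + u * (\<Sum>x\<in>K1. \<Sum>y\<in>K2. measure \<nu> (through x \<inter> through y))"
proof -
  let ?K = "K1 \<union> K2"
  obtain s :: "nat \<Rightarrow> 'v set" where s: "bij_betw s {0..<card (Pow ?K)} (Pow ?K)"
    using ex_bij_betw_nat_finite[of "Pow ?K"] K1 K2 by auto
  define J where "J = {0..<card (Pow ?K)}"
  have sK: "s j \<subseteq> ?K" if "j \<in> J" for j using bij_betwE[OF s] that unfolding J_def by auto
  define X where "X j = number u (atom ?K (s j))" for j
  have indep: "indep_vars (\<lambda>_. borel) X J"
  proof -
    have "disjoint_family_on (\<lambda>j. atom ?K (s j) \<times> {0..u}) J"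
      unfolding disjoint_family_on_def
    proof (intro ballI impI)
      fix i j assume ij: "i \<in> J" "j \<in> J" "i \<noteq> j"
      then have "s i \<noteq> s j" using s unfolding J_def bij_betw_def inj_on_def by blast
      then show "(atom ?K (s i) \<times> {0..u}) \<inter> (atom ?K (s j) \<times> {0..u}) = {}" by (auto simp: atom_def)
    qed
    moreover have "(\<lambda>j. atom ?K (s j) \<times> {0..u}) ` J \<subseteq> sets (\<nu> \<Otimes>\<^sub>M restrict_space lborel {0::real..})"
      using sets_atom[of ?K] K1 K2 sets_window by auto
    moreover have "finite J" by (simp add: J_def)
    ultimately show ?thesis
      unfolding X_def by (intro poisson_indep)
  qed
  define J1 where "J1 = {j \<in> J. s j \<inter> K2 = {} \<and> s j \<noteq> {}}"
  define J2 where "J2 = {j \<in> J. s j \<inter> K1 = {} \<and> s j \<noteq> {}}"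
  have J: "finite J1" "finite J2" "J1 \<subseteq> J" "J2 \<subseteq> J" "J1 \<inter> J2 = {}"
    using sK by (auto simp: J1_def J2_def J_def)
  \<comment> \<open>The sites covered by the atoms that are indexed by \<open>A\<close> and contain a point of the process.\<close>
  define part :: "nat set \<Rightarrow> (nat \<Rightarrow> ennreal) \<Rightarrow> 'v set" where "part A g = \<Union> (s ` {j \<in> A. g j \<noteq> 0})" for A g
  have part_sets: "{g \<in> space (PiM A (\<lambda>_. borel :: ennreal measure)). f (part A g)} \<in> sets (PiM A (\<lambda>_. borel :: ennreal measure))"
    if A: "finite A" for A f
    unfolding part_def
  proof (rule sets_Collect_finite_pattern[OF A, where \<Phi> = "\<lambda>T. f (\<Union> (s ` T))"])
    fix j assume "j \<in> A"
    then show "{g \<in> space (PiM A (\<lambda>_. borel)). g j \<noteq> (0::ennreal)} \<in> sets (PiM A (\<lambda>_. borel))"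
      by measurable
  qed
  define R where "R A \<xi> = restrict (\<lambda>j. X j \<xi>) A" for A \<xi>
  \<comment> \<open>\<open>F1\<close> and \<open>F2\<close> are the events \<open>f1\<close> and \<open>f2\<close> for the sites covered by trajectories that meet only one of the sets.\<close>
  define F1 where "F1 = R J1 -` {g \<in> space (PiM J1 (\<lambda>_. borel :: ennreal measure)). f1 (part J1 g)} \<inter> space P"
  define F2 where "F2 = R J2 -` {g \<in> space (PiM J2 (\<lambda>_. borel :: ennreal measure)). f2 (part J2 g)} \<inter> space P"
  have ind: "indep_var (PiM J1 (\<lambda>_. borel :: ennreal measure)) (R J1) (PiM J2 (\<lambda>_. borel :: ennreal measure)) (R J2)"
    unfolding R_def by (rule indep_var_restrict[OF indep]) (use J in auto)
  have prod: "prob (F1 \<inter> F2) = prob F1 * prob F2"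
    using indep_varD[OF ind part_sets[OF J(1)] part_sets[OF J(2)]] unfolding F1_def F2_def
    by (simp add: vimage_Times Int_def vimage_def) (smt (verit) Collect_cong)
  have sets_F: "F1 \<in> sets P" "F2 \<in> sets P"
    unfolding F1_def F2_def using indep_var_rv1[OF ind] indep_var_rv2[OF ind] part_sets[OF J(1)] part_sets[OF J(2)]
    by (auto intro: measurable_sets)
  have F_iff: "\<xi> \<in> F1 \<longleftrightarrow> \<xi> \<in> space P \<and> f1 (part J1 (R J1 \<xi>))" "\<xi> \<in> F2 \<longleftrightarrow> \<xi> \<in> space P \<and> f2 (part J2 (R J2 \<xi>))" for \<xi>
    unfolding F1_def F2_def by (auto simp: R_def space_PiM)
  define both where "both = (\<Union>x\<in>K1. \<Union>y\<in>K2. through x \<inter> through y)"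
  have sets_both: "both \<in> sets \<nu>" unfolding both_def using K1 K2 by (intro sets.finite_UN) auto
  have part_iff: "y \<in> part A (R A \<xi>) \<longleftrightarrow> (\<exists>j\<in>A. y \<in> s j \<and> (\<exists>i\<in>I \<xi>. fst (p \<xi> i) \<in> atom ?K (s j) \<and> snd (p \<xi> i) \<le> u))"
    if "\<xi> \<in> space P" for A y \<xi>
    unfolding part_def R_def X_def using number_neq_0_iff[OF that] by auto
  have part_occ: "part A (R A \<xi>) \<subseteq> occupied u \<xi>" if \<xi>: "\<xi> \<in> space P" for A \<xi>
  proof
    fix y assume "y \<in> part A (R A \<xi>)"
    then obtain j i where "y \<in> s j" "i \<in> I \<xi>" "fst (p \<xi> i) \<in> atom ?K (s j)" "snd (p \<xi> i) \<le> u"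
      using part_iff[OF \<xi>] by blast
    then show "y \<in> occupied u \<xi>" by (auto simp: vacant_set_def atom_def)
  qed
  have part_K: "part J1 g \<subseteq> K1" "part J2 g \<subseteq> K2" for g
    using sK by (auto simp: part_def J1_def J2_def)
  have occ_part: "occupied u \<xi> \<inter> K1 \<subseteq> part J1 (R J1 \<xi>) \<and> occupied u \<xi> \<inter> K2 \<subseteq> part J2 (R J2 \<xi>)"
    if \<xi>: "\<xi> \<in> space P" and none: "number u both \<xi> = 0" for \<xi>
  proof -
    have none': "\<not> (\<exists>i\<in>I \<xi>. fst (p \<xi> i) \<in> both \<and> snd (p \<xi> i) \<le> u)"
      using none number_neq_0_iff[OF \<xi>] by blast
    have "\<exists>j\<in>J. y \<in> s j \<and> (\<exists>i\<in>I \<xi>. fst (p \<xi> i) \<in> atom ?K (s j) \<and> snd (p \<xi> i) \<le> u) \<and> (s j \<inter> K1 = {} \<or> s j \<inter> K2 = {})"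
      if y: "y \<in> occupied u \<xi>" "y \<in> ?K" for y
    proof -
      obtain i where i: "i \<in> I \<xi>" "fst (p \<xi> i) \<in> through y" "snd (p \<xi> i) \<le> u"
        using y(1) unfolding occupied_iff[OF \<xi>] number_neq_0_iff[OF \<xi>] by blast
      define S where "S = class_range (fst (p \<xi> i)) \<inter> ?K"
      have "S \<in> s ` J" using s unfolding J_def bij_betw_def S_def by auto
      then obtain j where j: "j \<in> J" "s j = S" by auto
      have "fst (p \<xi> i) \<in> atom ?K (s j)" using i(2) unfolding j by (simp add: atom_def S_def trajectories_through_def)
      moreover have "S \<inter> K1 = {} \<or> S \<inter> K2 = {}"
      proof (rule ccontr)
        assume "\<not> ?thesis"
        then obtain x1 x2 where "x1 \<in> S" "x1 \<in> K1" "x2 \<in> S" "x2 \<in> K2" by blast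
        then have "fst (p \<xi> i) \<in> both"
          using i(2) unfolding both_def by (auto simp: S_def trajectories_through_def)
        then show False using none' i by blast
      qed
      moreover have "y \<in> s j" using i(2) y(2) unfolding j by (simp add: S_def trajectories_through_def)
      ultimately show ?thesis using j i by blast
    qed
    then show ?thesis
      unfolding subset_iff part_iff[OF \<xi>] J1_def J2_def by blast
  qed
  have E_sets: "{\<xi> \<in> space P. f1 (occupied u \<xi> \<inter> K1)} \<in> sets P" "{\<xi> \<in> space P. f2 (occupied u \<xi> \<inter> K2)} \<in> sets P"
    using occupied_local_event[OF K1, of f1 u] occupied_local_event[OF K2, of f2 u] by auto
  have N_sets: "{\<xi> \<in> space P. number u both \<xi> \<noteq> 0} \<in> sets P"
  proof -
    have [measurable]: "number u both \<in> borel_measurable P" by (rule number_measurable[OF sets_both])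
    show ?thesis by measurable
  qed
  have "prob {\<xi> \<in> space P. f1 (occupied u \<xi> \<inter> K1) \<and> f2 (occupied u \<xi> \<inter> K2)}
      \<le> prob ((F1 \<inter> F2) \<union> {\<xi> \<in> space P. number u both \<xi> \<noteq> 0})"
  proof (rule finite_measure_mono)
    show "{\<xi> \<in> space P. f1 (occupied u \<xi> \<inter> K1) \<and> f2 (occupied u \<xi> \<inter> K2)}
      \<subseteq> (F1 \<inter> F2) \<union> {\<xi> \<in> space P. number u both \<xi> \<noteq> 0}"
    proof
      fix \<xi> assume \<xi>: "\<xi> \<in> {\<xi> \<in> space P. f1 (occupied u \<xi> \<inter> K1) \<and> f2 (occupied u \<xi> \<inter> K2)}"
      show "\<xi> \<in> (F1 \<inter> F2) \<union> {\<xi> \<in> space P. number u both \<xi> \<noteq> 0}"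
      proof (cases "number u both \<xi> = 0")
        case True
        have "\<xi> \<in> F1 \<inter> F2"
          using \<xi> occ_part[OF _ True] mono1 mono2 unfolding Int_iff F_iff by blast
        then show ?thesis by blast
      qed (use \<xi> in auto)
    qed
    show "(F1 \<inter> F2) \<union> {\<xi> \<in> space P. number u both \<xi> \<noteq> 0} \<in> sets P" using sets_F N_sets by blast
  qed
  also have "\<dots> \<le> prob (F1 \<inter> F2) + prob {\<xi> \<in> space P. number u both \<xi> \<noteq> 0}"
    by (rule measure_Un_le) (use sets_F N_sets in auto)
  also have "prob (F1 \<inter> F2) \<le> prob {\<xi> \<in> space P. f1 (occupied u \<xi> \<inter> K1)} * prob {\<xi> \<in> space P. f2 (occupied u \<xi> \<inter> K2)}"
    unfolding prod
  proof (intro mult_mono finite_measure_mono E_sets)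
    show "F1 \<subseteq> {\<xi> \<in> space P. f1 (occupied u \<xi> \<inter> K1)}"
    proof
      fix \<xi> assume "\<xi> \<in> F1"
      then have \<xi>: "\<xi> \<in> space P" and f: "f1 (part J1 (R J1 \<xi>))" using F_iff by auto
      have "part J1 (R J1 \<xi>) \<subseteq> occupied u \<xi> \<inter> K1" using part_occ[OF \<xi>] part_K by blast
      from mono1[OF this f] show "\<xi> \<in> {\<xi> \<in> space P. f1 (occupied u \<xi> \<inter> K1)}" using \<xi> by simp
    qed
    show "F2 \<subseteq> {\<xi> \<in> space P. f2 (occupied u \<xi> \<inter> K2)}"
    proof
      fix \<xi> assume "\<xi> \<in> F2"
      then have \<xi>: "\<xi> \<in> space P" and f: "f2 (part J2 (R J2 \<xi>))" using F_iff by auto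
      have "part J2 (R J2 \<xi>) \<subseteq> occupied u \<xi> \<inter> K2" using part_occ[OF \<xi>] part_K by blast
      from mono2[OF this f] show "\<xi> \<in> {\<xi> \<in> space P. f2 (occupied u \<xi> \<inter> K2)}" using \<xi> by simp
    qed
  qed auto
  also have "prob {\<xi> \<in> space P. number u both \<xi> \<noteq> 0} \<le> u * (\<Sum>x\<in>K1. \<Sum>y\<in>K2. measure \<nu> (through x \<inter> through y))"
  proof -
    have sum: "emeasure \<nu> both \<le> ennreal (\<Sum>x\<in>K1. \<Sum>y\<in>K2. measure \<nu> (through x \<inter> through y))"
    proof -
      have "emeasure \<nu> both \<le> (\<Sum>x\<in>K1. emeasure \<nu> (\<Union>y\<in>K2. through x \<inter> through y))"
        unfolding both_def using K1 K2 by (intro emeasure_subadditive_finite) auto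
      also have "\<dots> \<le> (\<Sum>x\<in>K1. \<Sum>y\<in>K2. emeasure \<nu> (through x \<inter> through y))"
        using K2 by (intro sum_mono emeasure_subadditive_finite) auto
      also have "\<dots> = (\<Sum>x\<in>K1. \<Sum>y\<in>K2. ennreal (measure \<nu> (through x \<inter> through y)))"
        using fin by (intro sum.cong refl emeasure_eq_ennreal_measure) (simp add: less_top[symmetric])
      also have "\<dots> = ennreal (\<Sum>x\<in>K1. \<Sum>y\<in>K2. measure \<nu> (through x \<inter> through y))"
        by (simp add: sum_ennreal sum_nonneg)
      finally show ?thesis .
    qed
    then have both_fin: "emeasure \<nu> both < \<infinity>" by (simp add: le_less_trans)
    have "measure \<nu> both \<le> (\<Sum>x\<in>K1. \<Sum>y\<in>K2. measure \<nu> (through x \<inter> through y))"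
      unfolding measure_def[of \<nu> both] using sum by (intro enn2real_leI sum_nonneg) auto
    then show ?thesis
      using prob_number_le[OF sets_both u both_fin] u mult_left_mono order_trans by blast
  qed
  finally show ?thesis by simp
qed

end

section \<open>Percolation and crossing probabilities\<close>

lemma grid_box_eq: "grid_box z r = {fst z - r..fst z + r} \<times> {snd z - r..snd z + r}"
  by (auto simp: grid_box_def abs_le_iff)

lemma finite_grid_box [simp]: "finite (grid_box z r)"
  by (simp add: grid_box_eq)

lemma card_grid_box: "0 \<le> r \<Longrightarrow> real (card (grid_box z r)) = (2 * real_of_int r + 1)\<^sup>2"
  by (simp add: grid_box_eq card_cartesian_product power2_eq_square)

lemma infinite_iff_unbounded_to_nat:
  "infinite (S :: 'a::countable set) \<longleftrightarrow> (\<forall>n. \<exists>y. n < to_nat y \<and> y \<in> S)"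
proof -
  have "infinite S \<longleftrightarrow> infinite (to_nat ` S)"
    using finite_image_iff[of to_nat S] inj_on_subset[OF inj_to_nat, of S] by auto
  also have "\<dots> \<longleftrightarrow> (\<forall>n. \<exists>m>n. m \<in> to_nat ` S)" by (rule infinite_nat_iff_unbounded)
  also have "\<dots> \<longleftrightarrow> (\<forall>n. \<exists>y. n < to_nat y \<and> y \<in> S)" by blast
  finally show ?thesis .
qed

context interlacement begin

text \<open>
  Since the vertices are countable, paths of length \<open>n\<close> and infinite sets are described by countable
  quantifiers over the events \<open>y \<in> occupied u \<xi>\<close>.
\<close>

lemma percolation_event:
  "{\<xi> \<in> space P. infinite (component_in E (vacant_set (I \<xi>) (p \<xi>) u) x)} \<in> sets P"
proof -
  let ?S = "\<lambda>\<xi>. vacant_set (I \<xi>) (p \<xi>) u"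
  let ?R = "\<lambda>\<xi>. {(y, z). y \<in> ?S \<xi> \<and> z \<in> ?S \<xi> \<and> {y, z} \<in> E}"
  have vac: "{\<xi> \<in> space P. y \<in> ?S \<xi>} \<in> sets P" for y
    using sets.sets_Collect_neg[OF occupied_event[of y u]] by simp
  have rel: "{\<xi> \<in> space P. (x, y) \<in> ?R \<xi> ^^ n} \<in> sets P" for n y
  proof (induction n arbitrary: y)
    case 0
    show ?case by (cases "x = y") auto
  next
    case (Suc n)
    have "{\<xi> \<in> space P. (x, y) \<in> ?R \<xi> ^^ Suc n} =
      {\<xi> \<in> space P. \<exists>z. (x, z) \<in> ?R \<xi> ^^ n \<and> z \<in> ?S \<xi> \<and> y \<in> ?S \<xi> \<and> {z, y} \<in> E}"
      by (auto simp: relcomp_unfold)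
    also have "\<dots> \<in> sets P"
      by (intro sets.sets_Collect_countable_Ex sets.sets_Collect_conj Suc.IH vac sets.sets_Collect_const)
    finally show ?case .
  qed
  have "{\<xi> \<in> space P. infinite (component_in E (?S \<xi>) x)} =
    {\<xi> \<in> space P. \<forall>n. \<exists>y. n < to_nat y \<and> (x \<in> ?S \<xi> \<and> (\<exists>k. (x, y) \<in> ?R \<xi> ^^ k))}"
    unfolding infinite_iff_unbounded_to_nat component_in_def rtrancl_is_UN_relpow by simp
  also have "\<dots> \<in> sets P"
    by (intro sets.sets_Collect_countable_All sets.sets_Collect_countable_Ex sets.sets_Collect_conj rel vac sets.sets_Collect_const)
  finally show ?thesis .
qed

lemma percolation_prob_pos:
  assumes "B \<in> sets P" "prob B < 1"
    and "\<And>\<xi>. \<xi> \<in> space P \<Longrightarrow> \<xi> \<notin> B \<Longrightarrow> infinite (component_in E (vacant_set (I \<xi>) (p \<xi>) u) x)"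
  shows "0 < percolation_prob E P I p u x"
proof -
  have "0 < prob (space P - B)" using assms by (simp add: prob_compl)
  also have "\<dots> \<le> percolation_prob E P I p u x"
    unfolding percolation_prob_def by (rule finite_measure_mono[OF _ percolation_event]) (use assms(3) in auto)
  finally show ?thesis .
qed

lemma intensity_finite: "emeasure \<nu> (through x \<inter> through y) < \<infinity>"
  using le_less_trans[OF intensity_through_two[OF intensity, of x y]] by simp

lemma measure_through_two:
  "measure \<nu> (through x \<inter> through y) \<le> 2 * min (equilibrium_measure E a {x} x) (hi * measure (walk_law E a x) {w. \<exists>n. w n = y})"
proof -
  have "0 \<le> hi" using mu_pos[of x] weight_le[of x] by linarith
  moreover have "0 \<le> equilibrium_measure E a {x} x"
    using mu_pos[of x] by (simp add: equilibrium_measure_def less_imp_le)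
  ultimately show ?thesis
    unfolding measure_def[of \<nu>] by (intro enn2real_leI intensity_through_two[OF intensity]) simp
qed

lemma prob_occupied_le: "0 \<le> u \<Longrightarrow> prob {\<xi> \<in> space P. y \<in> occupied u \<xi>} \<le> u * measure \<nu> (through y)"
proof -
  assume u: "0 \<le> u"
  have "{\<xi> \<in> space P. y \<in> occupied u \<xi>} = {\<xi> \<in> space P. number u (through y) \<xi> \<noteq> 0}"
    using occupied_iff by auto
  then show ?thesis using prob_number_le[OF sets_through u, of y] intensity_finite[of y y] by simp
qed

end

text \<open>
  An embedded quarter plane with intensity decaying faster than the inverse fourth power of the
  distance. The map \<open>\<phi>\<close> is defined on the whole plane so that boxes may extend beyond the quarter plane and all
  centres can be treated alike.
\<close>

locale planar_interlacement = interlacement E a lo hi P I p \<nu>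
  for E :: "'v::countable set set" and a lo hi and P :: "'w measure" and I p \<nu> +
  fixes \<phi> :: "int \<times> int \<Rightarrow> 'v" and C :: real
  assumes C_pos: "0 < C"
    and single: "measure \<nu> (trajectories_through E x) \<le> C"
    and pair: "\<And>q q' r. 0 \<le> fst q \<Longrightarrow> 0 \<le> snd q \<Longrightarrow> 0 \<le> fst q' \<Longrightarrow> 0 \<le> snd q' \<Longrightarrow> 0 < r \<Longrightarrow>
        r \<le> \<bar>real_of_int (fst q - fst q')\<bar> \<or> r \<le> \<bar>real_of_int (snd q - snd q')\<bar> \<Longrightarrow>
        measure \<nu> (trajectories_through E (\<phi> q) \<inter> trajectories_through E (\<phi> q')) \<le> C * r powr (- 9 / 2)"
    and inj: "inj_on \<phi> {q. 0 \<le> fst q \<and> 0 \<le> snd q}"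
    and adjacent: "grid_adjacent q q' \<Longrightarrow> {\<phi> (int_pair q), \<phi> (int_pair q')} \<in> E"
begin

definition preimage :: "'v set \<Rightarrow> (int \<times> int) set" where
  "preimage S = {q. 0 \<le> fst q \<and> 0 \<le> snd q \<and> \<phi> q \<in> S}"

abbreviation blocked :: "real \<Rightarrow> 'w \<Rightarrow> (int \<times> int) set" where
  "blocked u \<xi> \<equiv> preimage (occupied u \<xi>)"

definition patch :: "int \<times> int \<Rightarrow> int \<Rightarrow> 'v set" where
  "patch z L = \<phi> ` {q \<in> grid_box z (3 * L + 1). 0 \<le> fst q \<and> 0 \<le> snd q}"

lemma finite_patch [simp]: "finite (patch z L)"
  by (simp add: patch_def)

lemma preimage_mono: "S \<subseteq> S' \<Longrightarrow> preimage S \<subseteq> preimage S'"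
  by (auto simp: preimage_def)

lemma crossing_preimage_mono: "S \<subseteq> S' \<Longrightarrow> crossing (preimage S) z L \<Longrightarrow> crossing (preimage S') z L"
  using crossing_mono[of "preimage S" z L "preimage S'"] preimage_mono[of S S'] by blast

lemma crossing_patch: "crossing (preimage (S \<inter> patch z L)) z L \<longleftrightarrow> crossing (preimage S) z L"
proof
  assume "crossing (preimage S) z L"
  moreover have "preimage S \<inter> grid_box z (3 * L + 1) \<subseteq> preimage (S \<inter> patch z L)"
    by (auto simp: preimage_def patch_def)
  ultimately show "crossing (preimage (S \<inter> patch z L)) z L" by (rule crossing_mono)
qed (erule crossing_preimage_mono[rotated], simp)

lemma crossing_event: "{\<xi> \<in> space P. crossing (blocked u \<xi>) z L} \<in> sets P"
  using occupied_local_event[OF finite_patch, of "\<lambda>S. crossing (preimage S) z L" u z L]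
  by (simp only: crossing_patch)

definition cross_prob :: "real \<Rightarrow> int \<times> int \<Rightarrow> int \<Rightarrow> real" where
  "cross_prob u z L = prob {\<xi> \<in> space P. crossing (blocked u \<xi>) z L}"

text \<open>
  Each box contains at most \<open>81 L\<^sup>2\<close> sites, and sites in different boxes are at distance at least \<open>L\<close>. So the
  decoupling error is at most \<open>u\<close> times \<open>81\<^sup>2 L\<^sup>4 C L\<^sup>-\<^sup>9\<^sup>/\<^sup>2\<close>.
\<close>

lemma cross_prob_pair:
  assumes u: "0 \<le> u" and L: "1 \<le> L"
    and far: "31 * L \<le> \<bar>fst z - fst z'\<bar> \<or> 31 * L \<le> \<bar>snd z - snd z'\<bar>"
  shows "prob {\<xi> \<in> space P. crossing (blocked u \<xi>) z L \<and> crossing (blocked u \<xi>) z' L}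
     \<le> cross_prob u z L * cross_prob u z' L + u * (6561 * C * real_of_int L powr (- 1 / 2))"
proof -
  have pair_le: "measure \<nu> (through x \<inter> through y) \<le> C * real_of_int L powr (- 9 / 2)"
    if xy: "x \<in> patch z L" "y \<in> patch z' L" for x y
  proof -
    obtain q q' where q: "x = \<phi> q" "y = \<phi> q'" "q \<in> grid_box z (3 * L + 1)" "q' \<in> grid_box z' (3 * L + 1)"
      "0 \<le> fst q" "0 \<le> snd q" "0 \<le> fst q'" "0 \<le> snd q'"
      using xy by (auto simp: patch_def)
    have "\<bar>fst q - fst z\<bar> \<le> 3 * L + 1" "\<bar>snd q - snd z\<bar> \<le> 3 * L + 1" "\<bar>fst q' - fst z'\<bar> \<le> 3 * L + 1" "\<bar>snd q' - snd z'\<bar> \<le> 3 * L + 1"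
      using q(3,4) by (auto simp: grid_box_def)
    then have "L \<le> \<bar>fst q - fst q'\<bar> \<or> L \<le> \<bar>snd q - snd q'\<bar>" using far L by linarith
    then have "real_of_int L \<le> \<bar>real_of_int (fst q - fst q')\<bar> \<or> real_of_int L \<le> \<bar>real_of_int (snd q - snd q')\<bar>"
      by (simp only: of_int_abs[symmetric] of_int_le_iff)
    then show ?thesis unfolding q(1,2) using L by (intro pair q) auto
  qed
  have card_patch: "real (card (patch z L)) \<le> 81 * (real_of_int L)\<^sup>2" for z
  proof -
    have "card (patch z L) \<le> card {q \<in> grid_box z (3 * L + 1). 0 \<le> fst q \<and> 0 \<le> snd q}"
      unfolding patch_def by (rule card_image_le) simp
    also have "\<dots> \<le> card (grid_box z (3 * L + 1))" by (rule card_mono) auto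
    finally have "real (card (patch z L)) \<le> (2 * real_of_int (3 * L + 1) + 1)\<^sup>2"
      using card_grid_box[of "3 * L + 1" z] L by simp
    also have "\<dots> \<le> (9 * real_of_int L)\<^sup>2" using L by (intro power_mono) auto
    finally show ?thesis by (simp add: power_mult_distrib)
  qed
  have "prob {\<xi> \<in> space P. crossing (blocked u \<xi>) z L \<and> crossing (blocked u \<xi>) z' L} =
    prob {\<xi> \<in> space P. crossing (preimage (occupied u \<xi> \<inter> patch z L)) z L \<and> crossing (preimage (occupied u \<xi> \<inter> patch z' L)) z' L}"
    by (simp only: crossing_patch)
  also have "\<dots> \<le> prob {\<xi> \<in> space P. crossing (preimage (occupied u \<xi> \<inter> patch z L)) z L} *
       prob {\<xi> \<in> space P. crossing (preimage (occupied u \<xi> \<inter> patch z' L)) z' L}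
      + u * (\<Sum>x\<in>patch z L. \<Sum>y\<in>patch z' L. measure \<nu> (through x \<inter> through y))"
    by (rule decoupling) (use u intensity_finite crossing_preimage_mono in auto)
  also have "\<dots> = cross_prob u z L * cross_prob u z' L
      + u * (\<Sum>x\<in>patch z L. \<Sum>y\<in>patch z' L. measure \<nu> (through x \<inter> through y))"
    by (simp only: crossing_patch cross_prob_def)
  also have "(\<Sum>x\<in>patch z L. \<Sum>y\<in>patch z' L. measure \<nu> (through x \<inter> through y))
      \<le> (\<Sum>x\<in>patch z L. \<Sum>y\<in>patch z' L. C * real_of_int L powr (- 9 / 2))"
    by (intro sum_mono pair_le)
  also have "\<dots> = real (card (patch z L)) * real (card (patch z' L)) * (C * real_of_int L powr (- 9 / 2))"
    by simp
  also have "\<dots> \<le> (81 * (real_of_int L)\<^sup>2) * (81 * (real_of_int L)\<^sup>2) * (C * real_of_int L powr (- 9 / 2))"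
    using C_pos by (intro mult_right_mono mult_mono card_patch) auto
  also have "\<dots> = 6561 * C * (real_of_int L powr 4 * real_of_int L powr (- 9 / 2))"
    using L by (simp add: power2_eq_square flip: powr_numeral) (simp add: power4_eq_xxxx)
  also have "real_of_int L powr 4 * real_of_int L powr (- 9 / 2) = real_of_int L powr (- 1 / 2)"
    by (simp flip: powr_add)
  finally show ?thesis using u by (simp add: mult_left_mono)
qed

text \<open>
  The union bound over the at most \<open>99\<^sup>4\<close> pairs of centres in \<open>crossing_cascade\<close>.
\<close>

lemma cross_prob_step:
  assumes u: "0 \<le> u" and L: "1 \<le> L" and s: "\<And>z. cross_prob u z L \<le> s"
  shows "cross_prob u z (16 * L) \<le> 99 ^ 4 * (s\<^sup>2 + u * (6561 * C * real_of_int L powr (- 1 / 2)))"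
proof -
  define Idx where "Idx = ({-49..49} \<times> {-49..49} :: (int \<times> int) set)"
  define pos where "pos i = (fst z + L * fst i, snd z + L * snd i)" for i :: "int \<times> int"
  define D where "D = {(i, j) \<in> Idx \<times> Idx. 31 \<le> \<bar>fst i - fst j\<bar> \<or> 31 \<le> \<bar>snd i - snd j\<bar>}"
  define G where "G ij = {\<xi> \<in> space P. crossing (blocked u \<xi>) (pos (fst ij)) L \<and> crossing (blocked u \<xi>) (pos (snd ij)) L}" for ij
  have D: "finite D" "D \<subseteq> Idx \<times> Idx" unfolding D_def Idx_def by (auto intro: finite_subset[of _ "Idx \<times> Idx"] simp: Idx_def)
  have card_D: "card D \<le> 99 ^ 4"
  proof -
    have "card D \<le> card (Idx \<times> Idx)" using D(2) by (intro card_mono) (auto simp: Idx_def)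
    also have "\<dots> = 99 ^ 4" by (simp add: Idx_def card_cartesian_product)
    finally show ?thesis .
  qed
  have G: "G ij \<in> sets P" for ij
    unfolding G_def by (intro sets.sets_Collect_conj crossing_event)
  have s0: "0 \<le> s" using s[of z] measure_nonneg[of P] unfolding cross_prob_def by (meson order_trans)
  have "cross_prob u z (16 * L) \<le> prob (\<Union>ij\<in>D. G ij)"
    unfolding cross_prob_def
  proof (rule finite_measure_mono)
    show "{\<xi> \<in> space P. crossing (blocked u \<xi>) z (16 * L)} \<subseteq> (\<Union>ij\<in>D. G ij)"
    proof
      fix \<xi> assume "\<xi> \<in> {\<xi> \<in> space P. crossing (blocked u \<xi>) z (16 * L)}"
      then obtain i j where "i \<in> Idx" "j \<in> Idx" "crossing (blocked u \<xi>) (pos i) L" "crossing (blocked u \<xi>) (pos j) L"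
        "31 \<le> \<bar>fst i - fst j\<bar> \<or> 31 \<le> \<bar>snd i - snd j\<bar>" "\<xi> \<in> space P"
        using crossing_cascade[of "blocked u \<xi>" z L, OF _ L] unfolding Idx_def pos_def by auto
      then show "\<xi> \<in> (\<Union>ij\<in>D. G ij)" by (intro UN_I[of "(i, j)"]) (auto simp: D_def G_def)
    qed
    show "(\<Union>ij\<in>D. G ij) \<in> sets P" using D G by (intro sets.finite_UN) auto
  qed
  also have "\<dots> \<le> (\<Sum>ij\<in>D. prob (G ij))"
    by (rule measure_UNION_le) (use D G in auto)
  also have "\<dots> \<le> (\<Sum>ij\<in>D. s\<^sup>2 + u * (6561 * C * real_of_int L powr (- 1 / 2)))"
  proof (rule sum_mono)
    fix ij assume "ij \<in> D"
    have dist: "31 * L \<le> \<bar>L * k - L * k'\<bar>" if "31 \<le> \<bar>k - k'\<bar>" for k k' :: int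
    proof -
      have "L * 31 \<le> L * \<bar>k - k'\<bar>" using that L by (intro mult_left_mono) auto
      also have "\<dots> = \<bar>L * k - L * k'\<bar>" using L by (simp add: abs_mult flip: right_diff_distrib)
      finally show ?thesis by simp
    qed
    have "prob (G ij) \<le> cross_prob u (pos (fst ij)) L * cross_prob u (pos (snd ij)) L + u * (6561 * C * real_of_int L powr (- 1 / 2))"
      unfolding G_def by (rule cross_prob_pair[OF u L]) (use \<open>ij \<in> D\<close> dist in \<open>auto simp: D_def pos_def\<close>)
    also have "cross_prob u (pos (fst ij)) L * cross_prob u (pos (snd ij)) L \<le> s * s"
      using s s0 by (intro mult_mono) (auto simp: cross_prob_def)
    finally show "prob (G ij) \<le> s\<^sup>2 + u * (6561 * C * real_of_int L powr (- 1 / 2))" by (simp add: power2_eq_square)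
  qed
  also have "\<dots> = real (card D) * (s\<^sup>2 + u * (6561 * C * real_of_int L powr (- 1 / 2)))" by simp
  also have "\<dots> \<le> real (99 ^ 4) * (s\<^sup>2 + u * (6561 * C * real_of_int L powr (- 1 / 2)))"
    using card_D u C_pos by (intro mult_right_mono of_nat_mono) auto
  finally show ?thesis by simp
qed

text \<open>
  The scales \<open>16\<^sup>n\<close> make the error of order \<open>(16\<^sup>n)\<^sup>-\<^sup>1\<^sup>/\<^sup>2 = 4\<^sup>-\<^sup>n\<close>. By the choice of \<open>\<epsilon>\<close> the quadratic term
  and, for small \<open>u\<close>, the error contribute at most \<open>\<epsilon> / 8\<close> each to the new constant \<open>\<epsilon> / 4\<close>.
\<close>

lemma cross_prob_small:
  fixes \<epsilon> :: real
  assumes eps: "\<epsilon> = 1 / (8 * 99 ^ 4)" and u: "0 \<le> u"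
    and u1: "u * (6561 * C) \<le> \<epsilon> / (8 * 99 ^ 4)"
  shows "cross_prob u z (16 ^ n) \<le> \<epsilon> / 4 ^ n"
proof (induction n arbitrary: z)
  case 0
  have "cross_prob u z 1 \<le> prob (\<Union>y\<in>patch z 1. {\<xi> \<in> space P. y \<in> occupied u \<xi>})"
    unfolding cross_prob_def
  proof (rule finite_measure_mono)
    show "{\<xi> \<in> space P. crossing (blocked u \<xi>) z 1} \<subseteq> (\<Union>y\<in>patch z 1. {\<xi> \<in> space P. y \<in> occupied u \<xi>})"
    proof
      fix \<xi> assume \<xi>: "\<xi> \<in> {\<xi> \<in> space P. crossing (blocked u \<xi>) z 1}"
      then obtain q q' where q: "q \<in> grid_box z 1" "q' \<notin> grid_box z 3" "star_connected (blocked u \<xi> \<inter> grid_box z 4) q q'"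
        by (auto simp: crossing_def)
      have "q \<noteq> q'" using q(1,2) by (auto simp: grid_box_def)
      with q(3) have "q \<in> blocked u \<xi> \<inter> grid_box z 4"
        unfolding star_connected_def by (cases rule: converse_rtranclE) auto
      then show "\<xi> \<in> (\<Union>y\<in>patch z 1. {\<xi> \<in> space P. y \<in> occupied u \<xi>})"
        using \<xi> by (intro UN_I[of "\<phi> q"]) (auto simp: preimage_def patch_def)
    qed
    show "(\<Union>y\<in>patch z 1. {\<xi> \<in> space P. y \<in> occupied u \<xi>}) \<in> sets P"
      by (intro sets.finite_UN occupied_event) simp
  qed
  also have "\<dots> \<le> (\<Sum>y\<in>patch z 1. prob {\<xi> \<in> space P. y \<in> occupied u \<xi>})"
    by (rule measure_UNION_le) (use occupied_event in auto)
  also have "\<dots> \<le> (\<Sum>y\<in>patch z 1. u * C)"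
    by (intro sum_mono order_trans[OF prob_occupied_le[OF u]] mult_left_mono single u)
  also have "\<dots> \<le> 81 * (u * C)"
  proof -
    have "card (patch z 1) \<le> card {q \<in> grid_box z (3 * 1 + 1). 0 \<le> fst q \<and> 0 \<le> snd q}"
      unfolding patch_def by (rule card_image_le) simp
    also have "\<dots> \<le> card (grid_box z 4)" by (rule card_mono) auto
    finally have "real (card (patch z 1)) \<le> 81" using card_grid_box[of 4 z] by simp
    then show ?thesis using u C_pos by (simp add: mult_right_mono)
  qed
  also have "\<dots> \<le> \<epsilon>"
  proof -
    have "81 * (u * C) \<le> u * (6561 * C)" using u C_pos by simp
    also have "\<dots> \<le> \<epsilon> / (8 * 99 ^ 4)" by (rule u1)
    also have "\<dots> \<le> \<epsilon>" by (simp add: eps)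
    finally show ?thesis .
  qed
  finally show ?case by simp
next
  case (Suc n)
  have "real_of_int (16 ^ n) powr (- 1 / 2) = 1 / 4 ^ n"
  proof -
    have "real_of_int (16 ^ n) = (4 ^ n) powr 2" by (simp add: power2_eq_square flip: power_mult_distrib)
    then show ?thesis by (simp add: powr_powr powr_minus_divide)
  qed
  then have "cross_prob u z (16 * 16 ^ n) \<le> 99 ^ 4 * ((\<epsilon> / 4 ^ n)\<^sup>2 + u * (6561 * C * (1 / 4 ^ n)))"
    using cross_prob_step[OF u _ Suc.IH, of z] by simp
  also have "\<dots> \<le> 99 ^ 4 * (\<epsilon>\<^sup>2 / 4 ^ n + \<epsilon> / (8 * 99 ^ 4) / 4 ^ n)"
  proof (intro mult_left_mono add_mono)
    have "(\<epsilon> / 4 ^ n)\<^sup>2 = \<epsilon>\<^sup>2 / 4 ^ n / 4 ^ n" by (simp add: power2_eq_square)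
    also have "\<dots> \<le> \<epsilon>\<^sup>2 / 4 ^ n / 1" by (intro divide_left_mono) auto
    finally show "(\<epsilon> / 4 ^ n)\<^sup>2 \<le> \<epsilon>\<^sup>2 / 4 ^ n" by simp
    show "u * (6561 * C * (1 / 4 ^ n)) \<le> \<epsilon> / (8 * 99 ^ 4) / 4 ^ n"
      using divide_right_mono[OF u1, of "4 ^ n"] by simp
  qed simp
  also have "\<dots> = (99 ^ 4 * \<epsilon> * \<epsilon> + \<epsilon> / 8) / 4 ^ n"
    by (simp add: power2_eq_square add_divide_distrib)
  also have "99 ^ 4 * \<epsilon> = 1 / 8" by (simp add: eps)
  finally show ?case by simp
qed

lemma exists_scale:
  fixes m :: int
  assumes "4 < m"
  obtains n where "4 * 16 ^ n < m" "m \<le> 4 * 16 ^ Suc n"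
proof -
  have "\<exists>n. m \<le> 4 * 16 ^ n"
  proof
    have "nat m < 2 ^ nat m" by (rule less_exp)
    also have "(2::nat) ^ nat m \<le> 16 ^ nat m" by (intro power_mono) auto
    finally have "int (nat m) < int (16 ^ nat m)" by (simp only: of_nat_less_iff)
    then have "m < 16 ^ nat m" using assms by simp
    moreover have "0 \<le> (16::int) ^ nat m" by simp
    ultimately show "m \<le> 4 * 16 ^ nat m" by linarith
  qed
  define N where "N = (LEAST n. m \<le> 4 * 16 ^ n)"
  have N: "m \<le> 4 * 16 ^ N" unfolding N_def using \<open>\<exists>n. _\<close> by (rule LeastI_ex)
  with assms obtain n where n: "N = Suc n" by (cases N) auto
  have "\<not> m \<le> 4 * 16 ^ n" using not_less_Least[of n "\<lambda>n. m \<le> 4 * 16 ^ n"] n unfolding N_def by simp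
  show ?thesis
  proof (rule that)
    show "4 * 16 ^ n < m" using \<open>\<not> m \<le> 4 * 16 ^ n\<close> by linarith
    show "m \<le> 4 * 16 ^ Suc n" using N unfolding n .
  qed
qed

text \<open>
  If the cluster of the corner is finite, a blocked path joins some \<open>(m, 0)\<close> to the vertical axis. For \<open>m \<le> 4\<close>
  the event \<open>A\<close> occurs. Otherwise \<open>4 16\<^sup>n < m \<le> 4 16\<^sup>n\<^sup>+\<^sup>1\<close> for some \<open>n\<close>; with \<open>m\<close> rounded down to a
  multiple \<open>16\<^sup>n k\<close>, the vertical axis lies outside the box of radius \<open>3 16\<^sup>n\<close> around \<open>(16\<^sup>n k, 0)\<close>, and there is a crossing
  at this centre, as in the event \<open>B n\<close>. There are only 61 such centres at each scale.
\<close>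

lemma planar_percolation:
  fixes \<epsilon> :: real
  assumes eps: "\<epsilon> = 1 / (8 * 99 ^ 4)" and u: "0 \<le> u"
    and u1: "u * (6561 * C) \<le> \<epsilon> / (8 * 99 ^ 4)"
  shows "0 < percolation_prob E P I p u (\<phi> (0, 0))"
proof -
  define A where "A = (\<Union>m\<in>{0..4::int}. {\<xi> \<in> space P. \<phi> (m, 0) \<in> occupied u \<xi>})"
  define B where "B n = (\<Union>k\<in>{4..64::int}. {\<xi> \<in> space P. crossing (blocked u \<xi>) (16 ^ n * k, 0) (16 ^ n)})" for n
  have sets: "A \<in> sets P" "B n \<in> sets P" for n
    unfolding A_def B_def by (intro sets.finite_UN occupied_event crossing_event; simp)+
  have eps0: "0 < \<epsilon>" by (simp add: eps)
  have A_le: "prob A \<le> 5 * \<epsilon>"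
  proof -
    have "prob A \<le> (\<Sum>m\<in>{0..4::int}. prob {\<xi> \<in> space P. \<phi> (m, 0) \<in> occupied u \<xi>})"
      unfolding A_def by (rule measure_UNION_le) (use occupied_event in auto)
    also have "\<dots> \<le> (\<Sum>m\<in>{0..4::int}. u * C)"
      by (intro sum_mono order_trans[OF prob_occupied_le[OF u]] mult_left_mono single u)
    also have "\<dots> = 5 * (u * C)" by simp
    also have "u * C \<le> u * (6561 * C)" using u C_pos by (intro mult_left_mono) auto
    also have "u * (6561 * C) \<le> \<epsilon>"
    proof -
      have "\<epsilon> / (8 * 99 ^ 4) \<le> \<epsilon>" using eps0 by simp
      then show ?thesis using u1 by linarith
    qed
    finally show ?thesis by simp
  qed
  have B_le: "prob (B n) \<le> 61 * \<epsilon> * (1 / 4) ^ n" for n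
  proof -
    have "prob (B n) \<le> (\<Sum>k\<in>{4..64::int}. cross_prob u (16 ^ n * k, 0) (16 ^ n))"
      unfolding B_def cross_prob_def by (rule measure_UNION_le) (use crossing_event in auto)
    also have "\<dots> \<le> (\<Sum>k\<in>{4..64::int}. \<epsilon> / 4 ^ n)"
      by (intro sum_mono cross_prob_small[OF eps u u1])
    finally show ?thesis by (simp add: power_divide)
  qed
  have geo: "summable (\<lambda>n. 61 * \<epsilon> * (1 / 4) ^ n)" "(\<Sum>n. 61 * \<epsilon> * (1 / 4) ^ n) = 61 * \<epsilon> * (4 / 3)"
    by (auto simp: suminf_mult suminf_geometric intro!: summable_mult)
  have sumB: "summable (\<lambda>n. prob (B n))"
    by (rule summable_comparison_test'[OF geo(1), of 0]) (use B_le in simp)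
  have "prob (\<Union>n. B n) \<le> (\<Sum>n. prob (B n))"
    by (rule finite_measure_subadditive_countably) (use sets sumB in auto)
  also have "\<dots> \<le> (\<Sum>n. 61 * \<epsilon> * (1 / 4) ^ n)"
    by (rule suminf_le[OF B_le sumB geo(1)])
  finally have UB: "prob (\<Union>n. B n) \<le> 61 * \<epsilon> * (4 / 3)" unfolding geo(2) .
  have "prob (A \<union> (\<Union>n. B n)) \<le> prob A + prob (\<Union>n. B n)"
    by (rule measure_Un_le) (use sets in auto)
  also have "\<dots> \<le> 5 * \<epsilon> + 61 * \<epsilon> * (4 / 3)" using A_le UB by simp
  also have "\<dots> < 1" by (simp add: eps)
  finally have small: "prob (A \<union> (\<Union>n. B n)) < 1" .
  show ?thesis
  proof (rule percolation_prob_pos[OF _ small])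
    show "A \<union> (\<Union>n. B n) \<in> sets P" using sets by auto
    fix \<xi> assume \<xi>: "\<xi> \<in> space P" "\<xi> \<notin> A \<union> (\<Union>n. B n)"
    let ?S = "blocked u \<xi>" and ?V = "vacant_set (I \<xi>) (p \<xi>) u"
    define G where "G = {(q, q'). int_pair q \<notin> ?S \<and> int_pair q' \<notin> ?S \<and> grid_adjacent q q'}"
    define cl where "cl = {q. (0, q) \<in> G\<^sup>*}"
    have free: "(m, 0) \<notin> ?S" if "m \<in> {0..4}" for m
      using \<xi> that by (auto simp: A_def preimage_def)
    have "infinite cl"
    proof
      assume "finite cl"
      then obtain m k where mk: "star_connected ?S (int m, 0) (0, int k)" "(int m, 0) \<in> ?S"
        using finite_cluster_blocked[of ?S] free[of 0] unfolding cl_def G_def by auto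
      then have "4 < int m" using free[of "int m"] by fastforce
      then obtain n where n: "4 * 16 ^ n < int m" "int m \<le> 4 * 16 ^ Suc n" by (rule exists_scale)
      define j where "j = int m div 16 ^ n"
      have near: "16 ^ n * j \<le> int m \<and> int m < 16 ^ n * j + 16 ^ n"
        unfolding j_def by (rule div_mult_near) simp
      have "16 ^ n * 3 < 16 ^ n * j" "16 ^ n * j < 16 ^ n * 65"
        using near n(1) n(2)[unfolded power_Suc] zero_less_power[of "16::int" n] by linarith+
      then have j: "3 < j" "j < 65" by (simp_all only: mult_less_cancel_left_pos zero_less_power zero_less_numeral)
      have "crossing ?S (16 ^ n * j, 0) (16 ^ n)"
      proof (rule star_connected_crossing[OF mk(1)])
        show "(int m, 0) \<in> grid_box (16 ^ n * j, 0) (16 ^ n)" using near by (simp add: grid_box_def)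
        show "(0, int k) \<notin> grid_box (16 ^ n * j, 0) (3 * 16 ^ n)" using j by (simp add: grid_box_def abs_mult)
      qed simp
      then have "\<xi> \<in> B n" using j \<xi>(1) unfolding B_def by (intro UN_I[of j]) auto
      then show False using \<xi>(2) by auto
    qed
    have inj': "inj_on (\<lambda>q. \<phi> (int_pair q)) cl"
    proof (rule inj_onI)
      fix q q' assume "\<phi> (int_pair q) = \<phi> (int_pair q')"
      then have "int_pair q = int_pair q'" by (rule inj_onD[OF inj]) auto
      then show "q = q'" by (simp add: prod_eq_iff)
    qed
    have "(\<lambda>q. \<phi> (int_pair q)) ` cl \<subseteq> component_in E ?V (\<phi> (0, 0))"
    proof clarify
      fix i j assume "(i, j) \<in> cl"
      then have "(0, (i, j)) \<in> G\<^sup>*" by (simp add: cl_def)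
      then have "(\<phi> (0, 0), \<phi> (int_pair (i, j))) \<in> {(y, z). y \<in> ?V \<and> z \<in> ?V \<and> {y, z} \<in> E}\<^sup>*"
      proof (induction rule: rtrancl_induct)
        case base
        then show ?case by simp
      next
        case (step q q')
        have "\<phi> (int_pair q) \<in> ?V" "\<phi> (int_pair q') \<in> ?V" "{\<phi> (int_pair q), \<phi> (int_pair q')} \<in> E"
          using step.hyps(2) adjacent[of q q'] by (auto simp: G_def preimage_def)
        then show ?case using step.IH by (auto intro: rtrancl_into_rtrancl)
      qed
      moreover have "\<phi> (0, 0) \<in> ?V" using free[of 0] by (simp add: preimage_def)
      ultimately show "\<phi> (int_pair (i, j)) \<in> component_in E ?V (\<phi> (0, 0))" by (simp add: component_in_def)
    qed
    then show "infinite (component_in E ?V (\<phi> (0, 0)))"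
      using \<open>infinite cl\<close> finite_imageD[OF _ inj'] finite_subset by blast
  qed
qed

end

section \<open>Positivity of the critical value\<close>

lemma critical_value_pos:
  assumes "0 < u\<^sub>0" "\<And>u. 0 \<le> u \<Longrightarrow> u \<le> u\<^sub>0 \<Longrightarrow> 0 < percolation_prob E P I p u x"
  shows "0 < critical_value E P I p x"
proof -
  have "ereal u\<^sub>0 \<le> critical_value E P I p x"
    unfolding critical_value_def
  proof (rule Inf_greatest)
    fix e assume "e \<in> ereal ` {u. 0 \<le> u \<and> percolation_prob E P I p u x = 0}"
    then obtain u where "e = ereal u" "0 \<le> u" "percolation_prob E P I p u x = 0" by auto
    then show "ereal u\<^sub>0 \<le> e" using assms(2)[of u] by force
  qed
  then show ?thesis using assms(1) by (meson ereal_less(2) less_le_trans)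
qed

theorem theorem4p2:
  fixes E :: "'v::countable set set" and a :: "'v \<Rightarrow> 'v \<Rightarrow> real"
    and P :: "'w measure" and I :: "'w \<Rightarrow> nat set"
    and p :: "'w \<Rightarrow> nat \<Rightarrow> (int \<Rightarrow> 'v \<times> int) set \<times> real"
    and x :: "'v \<times> int"
  assumes "weighted_graph E a"
    and "bounded_degree E"
    and "bounded_weights E a"
    and "isoperimetric_ineq 6 E a"
    and "is_random_interlacement (product_edges E int_edges) (product_weight a int_weight) P I p"
  shows "0 < critical_value (product_edges E int_edges) P I p x"
proof -
  let ?E = "product_edges E int_edges" and ?a = "product_weight a int_weight"
  interpret G: weighted_graph E a by (rule assms(1))
  obtain \<nu> where \<nu>: "is_interlacement_intensity ?E ?a \<nu>"
    and poisson: "poisson_point_process P (\<nu> \<Otimes>\<^sub>M restrict_space lborel {0..}) I p"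
    using assms(5) unfolding is_random_interlacement_def by blast
  have interlacement: "interlacement ?E ?a 2 hi P I p \<nu>" if "bounded_graph ?E ?a 2 hi" for hi
    using that \<nu> poisson by (intro interlacement.intro interlacement_axioms.intro)
  show ?thesis
  proof (cases "E = {}")
    \<comment> \<open>The graph is a single vertex and the product is the line: almost surely nothing is occupied.\<close>
    case True
    obtain hi where bg: "bounded_graph ?E ?a 2 hi"
      using G.bounded_graph_product[OF assms(2,3)] by blast
    interpret R: interlacement ?E ?a 2 hi P I p \<nu> by (rule interlacement[OF bg])
    have zero: "measure \<nu> (R.through y) = 0" for y
    proof (rule order_antisym[OF _ measure_nonneg])
      have "min (equilibrium_measure ?E ?a {y} y) (hi * measure (walk_law ?E ?a y) {w. \<exists>n. w n = y}) \<le> 0"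
        using G.line_recurrent[OF True bg, of y] by (simp add: min.coboundedI1)
      then show "measure \<nu> (R.through y) \<le> 0" using R.measure_through_two[of y y] by simp
    qed
    show ?thesis
    proof (rule critical_value_pos[of 1])
      fix u :: real assume u: "0 \<le> u"
      define B where "B = (\<Union>y. {\<xi> \<in> space P. y \<in> R.occupied u \<xi>})"
      have null: "{\<xi> \<in> space P. y \<in> R.occupied u \<xi>} \<in> null_sets P" for y
        using R.prob_occupied_le[OF u, of y] zero R.occupied_event[of y u] measure_nonneg[of P]
        by (simp add: null_sets_def R.emeasure_eq_measure order_antisym)
      then have B: "B \<in> null_sets P" unfolding B_def by (intro null_sets_UN)
      show "0 < percolation_prob ?E P I p u x"
      proof (rule R.percolation_prob_pos)
        show "B \<in> sets P" using B by blast
        show "R.prob B < 1" using B by (simp add: measure_eq_0_null_sets)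
        fix \<xi> assume "\<xi> \<in> space P" "\<xi> \<notin> B"
        then have "vacant_set (I \<xi>) (p \<xi>) u = UNIV" by (auto simp: B_def)
        then have "component_in ?E (vacant_set (I \<xi>) (p \<xi>) u) x = UNIV"
          using R.connected_edges by (auto simp: component_in_def)
        then show "infinite (component_in ?E (vacant_set (I \<xi>) (p \<xi>) u) x)"
          by (simp add: finite_prod infinite_UNIV_int)
      qed
    qed simp
  next
    case False
    obtain hi \<kappa> where iso: "isoperimetric_graph ?E ?a 2 hi (6 + 1) \<kappa>"
      and fin: "\<And>x. finite {y. {x, y} \<in> E}" and inf: "infinite (UNIV :: 'v set)"
      by (rule G.isoperimetric_graph_product[OF assms(2,3,4) _ False]) auto
    interpret R: isoperimetric_graph ?E ?a 2 hi "6 + 1" \<kappa> by (rule iso)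
    have bg: "bounded_graph ?E ?a 2 hi" by (rule R.bounded_graph_axioms)
    interpret R: interlacement ?E ?a 2 hi P I p \<nu> by (rule interlacement[OF bg])
    obtain v j\<^sub>0 where x: "x = (v, j\<^sub>0)" by (cases x)
    obtain \<gamma> where \<gamma>: "\<gamma> 0 = v" "\<And>i. {\<gamma> i, \<gamma> (Suc i)} \<in> E" "\<And>i. G.graph_dist v (\<gamma> i) = i"
      by (rule G.geodesic_ray[where v = v, OF fin inf]) blast
    \<comment> \<open>Any exponent strictly between 4, twice the dimension of the plane, and 5, the dimension of the product minus two, works; with 9/2 the scales \<open>16\<^sup>n\<close> give the rate \<open>4\<^sup>-\<^sup>n\<close>.\<close>
    obtain C h where C: "0 < C" "\<And>x y. 0 \<le> h x y" "\<And>x y. h x y = of_bool (y = x) + R.avg (h x) y"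
      "\<And>x y \<rho> r. R.edge_lipschitz \<rho> \<Longrightarrow> 0 < r \<Longrightarrow> r \<le> \<bar>\<rho> y - \<rho> x\<bar> \<Longrightarrow> h x y \<le> C * r powr (- (9 / 2))"
      by (rule R.green_function[of "9 / 2"]) auto
    define \<phi> where "\<phi> q = (\<gamma> (nat (fst q)), j\<^sub>0 + snd q)" for q :: "int \<times> int"
    define K where "K = 2 * hi * (C + 1)"
    have hi: "0 < hi" using R.mu_pos[of x] R.weight_le[of x] by linarith
    \<comment> \<open>The distance from \<open>v\<close> and the height separate the points of the quarter plane.\<close>
    have lip1: "R.edge_lipschitz (\<lambda>y. real (G.graph_dist v (fst y)))"
      unfolding R.edge_lipschitz_def
    proof (intro allI impI)
      fix y z assume yz: "{y, z} \<in> ?E"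
      have "G.graph_dist v (fst z) \<le> G.graph_dist v (fst y) + 1 \<and> G.graph_dist v (fst y) \<le> G.graph_dist v (fst z) + 1"
        using yz G.graph_dist_edge[of "fst y" "fst z" v] G.graph_dist_edge[of "fst z" "fst y" v]
        by (cases y; cases z) (auto simp: product_edge_iff insert_commute)
      then show "\<bar>real (G.graph_dist v (fst y)) - real (G.graph_dist v (fst z))\<bar> \<le> 1" by linarith
    qed
    have lip2: "R.edge_lipschitz (\<lambda>y. real_of_int (snd y))"
      unfolding R.edge_lipschitz_def
    proof (intro allI impI)
      fix y z assume yz: "{y, z} \<in> ?E"
      have "\<bar>snd y - snd z\<bar> \<le> 1"
        using yz by (cases y; cases z) (auto simp: product_edge_iff)
      then show "\<bar>real_of_int (snd y) - real_of_int (snd z)\<bar> \<le> 1" by linarith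
    qed
    have pair: "measure \<nu> (R.through y \<inter> R.through z) \<le> 2 * hi * h z y" for y z
    proof -
      have "emeasure (walk_law ?E ?a y) {w. \<exists>n. w n = z} \<le> ennreal (h z y)"
      proof (rule R.hitting_le_superharmonic)
        show "0 \<le> h z y'" for y' by (rule C(2))
        show "of_bool (y' = z) + R.avg (h z) y' \<le> h z y'" for y' using C(3)[of z y'] by linarith
      qed
      then have "measure (walk_law ?E ?a y) {w. \<exists>n. w n = z} \<le> h z y"
        unfolding measure_def using C(2) by (intro enn2real_leI) auto
      then have "hi * measure (walk_law ?E ?a y) {w. \<exists>n. w n = z} \<le> hi * h z y"
        using hi by (intro mult_left_mono) auto
      then show ?thesis using R.measure_through_two[of y z] by linarith
    qed
    interpret S: planar_interlacement ?E ?a 2 hi P I p \<nu> \<phi> K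
    proof
      show "0 < K" using hi C(1) by (simp add: K_def)
      show "measure \<nu> (R.through y) \<le> K" for y
      proof -
        have "hi * measure (walk_law ?E ?a y) {w. \<exists>n. w n = y} \<le> hi * 1"
          using hi prob_space.prob_le_1[OF prob_space_walk_law] by (intro mult_left_mono) auto
        moreover have "0 \<le> hi * C" using hi C(1) by simp
        ultimately show ?thesis using R.measure_through_two[of y y] by (simp add: K_def algebra_simps)
      qed
      show "inj_on \<phi> {q. 0 \<le> fst q \<and> 0 \<le> snd q}"
      proof (rule inj_onI)
        fix q q' :: "int \<times> int"
        assume q: "q \<in> {q. 0 \<le> fst q \<and> 0 \<le> snd q}" "q' \<in> {q. 0 \<le> fst q \<and> 0 \<le> snd q}" "\<phi> q = \<phi> q'"
        then have "nat (fst q) = nat (fst q')" using \<gamma>(3) unfolding \<phi>_def by (metis fst_conv)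
        then show "q = q'" using q by (auto simp: \<phi>_def prod_eq_iff)
      qed
      show "{\<phi> (int_pair q), \<phi> (int_pair q')} \<in> ?E" if "grid_adjacent q q'" for q q'
        using that \<gamma>(2)[of "fst q"] \<gamma>(2)[of "fst q'"]
        by (auto simp: grid_adjacent_def \<phi>_def product_edge_iff insert_commute)
      fix q q' :: "int \<times> int" and r :: real
      assume q: "0 \<le> fst q" "0 \<le> snd q" "0 \<le> fst q'" "0 \<le> snd q'" and r: "0 < r"
        and far: "r \<le> \<bar>real_of_int (fst q - fst q')\<bar> \<or> r \<le> \<bar>real_of_int (snd q - snd q')\<bar>"
      have "h (\<phi> q') (\<phi> q) \<le> C * r powr (- (9 / 2))"
        using far
      proof
        assume "r \<le> \<bar>real_of_int (fst q - fst q')\<bar>"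
        then show ?thesis using q by (intro C(4)[OF lip1 r]) (simp add: \<phi>_def \<gamma>(3))
      next
        assume "r \<le> \<bar>real_of_int (snd q - snd q')\<bar>"
        then show ?thesis by (intro C(4)[OF lip2 r]) (simp add: \<phi>_def)
      qed
      then have "2 * hi * h (\<phi> q') (\<phi> q) \<le> 2 * hi * (C * r powr (- (9 / 2)))"
        using hi by (intro mult_left_mono) auto
      also have "\<dots> \<le> K * r powr (- 9 / 2)" using hi by (simp add: K_def algebra_simps)
      finally show "measure \<nu> (R.through (\<phi> q) \<inter> R.through (\<phi> q')) \<le> K * r powr (- 9 / 2)"
        using pair[of "\<phi> q" "\<phi> q'"] by linarith
    qed
    define \<epsilon> :: real where "\<epsilon> = 1 / (8 * 99 ^ 4)"
    define u\<^sub>0 where "u\<^sub>0 = \<epsilon> / (8 * 99 ^ 4) / (6561 * K)"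
    have x\<phi>: "\<phi> (0, 0) = x" by (simp add: \<phi>_def x \<gamma>(1))
    show ?thesis
    proof (rule critical_value_pos[of u\<^sub>0])
      show "0 < u\<^sub>0" using S.C_pos by (simp add: u\<^sub>0_def \<epsilon>_def)
      fix u assume u: "0 \<le> u" "u \<le> u\<^sub>0"
      then have "u * (6561 * K) \<le> u\<^sub>0 * (6561 * K)" using S.C_pos by (intro mult_right_mono) auto
      also have "\<dots> = \<epsilon> / (8 * 99 ^ 4)" using S.C_pos by (simp add: u\<^sub>0_def)
      finally show "0 < percolation_prob ?E P I p u x"
        using S.planar_percolation[OF \<epsilon>_def u(1)] x\<phi> by simp
    qed
  qed
qed

end
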